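(* Let $s>1$, $T>0$, $h>0$, $1\le p<\infty$, let $E$ be a Banach space with norm $\|\cdot\|_E$ and let $A:D(A)\subseteq E\to E$ be a closed linear operator satisfying the Hille–Yosida condition. Consider the Cauchy problem $$\mathbf{u}'=A\mathbf{u}+\mathbf{f},\qquad \mathbf{u}(0)=u_0. \qquad(\mathrm{ACP})$$ i) (ACP) has an $F$-solution (resp. an $F$-weak solution) in $\tilde{\mathcal{D}}'^{s}_{L^p,h}(0,T;E)$ for every $\mathbf{f}=(\mathbf{F}_\alpha)_\alpha\in\tilde{\mathcal{D}}'^{s}_{L^p,h}(0,T;E)$ and every $u_0=(u_{0,\alpha})_\alpha$ such that $\big(\sum_{\alpha=0}^\infty\frac{\alpha!^{ps}}{h^{p\alpha}}\|u_{0,\alpha}\|_E^p\big)^{1/p}<\infty$ and $u_{0,\alpha}\in\overline{D(A)}$ for all $\alpha\in\mathbb{N}$. In the case of $F$-solution, it is unique. ii) (ACP) has a strict solution (resp. strict weak solution) in $\tilde{\mathcal{D}}'^{s}_{L^p,h}(0,T;E)$ for every $\mathbf{f}=(\mathbf{F}_\alpha)_\alpha\in\tilde{\mathcal{D}}'^{s}_{W^{1,p},h}(0,T;E)$ and every $u_0=(u_{0,\alpha})_\alpha$ such that $u_{0,\alpha}\in D(A)$ and $Au_{0,\alpha}+\mathbf{F}_\alpha(0)\in\overline{D(A)}$ for all $\alpha\in\mathbb{N}$, and $\big(\sum_{\alpha=0}^\infty\frac{\alpha!^{ps}}{h^{p\alpha}}\|u_{0,\alpha}\|_E^p\big)^{1/p}<\infty$,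 $\big(\sum_{\alpha=0}^\infty\frac{\alpha!^{ps}}{h^{p\alpha}}\|Au_{0,\alpha}\|_E^p\big)^{1/p}<\infty$. In the case of strict solution, it is unique.
   Context: Hille–Yosida condition: there are constants $\omega\in\mathbb{R}$, $C>0$ such that every $\lambda>\omega$ belongs to $\rho(A)$ and $\|(\lambda-\omega)^kR(\lambda:A)^k\|\le C$ for all $\lambda>\omega$, $k\in\mathbb{Z}_+$, where $R(\lambda:A)=(\lambda-A)^{-1}$. $D(A)$ (not necessarily dense) carries the graph norm; $q$ is conjugate to $p$. $W^{1,p}(0,T;E)$: all $\mathbf{F}(t)=F_0+\int_0^t\mathbf{F}'(\tau)d\tau$, $t\in[0,T]$, with $F_0\in E$, $\mathbf{F}'\in L^p(0,T;E)$ (Bochner space). For a Banach space $X$, $\tilde{\mathcal{D}}'^s_{L^p,h}(0,T;X)$ is the Banach space of sequences $\mathbf{f}=(\mathbf{F}_\alpha)_{\alpha\in\mathbb{N}}$ in $L^p(0,T;X)$ with norm $\left(\sum_\alpha\frac{\alpha!^{ps}}{h^{p\alpha}}\|\mathbf{F}_\alpha\|^p_{L^p(0,T;X)}\right)^{1/p}<\infty$. $\tilde{\mathcal{D}}'^s_{W^{1,p},h}(0,T;E)$ is the Banach space of sequences $(\mathbf{F}_\alpha)_\alpha$ in $W^{1,p}(0,T;E)$ with norm $\left(\sum_\alpha\frac{\alpha!^{ps}}{h^{p\alpha}}(\|\mathbf{F}_\alpha\|^p_{L^p}+\|\mathbf{F}'_\alpha\|^p_{L^p})\right)^{1/p}<\infty$;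 for such $\mathbf{f}$ put $\mathbf{f}'=(\mathbf{F}'_\alpha)_\alpha$. A sequence $u_0=(u_{0,\alpha})_\alpha$ in $E$ with $\sum_\alpha\frac{\alpha!^{ps}}{h^{p\alpha}}\|u_{0,\alpha}\|_E^p<\infty$ is identified with the sequence of constant functions in $\tilde{\mathcal{D}}'^s_{L^p,h}(0,T;E)$. $\mathcal{D}^s_{L^q,h}(0,T)$ is the Banach space of $\varphi\in\mathcal{C}^\infty(0,T)$ with finite norm $\left(\sum_\alpha h^{q\alpha}\|\varphi^{(\alpha)}\|_{L^q}^q/\alpha!^{qs}\right)^{1/q}$ (sup if $q=\infty$). For $\mathbf{f}=(\mathbf{F}_\alpha)_\alpha\in\tilde{\mathcal{D}}'^s_{L^p,h}(0,T;E)$ and $\varphi\in\mathcal{D}^s_{L^q,h}(0,T)$: $\langle\mathbf{f},\varphi\rangle=\sum_\alpha(-1)^\alpha\int_0^T\mathbf{F}_\alpha(t)\varphi^{(\alpha)}(t)\,dt\in E$. Let $\mathbf{f}\in\tilde{\mathcal{D}}'^s_{L^p,h}(0,T;E)$ and $u_{0,\alpha}\in E$. Strict solution (resp. strict weak solution): $\mathbf{u}=(\mathbf{U}_\alpha)_\alpha\in\tilde{\mathcal{D}}'^s_{W^{1,p},h}(0,T;E)\cap\tilde{\mathcal{D}}'^s_{L^p,h}(0,T;D(A))$ with $\mathbf{U}_\alpha(0)=u_{0,\alpha}$ for all $\alpha$ and $\mathbf{U}'_\alpha(t)=A\mathbf{U}_\alpha(t)+\mathbf{F}_\alpha(t)$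 for a.e. $t\in[0,T]$ and all $\alpha$ (resp. $\langle\mathbf{u}',\varphi\rangle=A\langle\mathbf{u},\varphi\rangle+\langle\mathbf{f},\varphi\rangle$ for all $\varphi\in\mathcal{D}^s_{L^q,h}(0,T)$). $F$-solution (resp. $F$-weak solution): $\mathbf{u}\in\tilde{\mathcal{D}}'^s_{L^p,h}(0,T;E)$ such that there are $\mathbf{u}_k=(\mathbf{U}_{k,\alpha})_\alpha\in\tilde{\mathcal{D}}'^s_{W^{1,p},h}(0,T;E)\cap\tilde{\mathcal{D}}'^s_{L^p,h}(0,T;D(A))$, $\mathbf{f}_k=(\mathbf{F}_{k,\alpha})_\alpha\in\tilde{\mathcal{D}}'^s_{L^p,h}(0,T;E)$ and $u_{0,k}=(u_{0,k,\alpha})_\alpha$, $k\in\mathbb{N}$, with $\mathbf{U}_{k,\alpha}(0)=u_{0,k,\alpha}$, such that $\mathbf{U}'_{k,\alpha}(t)=A\mathbf{U}_{k,\alpha}(t)+\mathbf{F}_{k,\alpha}(t)$ for a.e. $t$ and all $\alpha$, and $\mathbf{u}_k\to\mathbf{u}$, $\mathbf{f}_k\to\mathbf{f}$, $u_{0,k}\to u_0$ in the norm of $\tilde{\mathcal{D}}'^s_{L^p,h}(0,T;E)$ (resp. such that for all $\varphi\in\mathcal{D}^s_{L^q,h}(0,T)$: $\langle\mathbf{u}'_k,\varphi\rangle=A\langle\mathbf{u}_k,\varphi\rangle+\langle\mathbf{f}_k,\varphi\rangle$ and $\|\langle\mathbf{u}_k-\mathbf{u},\varphi\rangle\|_E+\|\langle\mathbf{f}_k-\mathbf{f},\varphi\rangle\|_E+\|\langle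 u_{0,k}-u_0,\varphi\rangle\|_E\to0$). *)

theory Defs
  imports "HOL-Analysis.Analysis" "HOL-Probability.Essential_Supremum"
begin

text \<open>
  The Bochner integral of the library asks for a second countable target space.  Banach spaces
  here need not be separable, so strong (Bochner) measurability and the integral are
  defined for all Banach spaces.

  A Banach space \<open>X\<close> is given by a linear subspace \<open>V\<close> of the type together with a norm \<open>N\<close> on
  \<open>V\<close>: \<open>E\<close> itself is \<open>(UNIV, norm)\<close>, and \<open>D(A)\<close> is \<open>D\<close> with the graph norm of \<open>A\<close>.

  Scalars are real.  A complex Banach space with a complex-linear operator is covered through its
  underlying real space: the condition on the resolvent only involves real spectral parameters, and the pairing with
  a complex test function is determined by the pairings with its real and imaginary parts.
\<close>

definition strongly_measurable ::
  "real measure \<Rightarrow> 'a::real_vector set \<Rightarrow> ('a \<Rightarrow> real) \<Rightarrow> (real \<Rightarrow> 'a) \<Rightarrow> bool" where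
  "strongly_measurable M V N F \<longleftrightarrow>
     (AE t in M. F t \<in> V) \<and>
     (\<exists>S. (\<forall>n. simple_function M (S n) \<and> S n ` space M \<subseteq> V) \<and>
          (AE t in M. (\<lambda>n. N (S n t - F t)) \<longlonglongrightarrow> 0))"

text \<open>Same definition as the library's \<^const>\<open>has_bochner_integral\<close>, with strong measurability
  in place of Borel measurability.\<close>

definition has_strong_integral ::
  "real measure \<Rightarrow> (real \<Rightarrow> 'a::real_normed_vector) \<Rightarrow> 'a \<Rightarrow> bool" where
  "has_strong_integral M F x \<longleftrightarrow>
     strongly_measurable M UNIV norm F \<and>
     (\<exists>S. (\<forall>n. Bochner_Integration.simple_bochner_integrable M (S n)) \<and>
          (\<lambda>n. \<integral>\<^sup>+ t. ennreal (norm (F t - S n t)) \<partial>M) \<longlonglongrightarrow> 0 \<and>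
          (\<lambda>n. Bochner_Integration.simple_bochner_integral M (S n)) \<longlonglongrightarrow> x)"

definition strong_integral :: "real measure \<Rightarrow> (real \<Rightarrow> 'a::real_normed_vector) \<Rightarrow> 'a" where
  "strong_integral M F = (THE x. has_strong_integral M F x)"

text \<open>The \<open>p\<close>-th power of the norm of \<open>L\<^sup>p(0,T;X)\<close>.\<close>

definition Lp_norm_pow :: "real \<Rightarrow> real \<Rightarrow> ('a \<Rightarrow> real) \<Rightarrow> (real \<Rightarrow> 'a) \<Rightarrow> ennreal" where
  "Lp_norm_pow T p N F = (\<integral>\<^sup>+ t. ennreal (N (F t) powr p) \<partial>lebesgue_on {0<..<T})"

definition Lp_space ::
  "real \<Rightarrow> real \<Rightarrow> 'a::real_vector set \<Rightarrow> ('a \<Rightarrow> real) \<Rightarrow> (real \<Rightarrow> 'a) set" where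
  "Lp_space T p V N =
     {F. strongly_measurable (lebesgue_on {0<..<T}) V N F \<and> Lp_norm_pow T p N F < \<infinity>}"

definition is_sobolev_deriv ::
  "real \<Rightarrow> real \<Rightarrow> (real \<Rightarrow> 'a::real_normed_vector) \<Rightarrow> (real \<Rightarrow> 'a) \<Rightarrow> bool" where
  "is_sobolev_deriv T p F G \<longleftrightarrow>
     G \<in> Lp_space T p UNIV norm \<and>
     (\<exists>F\<^sub>0. \<forall>t\<in>{0..T}. F t = F\<^sub>0 + strong_integral (lebesgue_on {0..t}) G)"

definition W1p_space :: "real \<Rightarrow> real \<Rightarrow> (real \<Rightarrow> 'a::real_normed_vector) set" where
  "W1p_space T p = {F. \<exists>G. is_sobolev_deriv T p F G}"

text \<open>\<open>F'\<close> is determined up to a null set; the choice of a representative is immaterial.\<close>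

definition sobolev_deriv ::
  "real \<Rightarrow> real \<Rightarrow> (real \<Rightarrow> 'a::real_normed_vector) \<Rightarrow> real \<Rightarrow> 'a" where
  "sobolev_deriv T p F = (SOME G. is_sobolev_deriv T p F G)"


subsection \<open>Spaces of sequences\<close>

definition weight :: "real \<Rightarrow> real \<Rightarrow> real \<Rightarrow> nat \<Rightarrow> real" where
  "weight p s h \<alpha> = fact \<alpha> powr (p * s) / h powr (p * real \<alpha>)"

definition seq_Lp_norm_pow ::
  "real \<Rightarrow> real \<Rightarrow> real \<Rightarrow> real \<Rightarrow> ('a \<Rightarrow> real) \<Rightarrow> (nat \<Rightarrow> real \<Rightarrow> 'a) \<Rightarrow> ennreal" where
  "seq_Lp_norm_pow T p s h N f = (\<Sum>\<alpha>. ennreal (weight p s h \<alpha>) * Lp_norm_pow T p N (f \<alpha>))"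

definition seq_Lp ::
  "real \<Rightarrow> real \<Rightarrow> real \<Rightarrow> real \<Rightarrow> 'a::real_vector set \<Rightarrow> ('a \<Rightarrow> real) \<Rightarrow> (nat \<Rightarrow> real \<Rightarrow> 'a) set" where
  "seq_Lp T p s h V N =
     {f. (\<forall>\<alpha>. f \<alpha> \<in> Lp_space T p V N) \<and> seq_Lp_norm_pow T p s h N f < \<infinity>}"

text \<open>Only meaningful on \<^const>\<open>seq_Lp\<close>, as \<^const>\<open>enn2real\<close> sends \<open>\<infinity>\<close> to \<open>0\<close>.\<close>

definition seq_Lp_norm ::
  "real \<Rightarrow> real \<Rightarrow> real \<Rightarrow> real \<Rightarrow> ('a \<Rightarrow> real) \<Rightarrow> (nat \<Rightarrow> real \<Rightarrow> 'a) \<Rightarrow> real" where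
  "seq_Lp_norm T p s h N f = enn2real (seq_Lp_norm_pow T p s h N f) powr (1 / p)"

definition seq_deriv ::
  "real \<Rightarrow> real \<Rightarrow> (nat \<Rightarrow> real \<Rightarrow> 'a::real_normed_vector) \<Rightarrow> nat \<Rightarrow> real \<Rightarrow> 'a" where
  "seq_deriv T p f = (\<lambda>\<alpha>. sobolev_deriv T p (f \<alpha>))"

definition seq_W1p ::
  "real \<Rightarrow> real \<Rightarrow> real \<Rightarrow> real \<Rightarrow> (nat \<Rightarrow> real \<Rightarrow> 'a::real_normed_vector) set" where
  "seq_W1p T p s h =
     {f. (\<forall>\<alpha>. f \<alpha> \<in> W1p_space T p) \<and>
         (\<Sum>\<alpha>. ennreal (weight p s h \<alpha>) *
               (Lp_norm_pow T p norm (f \<alpha>) + Lp_norm_pow T p norm (seq_deriv T p f \<alpha>))) < \<infinity>}"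

definition const_seq :: "(nat \<Rightarrow> 'a) \<Rightarrow> nat \<Rightarrow> real \<Rightarrow> 'a" where
  "const_seq v = (\<lambda>\<alpha> t. v \<alpha>)"

definition weighted_summable ::
  "real \<Rightarrow> real \<Rightarrow> real \<Rightarrow> (nat \<Rightarrow> 'a::real_normed_vector) \<Rightarrow> bool" where
  "weighted_summable p s h v \<longleftrightarrow> summable (\<lambda>\<alpha>. weight p s h \<alpha> * norm (v \<alpha>) powr p)"


subsection \<open>Test functions\<close>

text \<open>Functions on \<open>(0,T)\<close> are represented by functions on the reals; the values outside the
  open interval are irrelevant, also for the iterated derivatives inside it.\<close>

definition test_functions :: "real \<Rightarrow> ennreal \<Rightarrow> real \<Rightarrow> real \<Rightarrow> (real \<Rightarrow> real) set" where
  "test_functions T q s h =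
     {\<phi>. (\<forall>\<alpha>. \<forall>t\<in>{0<..<T}. ((deriv ^^ \<alpha>) \<phi>) differentiable (at t)) \<and>
         (if q = \<infinity>
          then (SUP \<alpha>. ennreal (h ^ \<alpha> / fact \<alpha> powr s) *
                  esssup (lebesgue_on {0<..<T}) (\<lambda>t. ennreal \<bar>(deriv ^^ \<alpha>) \<phi> t\<bar>)) < \<infinity>
          else (\<Sum>\<alpha>. ennreal (h powr (enn2real q * real \<alpha>) / fact \<alpha> powr (enn2real q * s)) *
                  (\<integral>\<^sup>+ t. ennreal (\<bar>(deriv ^^ \<alpha>) \<phi> t\<bar> powr enn2real q) \<partial>lebesgue_on {0<..<T})) < \<infinity>)}"

definition pairing ::
  "real \<Rightarrow> (nat \<Rightarrow> real \<Rightarrow> 'a::real_normed_vector) \<Rightarrow> (real \<Rightarrow> real) \<Rightarrow> 'a" where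
  "pairing T f \<phi> =
     (\<Sum>\<alpha>. (- 1) ^ \<alpha> *\<^sub>R
           strong_integral (lebesgue_on {0<..<T}) (\<lambda>t. (deriv ^^ \<alpha>) \<phi> t *\<^sub>R f \<alpha> t))"


subsection \<open>Operators\<close>

text \<open>An operator \<open>A : D(A) \<subseteq> E \<rightarrow> E\<close> is a pair of a set \<open>D\<close> and a function \<open>A\<close> whose values
  outside \<open>D\<close> are irrelevant.\<close>

definition closed_linear_operator ::
  "'a::real_normed_vector set \<Rightarrow> ('a \<Rightarrow> 'a) \<Rightarrow> bool" where
  "closed_linear_operator D A \<longleftrightarrow>
     subspace D \<and>
     (\<forall>x\<in>D. \<forall>y\<in>D. A (x + y) = A x + A y) \<and>
     (\<forall>c. \<forall>x\<in>D. A (c *\<^sub>R x) = c *\<^sub>R A x) \<and>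
     closed {(x, A x) |x. x \<in> D}"

definition graph_norm :: "('a::real_normed_vector \<Rightarrow> 'a) \<Rightarrow> 'a \<Rightarrow> real" where
  "graph_norm A x = norm x + norm (A x)"

definition resolvent ::
  "'a::real_normed_vector set \<Rightarrow> ('a \<Rightarrow> 'a) \<Rightarrow> real \<Rightarrow> 'a \<Rightarrow> 'a" where
  "resolvent D A \<mu> = inv_into D (\<lambda>x. \<mu> *\<^sub>R x - A x)"

definition resolvent_set ::
  "'a::real_normed_vector set \<Rightarrow> ('a \<Rightarrow> 'a) \<Rightarrow> real set" where
  "resolvent_set D A =
     {\<mu>. bij_betw (\<lambda>x. \<mu> *\<^sub>R x - A x) D UNIV \<and> bounded_linear (resolvent D A \<mu>)}"

definition hille_yosida ::
  "'a::real_normed_vector set \<Rightarrow> ('a \<Rightarrow> 'a) \<Rightarrow> bool" where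
  "hille_yosida D A \<longleftrightarrow>
     (\<exists>\<omega> C. C > 0 \<and>
        (\<forall>\<mu>>\<omega>. \<mu> \<in> resolvent_set D A \<and>
           (\<forall>k\<ge>1. onorm (\<lambda>x. (\<mu> - \<omega>) ^ k *\<^sub>R (resolvent D A \<mu> ^^ k) x) \<le> C)))"


subsection \<open>Solutions of the Cauchy problem\<close>

definition regular_seqs ::
  "real \<Rightarrow> real \<Rightarrow> real \<Rightarrow> real \<Rightarrow> 'a::real_normed_vector set \<Rightarrow> ('a \<Rightarrow> 'a) \<Rightarrow>
   (nat \<Rightarrow> real \<Rightarrow> 'a) set" where
  "regular_seqs T p s h D A = seq_W1p T p s h \<inter> seq_Lp T p s h D (graph_norm A)"

definition equation_ae ::
  "real \<Rightarrow> real \<Rightarrow> ('a::real_normed_vector \<Rightarrow> 'a) \<Rightarrow>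
   (nat \<Rightarrow> real \<Rightarrow> 'a) \<Rightarrow> (nat \<Rightarrow> real \<Rightarrow> 'a) \<Rightarrow> bool" where
  "equation_ae T p A f u \<longleftrightarrow>
     (\<forall>\<alpha>. AE t in lebesgue_on {0..T}. seq_deriv T p u \<alpha> t = A (u \<alpha> t) + f \<alpha> t)"

text \<open>As \<open>A\<close> is a total function, that the pairing lies in the domain has to be said explicitly.\<close>

definition equation_weak ::
  "real \<Rightarrow> real \<Rightarrow> ennreal \<Rightarrow> real \<Rightarrow> real \<Rightarrow> 'a::real_normed_vector set \<Rightarrow> ('a \<Rightarrow> 'a) \<Rightarrow>
   (nat \<Rightarrow> real \<Rightarrow> 'a) \<Rightarrow> (nat \<Rightarrow> real \<Rightarrow> 'a) \<Rightarrow> bool" where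
  "equation_weak T p q s h D A f u \<longleftrightarrow>
     (\<forall>\<phi>\<in>test_functions T q s h.
        pairing T u \<phi> \<in> D \<and>
        pairing T (seq_deriv T p u) \<phi> = A (pairing T u \<phi>) + pairing T f \<phi>)"

definition strict_solution ::
  "real \<Rightarrow> real \<Rightarrow> real \<Rightarrow> real \<Rightarrow> 'a::real_normed_vector set \<Rightarrow> ('a \<Rightarrow> 'a) \<Rightarrow>
   (nat \<Rightarrow> real \<Rightarrow> 'a) \<Rightarrow> (nat \<Rightarrow> 'a) \<Rightarrow> (nat \<Rightarrow> real \<Rightarrow> 'a) \<Rightarrow> bool" where
  "strict_solution T p s h D A f u\<^sub>0 u \<longleftrightarrow>
     u \<in> regular_seqs T p s h D A \<and> (\<forall>\<alpha>. u \<alpha> 0 = u\<^sub>0 \<alpha>) \<and> equation_ae T p A f u"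

definition strict_weak_solution ::
  "real \<Rightarrow> real \<Rightarrow> ennreal \<Rightarrow> real \<Rightarrow> real \<Rightarrow> 'a::real_normed_vector set \<Rightarrow> ('a \<Rightarrow> 'a) \<Rightarrow>
   (nat \<Rightarrow> real \<Rightarrow> 'a) \<Rightarrow> (nat \<Rightarrow> 'a) \<Rightarrow> (nat \<Rightarrow> real \<Rightarrow> 'a) \<Rightarrow> bool" where
  "strict_weak_solution T p q s h D A f u\<^sub>0 u \<longleftrightarrow>
     u \<in> regular_seqs T p s h D A \<and> (\<forall>\<alpha>. u \<alpha> 0 = u\<^sub>0 \<alpha>) \<and> equation_weak T p q s h D A f u"

text \<open>\<open>f\<close> and \<open>u\<^sub>0\<close> are understood to lie in the respective sequence spaces, so that all the
  differences below have finite norm.\<close>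

definition F_solution ::
  "real \<Rightarrow> real \<Rightarrow> real \<Rightarrow> real \<Rightarrow> 'a::real_normed_vector set \<Rightarrow> ('a \<Rightarrow> 'a) \<Rightarrow>
   (nat \<Rightarrow> real \<Rightarrow> 'a) \<Rightarrow> (nat \<Rightarrow> 'a) \<Rightarrow> (nat \<Rightarrow> real \<Rightarrow> 'a) \<Rightarrow> bool" where
  "F_solution T p s h D A f u\<^sub>0 u \<longleftrightarrow>
     u \<in> seq_Lp T p s h UNIV norm \<and>
     (\<exists>(U :: nat \<Rightarrow> nat \<Rightarrow> real \<Rightarrow> 'a) (F :: nat \<Rightarrow> nat \<Rightarrow> real \<Rightarrow> 'a) (v :: nat \<Rightarrow> nat \<Rightarrow> 'a).
        (\<forall>k. U k \<in> regular_seqs T p s h D A \<and>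
             F k \<in> seq_Lp T p s h UNIV norm \<and>
             weighted_summable p s h (v k) \<and>
             (\<forall>\<alpha>. U k \<alpha> 0 = v k \<alpha>) \<and>
             equation_ae T p A (F k) (U k)) \<and>
        (\<lambda>k. seq_Lp_norm T p s h norm (\<lambda>\<alpha> t. U k \<alpha> t - u \<alpha> t)) \<longlonglongrightarrow> 0 \<and>
        (\<lambda>k. seq_Lp_norm T p s h norm (\<lambda>\<alpha> t. F k \<alpha> t - f \<alpha> t)) \<longlonglongrightarrow> 0 \<and>
        (\<lambda>k. seq_Lp_norm T p s h norm (const_seq (\<lambda>\<alpha>. v k \<alpha> - u\<^sub>0 \<alpha>))) \<longlonglongrightarrow> 0)"

definition F_weak_solution ::
  "real \<Rightarrow> real \<Rightarrow> ennreal \<Rightarrow> real \<Rightarrow> real \<Rightarrow> 'a::real_normed_vector set \<Rightarrow> ('a \<Rightarrow> 'a) \<Rightarrow>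
   (nat \<Rightarrow> real \<Rightarrow> 'a) \<Rightarrow> (nat \<Rightarrow> 'a) \<Rightarrow> (nat \<Rightarrow> real \<Rightarrow> 'a) \<Rightarrow> bool" where
  "F_weak_solution T p q s h D A f u\<^sub>0 u \<longleftrightarrow>
     u \<in> seq_Lp T p s h UNIV norm \<and>
     (\<exists>(U :: nat \<Rightarrow> nat \<Rightarrow> real \<Rightarrow> 'a) (F :: nat \<Rightarrow> nat \<Rightarrow> real \<Rightarrow> 'a) (v :: nat \<Rightarrow> nat \<Rightarrow> 'a).
        (\<forall>k. U k \<in> regular_seqs T p s h D A \<and>
             F k \<in> seq_Lp T p s h UNIV norm \<and>
             weighted_summable p s h (v k) \<and>
             (\<forall>\<alpha>. U k \<alpha> 0 = v k \<alpha>) \<and>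
             equation_weak T p q s h D A (F k) (U k)) \<and>
        (\<forall>\<phi>\<in>test_functions T q s h.
           (\<lambda>k. norm (pairing T (\<lambda>\<alpha> t. U k \<alpha> t - u \<alpha> t) \<phi>) +
                norm (pairing T (\<lambda>\<alpha> t. F k \<alpha> t - f \<alpha> t) \<phi>) +
                norm (pairing T (const_seq (\<lambda>\<alpha>. v k \<alpha> - u\<^sub>0 \<alpha>)) \<phi>)) \<longlonglongrightarrow> 0))"

end

theory Submission
  imports Defs
begin

text \<open>
  Put \<open>F(t) = \<integral>\<^sub>0\<^sup>t f\<close>.  Everything rests on the integrated equation \<open>v(t) = x + A \<integral>\<^sub>0\<^sup>t v + F(t)\<close>.
  For \<open>f = 0\<close> and \<open>x\<close> in the closure of \<open>D(A)\<close> it is solved by the semigroup obtained from the Yosida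
  approximations; for a polynomial \<open>f\<close> one integrates repeatedly in time.  Its solutions satisfy
  \<open>\<parallel>v(t)\<parallel> \<le> K (\<parallel>x\<parallel> + \<integral> \<parallel>f\<parallel>)\<close>, and polynomials are dense in the Bochner space \<open>L\<^sup>1\<close>, so there is a unique
  solution for all \<open>x\<close> in the closure of \<open>D(A)\<close> and \<open>f \<in> L\<^sup>1\<close>.  If \<open>v\<close> is the solution for the data
  \<open>A x + f(0)\<close> and \<open>f'\<close>, then \<open>u(t) = x + \<integral>\<^sub>0\<^sup>t v\<close> satisfies \<open>A u = v - f\<close>, which is the strict equation;
  conversely strict solutions and limits of strict solutions solve the integrated equation.  The
  estimate does not depend on the index of the sequence, hence it passes to the weighted norms.
  For the pairings with test functions, \<open>A\<close> is replaced by its bounded resolvent: the equation says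
  \<open>u = R(l)(l u - u' + f)\<close>, and bounded operators commute with the integral and with the series.
\<close>

section \<open>The integral in a general Banach space\<close>

text \<open>The domain need not be dense, so there is a semigroup only on the closure of
  \<open>D\<close>, whereas the forcing takes values in all of \<open>E\<close>; variation of
  constants cannot even be written down for it. This is why the integrated equation is the central
  notion, why constant forcing \<open>y\<close> is solved through \<open>R l y\<close>, which does
  lie in \<open>D\<close>, and why the bound by the \<open>L1\<close> norm of the forcing has to be
  proved for an arbitrary solution instead of being read off a formula. The constant
  \<open>C\<close> need not be 1, so the growth of the approximating exponentials is taken from
  bounds on all powers of the resolvent at once. The condition on \<open>A x + f(0)\<close> says
  that the time derivative has an admissible initial value. For F-solutions it is not among the
  hypotheses; it is enforced by changing the forcing near time 0, which costs arbitrarily little in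
  \<open>Lp\<close> because \<open>p\<close> is finite.\<close>

lemma powr_add_le:
  fixes a b p :: real
  assumes "a \<ge> 0" "b \<ge> 0" "p \<ge> 0"
  shows "(a + b) powr p \<le> 2 powr p * (a powr p + b powr p)"
proof -
  have "(a + b) powr p \<le> (2 * max a b) powr p"
    using assms by (intro powr_mono2) auto
  also have "\<dots> = 2 powr p * max a b powr p"
    using assms by (subst powr_mult) auto
  also have "max a b powr p \<le> a powr p + b powr p"
    by (simp add: max_def)
  finally show ?thesis by simp
qed

text \<open>Strong measurability restricts a function only up to a null set; completeness is what
  still makes real functions built from it, such as its norm, measurable.\<close>

lemma (in complete_measure) borel_measurable_AE_eq:
  assumes g: "g \<in> borel_measurable M" and eq: "AE t in M. f t = g t"
  shows "f \<in> borel_measurable M"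
proof (rule measurableI)
  fix A :: "'b set" assume A: "A \<in> sets borel"
  show "f -` A \<inter> space M \<in> sets M"
  proof (rule in_sets_AE)
    show "AE x in M. (x \<in> g -` A \<inter> space M) = (x \<in> f -` A \<inter> space M)"
      using eq by eventually_elim auto
  qed (use g A in auto)
qed simp

lemma complete_measure_lebesgue_on:
  assumes "A \<in> sets lebesgue"
  shows "complete_measure (lebesgue_on A)"
proof
  fix B N :: "'a set" assume "B \<subseteq> N" "N \<in> null_sets (lebesgue_on A)"
  then have "N \<in> null_sets lebesgue" "B \<subseteq> A"
    using assms by (auto simp: null_sets_restrict_space dest: sets.sets_into_space)
  with \<open>B \<subseteq> N\<close> have "B \<in> sets lebesgue"
    by (meson completion.complete2 null_setsD2)
  with \<open>B \<subseteq> A\<close> show "B \<in> sets (lebesgue_on A)"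
    using assms by (simp add: sets_restrict_space_iff)
qed

lemma simple_bochner_integral_diff_le:
  fixes s t :: "'b \<Rightarrow> 'a::real_normed_vector"
  assumes s: "Bochner_Integration.simple_bochner_integrable M s" and t: "Bochner_Integration.simple_bochner_integrable M t"
  shows "ennreal (norm (Bochner_Integration.simple_bochner_integral M s - Bochner_Integration.simple_bochner_integral M t)) \<le> (\<integral>\<^sup>+ x. norm (s x - t x) \<partial>M)"
proof -
  have "ennreal (norm (Bochner_Integration.simple_bochner_integral M s - Bochner_Integration.simple_bochner_integral M t)) = norm (Bochner_Integration.simple_bochner_integral M (\<lambda>x. s x - t x))"
    by (simp add: simple_bochner_integral_diff[OF s t])
  also have "\<dots> \<le> Bochner_Integration.simple_bochner_integral M (\<lambda>x. norm (s x - t x))"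
    using simple_bochner_integrable_compose2[of "(-)" M "s" "t"] s t
    by (auto intro!: simple_bochner_integral_norm_bound ennreal_leI)
  also have "\<dots> = (\<integral>\<^sup>+x. norm (s x - t x) \<partial>M)"
    using simple_bochner_integrable_compose2[of "\<lambda>x y. norm (x - y)" M "s" "t"] s t
    by (auto intro!: simple_bochner_integral_eq_nn_integral)
  finally show ?thesis .
qed

section \<open>Strong measurability, integrability and the integral over a complete measure\<close>

definition strongly_integrable :: "real measure \<Rightarrow> (real \<Rightarrow> 'a::real_normed_vector) \<Rightarrow> bool" where
  "strongly_integrable M F \<longleftrightarrow>
     strongly_measurable M UNIV norm F \<and> (\<integral>\<^sup>+t. ennreal (norm (F t)) \<partial>M) < \<infinity>"

locale complete_real_measure = complete_measure M for M :: "real measure"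
begin

abbreviation smeas :: "(real \<Rightarrow> 'a::real_normed_vector) \<Rightarrow> bool" where
  "smeas F \<equiv> strongly_measurable M UNIV norm F"

lemma smeas_iff:
  "smeas F \<longleftrightarrow> (\<exists>S. (\<forall>n. simple_function M (S n)) \<and> (AE t in M. (\<lambda>n. S n t) \<longlonglongrightarrow> F t))"
  by (simp add: strongly_measurable_def tendsto_norm_zero_iff LIM_zero_iff)

lemma smeasE:
  assumes "smeas F"
  obtains S where "\<forall>n. simple_function M (S n)" "AE t in M. (\<lambda>n. S n t) \<longlonglongrightarrow> F t"
  using assms[unfolded smeas_iff] by (elim exE conjE)

lemma smeas_simple: "simple_function M F \<Longrightarrow> smeas F"
  unfolding smeas_iff by (intro exI[of _ "\<lambda>_. F"]) auto

lemma smeas_const [simp]: "smeas (\<lambda>_. c)"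
  by (rule smeas_simple) simp

text \<open>Combining the approximating simple functions pointwise asks of \<open>f\<close> only
  sequential continuity in both arguments together; sums, scalar multiples and bounded linear images
  are the instances.\<close>

lemma smeas_compose2:
  assumes F: "smeas F" and G: "smeas G"
    and f: "\<And>a b X Y. X \<longlonglongrightarrow> a \<Longrightarrow> Y \<longlonglongrightarrow> b \<Longrightarrow> (\<lambda>n. f (X n) (Y n)) \<longlonglongrightarrow> f a b"
  shows "smeas (\<lambda>t. f (F t) (G t))"
proof -
  obtain S where "\<forall>n. simple_function M (S n)" and *: "AE t in M. (\<lambda>n. S n t) \<longlonglongrightarrow> F t"
    by (rule smeasE[OF F])
  note S = this(1)[rule_format] *
  obtain S' where "\<forall>n. simple_function M (S' n)" and *: "AE t in M. (\<lambda>n. S' n t) \<longlonglongrightarrow> G t"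
    by (rule smeasE[OF G])
  note S' = this(1)[rule_format] *
  show ?thesis
    unfolding smeas_iff
  proof (intro exI conjI allI)
    show "simple_function M (\<lambda>t. f (S n t) (S' n t))" for n
      by (rule simple_function_compose2[OF S(1) S'(1)])
    show "AE t in M. (\<lambda>n. f (S n t) (S' n t)) \<longlonglongrightarrow> f (F t) (G t)"
      using S(2) S'(2) by eventually_elim (rule f)
  qed
qed

lemma smeas_add: "smeas F \<Longrightarrow> smeas G \<Longrightarrow> smeas (\<lambda>t. F t + G t)"
  by (rule smeas_compose2[of F G "(+)"]) (auto intro: tendsto_add)

lemma smeas_diff: "smeas F \<Longrightarrow> smeas G \<Longrightarrow> smeas (\<lambda>t. F t - G t)"
  by (rule smeas_compose2[of F G "(-)"]) (auto intro: tendsto_diff)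

lemma smeas_linear: "bounded_linear f \<Longrightarrow> smeas F \<Longrightarrow> smeas (\<lambda>t. f (F t))"
  by (rule smeas_compose2[of F F "\<lambda>a _. f a"]) (auto intro: bounded_linear.tendsto)

lemma smeas_real: "\<phi> \<in> borel_measurable M \<Longrightarrow> smeas (\<phi> :: real \<Rightarrow> real)"
  using borel_measurable_implies_sequence_metric[of \<phi> M 0] unfolding smeas_iff by blast

lemma smeas_scaleR: "\<phi> \<in> borel_measurable M \<Longrightarrow> smeas F \<Longrightarrow> smeas (\<lambda>t. \<phi> t *\<^sub>R F t)"
  by (rule smeas_compose2[OF smeas_real, of \<phi> F scaleR]) (auto intro: tendsto_scaleR)

lemma smeas_cong_AE: "smeas F \<Longrightarrow> AE t in M. F t = G t \<Longrightarrow> smeas G"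
  unfolding smeas_iff by (elim ex_forward conj_forward) (auto elim: AE_mp)

lemma smeas_norm:
  assumes "smeas F"
  shows "(\<lambda>t. norm (F t)) \<in> borel_measurable M"
proof -
  obtain S where "\<forall>n. simple_function M (S n)" and *: "AE t in M. (\<lambda>n. S n t) \<longlonglongrightarrow> F t"
    by (rule smeasE[OF assms])
  note S = this(1)[rule_format] *
  have [measurable]: "(\<lambda>t. norm (S n t)) \<in> borel_measurable M" for n
    by (rule borel_measurable_simple_function[OF simple_function_compose1[OF S(1)]])
  have "(\<lambda>t. lim (\<lambda>n. norm (S n t))) \<in> borel_measurable M"
    by measurable
  moreover have "AE t in M. norm (F t) = lim (\<lambda>n. norm (S n t))"
    using S(2) by eventually_elim (metis limI tendsto_norm)
  ultimately show ?thesis by (rule borel_measurable_AE_eq)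
qed

lemma smeas_ennreal_norm: "smeas F \<Longrightarrow> (\<lambda>t. ennreal (norm (F t))) \<in> borel_measurable M"
  by (rule measurable_compose[OF smeas_norm measurable_ennreal])

lemma smeas_ennreal_norm_powr:
  assumes "smeas F"
  shows "(\<lambda>t. ennreal (norm (F t) powr p)) \<in> borel_measurable M"
proof -
  have "(\<lambda>x::real. ennreal (x powr p)) \<in> borel_measurable borel" by measurable
  from measurable_compose[OF smeas_norm[OF assms] this] show ?thesis .
qed

text \<open>The approximating simple functions are set to 0 wherever their norm exceeds
  \<open>2 * norm (F t)\<close>. Convergence survives: where \<open>F t = 0\<close> the truncated
  values vanish, and elsewhere the truncation is eventually inactive. The error is then dominated by
  \<open>3 powr p * norm (F t) powr p\<close>.\<close>

lemma smeas_approx: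
  fixes F :: "real \<Rightarrow> 'a::real_normed_vector"
  assumes F: "smeas F" and p: "p > 0" and fin: "(\<integral>\<^sup>+t. ennreal (norm (F t) powr p) \<partial>M) < \<infinity>"
  shows "\<exists>S. (\<forall>n. simple_function M (S n)) \<and> (\<forall>n. \<forall>t. norm (S n t) \<le> 2 * norm (F t)) \<and>
    (\<lambda>n. \<integral>\<^sup>+t. ennreal (norm (F t - S n t) powr p) \<partial>M) \<longlonglongrightarrow> 0"
proof -
  obtain S0 where "\<forall>n. simple_function M (S0 n)" and *: "AE t in M. (\<lambda>n. S0 n t) \<longlonglongrightarrow> F t"
    by (rule smeasE[OF F])
  note S0 = this(1)[rule_format] *
  note smeas_norm[OF F, measurable]
  define S where "S = (\<lambda>n t. if norm (S0 n t) \<le> 2 * norm (F t) then S0 n t else 0)"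
  have S: "simple_function M (S n)" for n
  proof -
    have [measurable]: "(\<lambda>t. norm (S0 n t)) \<in> borel_measurable M"
      by (rule borel_measurable_simple_function[OF simple_function_compose1[OF S0(1)]])
    have "{t \<in> space M. norm (S0 n t) \<le> 2 * norm (F t)} \<in> sets M"
      by measurable
    then show ?thesis
      unfolding S_def by (intro simple_function_If S0) auto
  qed
  have le: "norm (S n t) \<le> 2 * norm (F t)" for n t
    by (auto simp: S_def)
  have lim: "AE t in M. (\<lambda>n. S n t) \<longlonglongrightarrow> F t"
    using S0(2)
  proof eventually_elim
    case (elim t)
    show ?case
    proof (cases "F t = 0")
      case True
      then have "S n t = 0" for n using le[of n t] by simp
      then show ?thesis using True by simp
    next
      case False
      have "\<forall>\<^sub>F n in sequentially. norm (S0 n t) < 2 * norm (F t)"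
        using False by (intro order_tendstoD(2)[OF tendsto_norm[OF elim]]) auto
      then have "\<forall>\<^sub>F n in sequentially. S0 n t = S n t"
        by eventually_elim (auto simp: S_def)
      with elim show ?thesis by (rule Lim_transform_eventually)
    qed
  qed
  have "(\<lambda>n. \<integral>\<^sup>+t. ennreal (norm (F t - S n t) powr p) \<partial>M) \<longlonglongrightarrow> (\<integral>\<^sup>+t. 0 \<partial>M)"
  proof (rule nn_integral_dominated_convergence[where w="\<lambda>t. ennreal (3 powr p) * ennreal (norm (F t) powr p)"])
    show "(\<lambda>t. ennreal (norm (F t - S n t) powr p)) \<in> borel_measurable M" for n
      by (rule smeas_ennreal_norm_powr[OF smeas_diff[OF F smeas_simple[OF S[of n]]]])
    show "(\<integral>\<^sup>+t. ennreal (3 powr p) * ennreal (norm (F t) powr p) \<partial>M) < \<infinity>"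
      using fin by (subst nn_integral_cmult) (auto simp: ennreal_mult_less_top smeas_ennreal_norm_powr[OF F])
    show "AE t in M. ennreal (norm (F t - S n t) powr p) \<le> ennreal (3 powr p) * ennreal (norm (F t) powr p)" for n
    proof (rule AE_I2)
      fix t
      have "norm (F t - S n t) \<le> 3 * norm (F t)"
        using norm_triangle_ineq4[of "F t" "S n t"] le[of n t] by simp
      then have "norm (F t - S n t) powr p \<le> (3 * norm (F t)) powr p"
        using p by (intro powr_mono2) auto
      also have "\<dots> = 3 powr p * norm (F t) powr p"
        by (subst powr_mult) auto
      finally show "ennreal (norm (F t - S n t) powr p) \<le> ennreal (3 powr p) * ennreal (norm (F t) powr p)"
        by (simp flip: ennreal_mult)
    qed
    show "AE t in M. (\<lambda>n. ennreal (norm (F t - S n t) powr p)) \<longlonglongrightarrow> 0"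
      using lim
    proof eventually_elim
      case (elim t)
      have "(\<lambda>n. norm (F t - S n t)) \<longlonglongrightarrow> 0"
        using tendsto_norm_zero[OF LIM_zero[OF elim]] by (simp add: norm_minus_commute)
      then have "(\<lambda>n. norm (F t - S n t) powr p) \<longlonglongrightarrow> 0 powr p"
        using p by (intro tendsto_powr' tendsto_const) auto
      then have "(\<lambda>n. ennreal (norm (F t - S n t) powr p)) \<longlonglongrightarrow> ennreal 0"
        using p by (intro tendsto_ennrealI) auto
      then show ?case by simp
    qed
  qed auto
  with S le show ?thesis by auto
qed

abbreviation L1 :: "(real \<Rightarrow> 'a::real_normed_vector) \<Rightarrow> bool" where
  "L1 F \<equiv> strongly_integrable M F"

lemmas L1_def = strongly_integrable_def[of M]

lemma L1_smeas: "L1 F \<Longrightarrow> smeas F" by (simp add: L1_def)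

lemma L1_bound:
  assumes F: "smeas F" and G: "L1 G" and le: "AE t in M. norm (F t) \<le> c * norm (G t)"
  shows "L1 F"
proof -
  have "(\<integral>\<^sup>+t. ennreal (norm (F t)) \<partial>M) \<le> (\<integral>\<^sup>+t. ennreal \<bar>c\<bar> * ennreal (norm (G t)) \<partial>M)"
    using le
  proof (intro nn_integral_mono_AE, eventually_elim)
    case (elim t)
    have "norm (F t) \<le> \<bar>c\<bar> * norm (G t)"
      using elim by (meson abs_ge_self mult_right_mono norm_ge_zero order_trans)
    then show ?case by (simp flip: ennreal_mult)
  qed
  also have "\<dots> = ennreal \<bar>c\<bar> * (\<integral>\<^sup>+t. ennreal (norm (G t)) \<partial>M)"
    by (rule nn_integral_cmult[OF smeas_ennreal_norm[OF L1_smeas[OF G]]])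
  also have "\<dots> < \<infinity>" using G by (simp add: L1_def ennreal_mult_less_top)
  finally show ?thesis using F by (simp add: L1_def)
qed

lemma nn_integral_norm_triangle:
  assumes F: "smeas F" and G: "smeas G" and le: "\<And>t. norm (H t) \<le> norm (F t) + norm (G t)"
  shows "(\<integral>\<^sup>+t. ennreal (norm (H t)) \<partial>M) \<le> (\<integral>\<^sup>+t. ennreal (norm (F t)) \<partial>M) + (\<integral>\<^sup>+t. ennreal (norm (G t)) \<partial>M)"
proof -
  have "(\<integral>\<^sup>+t. ennreal (norm (H t)) \<partial>M) \<le> (\<integral>\<^sup>+t. ennreal (norm (F t)) + ennreal (norm (G t)) \<partial>M)"
    using le by (intro nn_integral_mono) (simp flip: ennreal_plus)
  also have "\<dots> = (\<integral>\<^sup>+t. ennreal (norm (F t)) \<partial>M) + (\<integral>\<^sup>+t. ennreal (norm (G t)) \<partial>M)"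
    by (rule nn_integral_add[OF smeas_ennreal_norm[OF F] smeas_ennreal_norm[OF G]])
  finally show ?thesis .
qed

lemma L1_add: "L1 F \<Longrightarrow> L1 G \<Longrightarrow> L1 (\<lambda>t. F t + G t)"
  using nn_integral_norm_triangle[of F G "\<lambda>t. F t + G t", OF _ _ norm_triangle_ineq]
  by (auto simp: L1_def smeas_add elim!: le_less_trans)

lemma L1_linear:
  assumes f: "bounded_linear f" and F: "L1 F"
  shows "L1 (\<lambda>t. f (F t))"
proof -
  obtain c where c: "\<And>x. norm (f x) \<le> norm x * c" using bounded_linear.bounded[OF f] by blast
  have "AE t in M. norm (f (F t)) \<le> c * norm (F t)"
    using c by (auto simp: mult.commute)
  then show ?thesis by (rule L1_bound[OF smeas_linear[OF f L1_smeas[OF F]] F])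
qed

lemma L1_scaleR: "L1 F \<Longrightarrow> L1 (\<lambda>t. c *\<^sub>R F t)"
  by (rule L1_linear[OF bounded_linear_scaleR_right])

lemma L1_diff: "L1 F \<Longrightarrow> L1 G \<Longrightarrow> L1 (\<lambda>t. F t - G t)"
  using L1_add[of F "\<lambda>t. -1 *\<^sub>R G t"] L1_scaleR[of G "-1"] by simp

lemma L1_cong_AE:
  assumes F: "L1 F" and eq: "AE t in M. F t = G t"
  shows "L1 G"
proof (rule L1_bound[OF smeas_cong_AE[OF L1_smeas[OF F] eq] F])
  show "AE t in M. norm (G t) \<le> 1 * norm (F t)"
    using eq by eventually_elim simp
qed

text \<open>Inserting the approximants of both functions and passing to the limit yields one
  estimate that contains uniqueness of the integral (\<open>F = G\<close>), its norm bound
  (\<open>G = 0\<close>) and its continuity in \<open>L1\<close>.\<close>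

lemma has_strong_integral_diff_le:
  assumes x: "has_strong_integral M F x" and y: "has_strong_integral M G y"
  shows "ennreal (norm (x - y)) \<le> (\<integral>\<^sup>+t. norm (F t - G t) \<partial>M)"
proof -
  obtain S where S: "\<And>n. Bochner_Integration.simple_bochner_integrable M (S n)" "(\<lambda>n. \<integral>\<^sup>+t. norm (F t - S n t) \<partial>M) \<longlonglongrightarrow> 0"
    "(\<lambda>n. Bochner_Integration.simple_bochner_integral M (S n)) \<longlonglongrightarrow> x" and F: "smeas F"
    using x unfolding has_strong_integral_def by blast
  obtain S' where S': "\<And>n. Bochner_Integration.simple_bochner_integrable M (S' n)" "(\<lambda>n. \<integral>\<^sup>+t. norm (G t - S' n t) \<partial>M) \<longlonglongrightarrow> 0"
    "(\<lambda>n. Bochner_Integration.simple_bochner_integral M (S' n)) \<longlonglongrightarrow> y" and G: "smeas G"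
    using y unfolding has_strong_integral_def by blast
  have sm: "smeas (S n)" "smeas (S' n)" for n
    using S(1)[of n] S'(1)[of n] by (auto intro!: smeas_simple elim: simple_bochner_integrable.cases)
  have le: "ennreal (norm (Bochner_Integration.simple_bochner_integral M (S n) - Bochner_Integration.simple_bochner_integral M (S' n)))
     \<le> (\<integral>\<^sup>+t. norm (F t - S n t) \<partial>M) + ((\<integral>\<^sup>+t. norm (F t - G t) \<partial>M) + (\<integral>\<^sup>+t. norm (G t - S' n t) \<partial>M))" for n
  proof -
    have "ennreal (norm (Bochner_Integration.simple_bochner_integral M (S n) - Bochner_Integration.simple_bochner_integral M (S' n))) \<le> (\<integral>\<^sup>+t. norm (S n t - S' n t) \<partial>M)"
      by (rule simple_bochner_integral_diff_le[OF S(1) S'(1)])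
    also have "\<dots> \<le> (\<integral>\<^sup>+t. norm (F t - S n t) \<partial>M) + (\<integral>\<^sup>+t. norm (F t - S' n t) \<partial>M)"
    proof (intro nn_integral_norm_triangle smeas_diff F sm)
      show "norm (S n t - S' n t) \<le> norm (F t - S n t) + norm (F t - S' n t)" for t
        using norm_triangle_ineq4[of "F t - S' n t" "F t - S n t"] by simp
    qed
    also have "(\<integral>\<^sup>+t. norm (F t - S' n t) \<partial>M) \<le> (\<integral>\<^sup>+t. norm (F t - G t) \<partial>M) + (\<integral>\<^sup>+t. norm (G t - S' n t) \<partial>M)"
    proof (intro nn_integral_norm_triangle smeas_diff F G sm)
      show "norm (F t - S' n t) \<le> norm (F t - G t) + norm (G t - S' n t)" for t
        using norm_triangle_ineq[of "F t - G t" "G t - S' n t"] by simp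
    qed
    finally show ?thesis by (simp add: add_left_mono)
  qed
  have "(\<lambda>n. ennreal (norm (Bochner_Integration.simple_bochner_integral M (S n) - Bochner_Integration.simple_bochner_integral M (S' n)))) \<longlonglongrightarrow> ennreal (norm (x - y))"
    by (intro tendsto_intros S S')
  moreover have "(\<lambda>n. (\<integral>\<^sup>+t. norm (F t - S n t) \<partial>M) + ((\<integral>\<^sup>+t. norm (F t - G t) \<partial>M) + (\<integral>\<^sup>+t. norm (G t - S' n t) \<partial>M)))
     \<longlonglongrightarrow> 0 + ((\<integral>\<^sup>+t. norm (F t - G t) \<partial>M) + 0)"
    by (intro tendsto_add tendsto_const S S')
  ultimately have "ennreal (norm (x - y)) \<le> 0 + ((\<integral>\<^sup>+t. norm (F t - G t) \<partial>M) + 0)"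
    by (rule LIMSEQ_le) (use le in blast)
  then show ?thesis by simp
qed

lemma has_strong_integral_unique: "has_strong_integral M F x \<Longrightarrow> has_strong_integral M F y \<Longrightarrow> x = y"
  using has_strong_integral_diff_le[of F x F y] by simp

lemma strong_integral_eq: "has_strong_integral M F x \<Longrightarrow> strong_integral M F = x"
  unfolding strong_integral_def using has_strong_integral_unique by blast

lemma has_strong_integral_add:
  assumes x: "has_strong_integral M F x" and y: "has_strong_integral M G y"
  shows "has_strong_integral M (\<lambda>t. F t + G t) (x + y)"
proof -
  obtain S where S: "\<And>n. Bochner_Integration.simple_bochner_integrable M (S n)" "(\<lambda>n. \<integral>\<^sup>+t. norm (F t - S n t) \<partial>M) \<longlonglongrightarrow> 0"
    "(\<lambda>n. Bochner_Integration.simple_bochner_integral M (S n)) \<longlonglongrightarrow> x" and F: "smeas F"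
    using x unfolding has_strong_integral_def by blast
  obtain S' where S': "\<And>n. Bochner_Integration.simple_bochner_integrable M (S' n)" "(\<lambda>n. \<integral>\<^sup>+t. norm (G t - S' n t) \<partial>M) \<longlonglongrightarrow> 0"
    "(\<lambda>n. Bochner_Integration.simple_bochner_integral M (S' n)) \<longlonglongrightarrow> y" and G: "smeas G"
    using y unfolding has_strong_integral_def by blast
  have sm: "smeas (S n)" "smeas (S' n)" for n
    using S(1)[of n] S'(1)[of n] by (auto intro!: smeas_simple elim: simple_bochner_integrable.cases)
  have "(\<lambda>n. \<integral>\<^sup>+t. norm (F t + G t - (S n t + S' n t)) \<partial>M) \<longlonglongrightarrow> 0"
  proof (rule tendsto_sandwich[OF _ _ tendsto_const])
    show "(\<lambda>n. (\<integral>\<^sup>+t. norm (F t - S n t) \<partial>M) + (\<integral>\<^sup>+t. norm (G t - S' n t) \<partial>M)) \<longlonglongrightarrow> 0"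
      using tendsto_add[OF S(2) S'(2)] by simp
    show "\<forall>\<^sub>F n in sequentially. (\<integral>\<^sup>+t. norm (F t + G t - (S n t + S' n t)) \<partial>M) \<le> (\<integral>\<^sup>+t. norm (F t - S n t) \<partial>M) + (\<integral>\<^sup>+t. norm (G t - S' n t) \<partial>M)"
      by (intro always_eventually allI nn_integral_norm_triangle smeas_diff F G sm) (rule norm_diff_triangle_ineq)
  qed simp
  moreover have "Bochner_Integration.simple_bochner_integrable M (\<lambda>t. S n t + S' n t)" for n
    using simple_bochner_integrable_compose2[of "(+)" M "S n" "S' n"] S(1) S'(1) by simp
  moreover have "(\<lambda>n. Bochner_Integration.simple_bochner_integral M (\<lambda>t. S n t + S' n t)) \<longlonglongrightarrow> x + y"
    using tendsto_add[OF S(3) S'(3)] by (simp add: simple_bochner_integral_add S(1) S'(1))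
  ultimately show ?thesis
    unfolding has_strong_integral_def using smeas_add[OF F G]
    by (intro conjI exI[of _ "\<lambda>n t. S n t + S' n t"]) auto
qed

lemma has_strong_integral_linear:
  assumes f: "bounded_linear f" and x: "has_strong_integral M F x"
  shows "has_strong_integral M (\<lambda>t. f (F t)) (f x)"
proof -
  obtain S where S: "\<And>n. Bochner_Integration.simple_bochner_integrable M (S n)" "(\<lambda>n. \<integral>\<^sup>+t. norm (F t - S n t) \<partial>M) \<longlonglongrightarrow> 0"
    "(\<lambda>n. Bochner_Integration.simple_bochner_integral M (S n)) \<longlonglongrightarrow> x" and F: "smeas F"
    using x unfolding has_strong_integral_def by blast
  interpret f: bounded_linear f by fact
  obtain c where c: "\<And>y. norm (f y) \<le> norm y * c" "c \<ge> 0" using f.nonneg_bounded by blast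
  have sm: "smeas (S n)" for n
    using S(1)[of n] by (auto intro!: smeas_simple elim: simple_bochner_integrable.cases)
  have "(\<lambda>n. \<integral>\<^sup>+t. norm (f (F t) - f (S n t)) \<partial>M) \<longlonglongrightarrow> 0"
  proof (rule tendsto_sandwich[OF _ _ tendsto_const])
    show "(\<lambda>n. ennreal c * (\<integral>\<^sup>+t. norm (F t - S n t) \<partial>M)) \<longlonglongrightarrow> 0"
      using ennreal_tendsto_cmult[OF _ S(2), of "ennreal c"] by simp
    show "\<forall>\<^sub>F n in sequentially. (\<integral>\<^sup>+t. norm (f (F t) - f (S n t)) \<partial>M) \<le> ennreal c * (\<integral>\<^sup>+t. norm (F t - S n t) \<partial>M)"
    proof (intro always_eventually allI)
      fix n
      have "(\<integral>\<^sup>+t. norm (f (F t) - f (S n t)) \<partial>M) \<le> (\<integral>\<^sup>+t. ennreal c * norm (F t - S n t) \<partial>M)"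
        using c by (intro nn_integral_mono) (simp add: mult.commute flip: f.diff ennreal_mult)
      also have "\<dots> = ennreal c * (\<integral>\<^sup>+t. norm (F t - S n t) \<partial>M)"
        by (rule nn_integral_cmult[OF smeas_ennreal_norm[OF smeas_diff[OF F sm]]])
      finally show "(\<integral>\<^sup>+t. norm (f (F t) - f (S n t)) \<partial>M) \<le> ennreal c * (\<integral>\<^sup>+t. norm (F t - S n t) \<partial>M)" .
    qed
  qed simp
  moreover have "Bochner_Integration.simple_bochner_integrable M (\<lambda>t. f (S n t))" for n
    using simple_bochner_integrable_compose2[of "\<lambda>a _. f a" M "S n" "S n"] S(1) by (simp add: f.zero)
  moreover have "(\<lambda>n. Bochner_Integration.simple_bochner_integral M (\<lambda>t. f (S n t))) \<longlonglongrightarrow> f x"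
    using f.tendsto[OF S(3)] by (simp add: simple_bochner_integral_linear[OF f.linear S(1)])
  ultimately show ?thesis
    unfolding has_strong_integral_def using smeas_linear[OF f F]
    by (intro conjI exI[of _ "\<lambda>n t. f (S n t)"]) auto
qed

lemma has_strong_integral_cong_AE:
  assumes x: "has_strong_integral M F x" and eq: "AE t in M. F t = G t"
  shows "has_strong_integral M G x"
proof -
  have "(\<integral>\<^sup>+t. norm (G t - S t) \<partial>M) = (\<integral>\<^sup>+t. norm (F t - S t) \<partial>M)" for S
    using eq by (intro nn_integral_cong_AE) (auto elim: AE_mp)
  then show ?thesis
    using x smeas_cong_AE[OF _ eq] unfolding has_strong_integral_def by simp
qed

lemma has_strong_integral_simple:
  "Bochner_Integration.simple_bochner_integrable M F \<Longrightarrow> has_strong_integral M F (Bochner_Integration.simple_bochner_integral M F)"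
  unfolding has_strong_integral_def
  by (auto intro!: smeas_simple exI[of _ "\<lambda>_. F"] simp: zero_ennreal_def[symmetric] elim: simple_bochner_integrable.cases)

text \<open>The integrals of the approximating simple functions differ by at most the sum of the
  approximation errors, hence form a Cauchy sequence. Completeness of the target space enters
  here.\<close>

lemma has_strong_integral_exists:
  fixes F :: "real \<Rightarrow> 'a::banach"
  assumes "L1 F"
  shows "\<exists>x. has_strong_integral M F x"
proof -
  have F: "smeas F" and fin: "(\<integral>\<^sup>+t. ennreal (norm (F t)) \<partial>M) < \<infinity>" using assms by (auto simp: L1_def)
  obtain S where S: "\<And>n. simple_function M (S n)" "\<And>n t. norm (S n t) \<le> 2 * norm (F t)"
     "(\<lambda>n. \<integral>\<^sup>+t. ennreal (norm (F t - S n t)) \<partial>M) \<longlonglongrightarrow> 0"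
    using smeas_approx[OF F, of 1] fin by auto
  have sm: "smeas (S n)" for n by (rule smeas_simple[OF S(1)])
  have sbi: "Bochner_Integration.simple_bochner_integrable M (S n)" for n
  proof (rule simple_bochner_integrableI_bounded[OF S(1)])
    show "(\<integral>\<^sup>+ x. ennreal (norm (S n x)) \<partial>M) < \<infinity>"
      using L1_bound[OF sm assms, of n 2] S(2) by (auto simp: L1_def)
  qed
  have "Cauchy (\<lambda>n. Bochner_Integration.simple_bochner_integral M (S n))"
  proof (rule metric_CauchyI)
    fix e :: real assume e: "e > 0"
    then have "\<forall>\<^sub>F n in sequentially. (\<integral>\<^sup>+t. ennreal (norm (F t - S n t)) \<partial>M) < ennreal (e / 2)"
      by (intro order_tendstoD(2)[OF S(3)]) auto
    then obtain N where N: "\<And>n. n \<ge> N \<Longrightarrow> (\<integral>\<^sup>+t. ennreal (norm (F t - S n t)) \<partial>M) < ennreal (e / 2)"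
      unfolding eventually_sequentially by blast
    show "\<exists>N. \<forall>m\<ge>N. \<forall>n\<ge>N. dist (Bochner_Integration.simple_bochner_integral M (S m)) (Bochner_Integration.simple_bochner_integral M (S n)) < e"
    proof (intro exI allI impI)
      fix m n assume mn: "m \<ge> N" "n \<ge> N"
      have "ennreal (norm (Bochner_Integration.simple_bochner_integral M (S m) - Bochner_Integration.simple_bochner_integral M (S n))) \<le> (\<integral>\<^sup>+t. norm (S m t - S n t) \<partial>M)"
        by (rule simple_bochner_integral_diff_le[OF sbi sbi])
      also have "\<dots> \<le> (\<integral>\<^sup>+t. norm (F t - S m t) \<partial>M) + (\<integral>\<^sup>+t. norm (F t - S n t) \<partial>M)"
      proof (intro nn_integral_norm_triangle smeas_diff F sm)
        show "norm (S m t - S n t) \<le> norm (F t - S m t) + norm (F t - S n t)" for t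
          using norm_triangle_ineq4[of "F t - S n t" "F t - S m t"] by simp
      qed
      also have "\<dots> < ennreal (e / 2) + ennreal (e / 2)"
        using N mn by (intro add_strict_mono) auto
      also have "\<dots> = ennreal e" using e by (simp flip: ennreal_plus)
      finally show "dist (Bochner_Integration.simple_bochner_integral M (S m)) (Bochner_Integration.simple_bochner_integral M (S n)) < e"
        using e by (simp add: dist_norm ennreal_less_iff)
    qed
  qed
  then obtain x where "(\<lambda>n. Bochner_Integration.simple_bochner_integral M (S n)) \<longlonglongrightarrow> x"
    using Cauchy_convergent_iff convergent_def by blast
  then show ?thesis
    unfolding has_strong_integral_def using F sbi S(3) by blast
qed

lemma has_strong_integral_strong_integral:
  fixes F :: "real \<Rightarrow> 'a::banach"
  shows "L1 F \<Longrightarrow> has_strong_integral M F (strong_integral M F)"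
  by (auto dest!: has_strong_integral_exists simp: strong_integral_eq)

lemma strong_integral_add:
  fixes F G :: "real \<Rightarrow> 'a::banach"
  shows "L1 F \<Longrightarrow> L1 G \<Longrightarrow> strong_integral M (\<lambda>t. F t + G t) = strong_integral M F + strong_integral M G"
  by (intro strong_integral_eq has_strong_integral_add has_strong_integral_strong_integral)

lemma strong_integral_linear:
  fixes F :: "real \<Rightarrow> 'a::banach" and f :: "'a \<Rightarrow> 'b::banach"
  shows "bounded_linear f \<Longrightarrow> L1 F \<Longrightarrow> strong_integral M (\<lambda>t. f (F t)) = f (strong_integral M F)"
  by (rule strong_integral_eq[OF has_strong_integral_linear[OF _ has_strong_integral_strong_integral]])

lemma strong_integral_diff:
  fixes F G :: "real \<Rightarrow> 'a::banach"
  shows "L1 F \<Longrightarrow> L1 G \<Longrightarrow> strong_integral M (\<lambda>t. F t - G t) = strong_integral M F - strong_integral M G"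
  using strong_integral_add[of F "\<lambda>t. -1 *\<^sub>R G t"] strong_integral_linear[OF bounded_linear_scaleR_right, of G "-1"] L1_scaleR[of G "-1"]
  by simp

lemma strong_integral_cong_AE:
  fixes F G :: "real \<Rightarrow> 'a::banach"
  shows "L1 F \<Longrightarrow> AE t in M. F t = G t \<Longrightarrow> strong_integral M F = strong_integral M G"
  by (rule strong_integral_eq[OF has_strong_integral_cong_AE[OF has_strong_integral_strong_integral], symmetric])

lemma strong_integral_diff_le:
  fixes F G :: "real \<Rightarrow> 'a::banach"
  shows "L1 F \<Longrightarrow> L1 G \<Longrightarrow> ennreal (norm (strong_integral M F - strong_integral M G)) \<le> (\<integral>\<^sup>+t. norm (F t - G t) \<partial>M)"
  by (intro has_strong_integral_diff_le has_strong_integral_strong_integral)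

lemma strong_integral_0 [simp]: "strong_integral M (\<lambda>_. 0 :: 'a::banach) = 0"
  using has_strong_integral_simple[of "\<lambda>_. 0 :: 'a"]
  by (intro strong_integral_eq) (simp add: simple_bochner_integrable.simps simple_bochner_integral_def image_constant_conv
      split: if_splits)

lemma L1_0 [simp]: "L1 (\<lambda>_. 0)"
  by (simp add: L1_def)

lemma strong_integral_norm_le:
  fixes F :: "real \<Rightarrow> 'a::banach"
  shows "L1 F \<Longrightarrow> ennreal (norm (strong_integral M F)) \<le> (\<integral>\<^sup>+t. norm (F t) \<partial>M)"
  using strong_integral_diff_le[OF _ L1_0, of F] by simp

end

section \<open>Change of the domain of integration\<close>

lemma complete_real_measure_lebesgue_on [simp]:
  "A \<in> sets lebesgue \<Longrightarrow> complete_real_measure (lebesgue_on A)"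
  by (simp add: complete_real_measure_def complete_measure_lebesgue_on)

interpretation lebesgue: complete_real_measure lebesgue
  by (simp add: complete_real_measure_def completion.complete_measure_axioms)

lemma AE_lebesgue_on_iff:
  "A \<in> sets lebesgue \<Longrightarrow> (AE t in lebesgue_on A. P t) \<longleftrightarrow> (AE t in lebesgue. t \<in> A \<longrightarrow> P t)"
  by (rule AE_restrict_space_iff) simp

lemma AE_lebesgue_neq: "AE t in lebesgue. t \<noteq> (c::real)"
  by (rule AE_completion[OF AE_lborel_singleton])

lemma smeas_restrict_iff:
  fixes F :: "real \<Rightarrow> 'a::real_normed_vector"
  assumes A: "A \<in> sets lebesgue"
  shows "strongly_measurable (lebesgue_on A) UNIV norm F \<longleftrightarrow>
    strongly_measurable lebesgue UNIV norm (\<lambda>t. indicator A t *\<^sub>R F t)"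
proof -
  interpret A: complete_real_measure "lebesgue_on A" using A by simp
  have A': "A \<inter> space lebesgue \<in> sets lebesgue" using A by simp
  show ?thesis
  proof
    assume "A.smeas F"
    then obtain S where S: "\<forall>n. simple_function (lebesgue_on A) (S n)" "AE t in lebesgue_on A. (\<lambda>n. S n t) \<longlonglongrightarrow> F t"
      by (rule A.smeasE)
    show "lebesgue.smeas (\<lambda>t. indicator A t *\<^sub>R F t)"
      unfolding lebesgue.smeas_iff
    proof (intro exI conjI allI)
      show "simple_function lebesgue (\<lambda>t. indicator A t *\<^sub>R S n t)" for n
        using S(1) by (simp add: simple_function_restrict_space[OF A'])
      show "AE t in lebesgue. (\<lambda>n. indicator A t *\<^sub>R S n t) \<longlonglongrightarrow> indicator A t *\<^sub>R F t"
        using S(2)[unfolded AE_lebesgue_on_iff[OF A]]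
        by eventually_elim (auto simp: indicator_def)
    qed
  next
    assume "lebesgue.smeas (\<lambda>t. indicator A t *\<^sub>R F t)"
    then obtain S where S: "\<forall>n. simple_function lebesgue (S n)" "AE t in lebesgue. (\<lambda>n. S n t) \<longlonglongrightarrow> indicator A t *\<^sub>R F t"
      by (rule lebesgue.smeasE)
    show "A.smeas F"
      unfolding A.smeas_iff AE_lebesgue_on_iff[OF A]
    proof (intro exI conjI allI)
      fix n
      have "simple_function lebesgue (\<lambda>t. indicator A t *\<^sub>R S n t)"
        using S(1) A by (intro simple_function_compose2[of lebesgue "indicator A :: real \<Rightarrow> real" "S n" scaleR]) auto
      then show "simple_function (lebesgue_on A) (S n)"
        by (simp add: simple_function_restrict_space[OF A'])
    next
      show "AE t in lebesgue. t \<in> A \<longrightarrow> (\<lambda>n. S n t) \<longlonglongrightarrow> F t"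
        using S(2) by eventually_elim auto
    qed
  qed
qed

lemma nn_integral_norm_restrict:
  assumes A: "A \<in> sets lebesgue"
  shows "(\<integral>\<^sup>+t. ennreal (norm (F t)) \<partial>lebesgue_on A) = (\<integral>\<^sup>+t. ennreal (norm (indicator A t *\<^sub>R F t)) \<partial>lebesgue)"
  using A by (subst nn_integral_restrict_space) (auto intro!: nn_integral_cong split: split_indicator)

lemma strongly_integrable_restrict_iff:
  assumes A: "A \<in> sets lebesgue"
  shows "strongly_integrable (lebesgue_on A) F \<longleftrightarrow> strongly_integrable lebesgue (\<lambda>t. indicator A t *\<^sub>R F t)"
  by (simp add: strongly_integrable_def smeas_restrict_iff[OF A] nn_integral_norm_restrict[OF A])

text \<open>Extension by zero turns integrals over different sets into integrals for one measure,
  where they can be compared.\<close>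

lemma strong_integral_restrict:
  fixes F :: "real \<Rightarrow> 'a::banach"
  assumes A: "A \<in> sets lebesgue" and F: "strongly_integrable (lebesgue_on A) F"
  shows "strong_integral (lebesgue_on A) F = strong_integral lebesgue (\<lambda>t. indicator A t *\<^sub>R F t)"
proof -
  interpret A: complete_real_measure "lebesgue_on A" using A by simp
  have A': "A \<inter> space lebesgue \<in> sets lebesgue" using A by simp
  have "has_strong_integral (lebesgue_on A) F (strong_integral (lebesgue_on A) F)"
    by (rule A.has_strong_integral_strong_integral[OF F])
  then obtain S where S: "\<forall>n. Bochner_Integration.simple_bochner_integrable (lebesgue_on A) (S n)"
    "(\<lambda>n. \<integral>\<^sup>+t. norm (F t - S n t) \<partial>lebesgue_on A) \<longlonglongrightarrow> 0"
    "(\<lambda>n. Bochner_Integration.simple_bochner_integral (lebesgue_on A) (S n)) \<longlonglongrightarrow> strong_integral (lebesgue_on A) F"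
    unfolding has_strong_integral_def by blast
  have "has_strong_integral lebesgue (\<lambda>t. indicator A t *\<^sub>R F t) (strong_integral (lebesgue_on A) F)"
    unfolding has_strong_integral_def
  proof (intro conjI exI allI)
    show "lebesgue.smeas (\<lambda>t. indicator A t *\<^sub>R F t)"
      using F by (simp add: strongly_integrable_def smeas_restrict_iff[OF A])
    show "Bochner_Integration.simple_bochner_integrable lebesgue (\<lambda>t. indicator A t *\<^sub>R S n t)" for n
      using S(1) by (simp add: simple_bochner_integrable_restrict_space[OF A'])
    show "(\<lambda>n. \<integral>\<^sup>+t. norm (indicator A t *\<^sub>R F t - indicator A t *\<^sub>R S n t) \<partial>lebesgue) \<longlonglongrightarrow> 0"
      using S(2) by (simp add: nn_integral_norm_restrict[OF A] scaleR_diff_right)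
    show "(\<lambda>n. Bochner_Integration.simple_bochner_integral lebesgue (\<lambda>t. indicator A t *\<^sub>R S n t)) \<longlonglongrightarrow> strong_integral (lebesgue_on A) F"
      using S(1,3) by (simp add: simple_bochner_integral_restrict_space[OF A'])
  qed
  from lebesgue.strong_integral_eq[OF this] show ?thesis by simp
qed

lemma has_bochner_integral_has_strong_integral:
  fixes f :: "real \<Rightarrow> real"
  assumes M: "complete_real_measure M" and "has_bochner_integral M f x"
  shows "has_strong_integral M f x"
  using assms(2)
proof (cases rule: has_bochner_integral.cases)
  case (1 s)
  interpret complete_real_measure M by fact
  show ?thesis
    unfolding has_strong_integral_def using 1 smeas_real[of f] by blast
qed

text \<open>Polynomials in time with arbitrary coefficients in the space: a class large enough to be
  dense, and explicit enough for the integrated equation to be solved monomial by monomial.\<close>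

definition vpoly :: "(real \<Rightarrow> 'a::real_vector) \<Rightarrow> bool" where
  "vpoly P \<longleftrightarrow> (\<exists>n y. P = (\<lambda>s. \<Sum>i<n. s ^ i *\<^sub>R y i))"

lemma vpoly_0 [simp]: "vpoly (\<lambda>_. 0)"
  unfolding vpoly_def by (intro exI[of _ 0]) simp

lemma vpoly_add:
  assumes "vpoly P" "vpoly Q"
  shows "vpoly (\<lambda>s. P s + Q s)"
proof -
  obtain n y m z where *: "P = (\<lambda>s. \<Sum>i<n. s ^ i *\<^sub>R y i)" "Q = (\<lambda>s. \<Sum>i<m. s ^ i *\<^sub>R z i)"
    using assms unfolding vpoly_def by blast
  have ext: "(\<Sum>i<k. s ^ i *\<^sub>R a i) = (\<Sum>i<max n m. s ^ i *\<^sub>R (if i < k then a i else 0))" if "k \<le> max n m" for k s and a :: "nat \<Rightarrow> 'a"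
    using that by (intro sum.mono_neutral_cong_left) auto
  have "P s + Q s = (\<Sum>i<max n m. s ^ i *\<^sub>R ((if i < n then y i else 0) + (if i < m then z i else 0)))" for s
    unfolding * ext[of n s y, OF max.cobounded1] ext[of m s z, OF max.cobounded2]
    by (simp add: sum.distrib scaleR_add_right)
  then show ?thesis
    unfolding vpoly_def
    by (intro exI[of _ "max n m"] exI[of _ "\<lambda>i. (if i < n then y i else 0) + (if i < m then z i else 0)"]) auto
qed

lemma vpoly_continuous: "vpoly (P :: real \<Rightarrow> 'a::real_normed_vector) \<Longrightarrow> continuous_on A P"
  unfolding vpoly_def by (auto intro!: continuous_intros)

section \<open>Primitives on a bounded interval\<close>

locale time_interval =
  fixes T :: real
  assumes T_pos: "T > 0"
begin

abbreviation MT :: "real measure" where "MT \<equiv> lebesgue_on {0<..<T}"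

sublocale complete_real_measure MT
  by simp

lemma lebesgue_closed_interval: "{a..b::real} \<in> sets lebesgue"
  by simp

lemma emeasure_MT: "emeasure MT (space MT) = ennreal T"
  using T_pos by (simp add: emeasure_restrict_space)

lemma AE_MT_iff: "(AE t in MT. P t) \<longleftrightarrow> (AE t in lebesgue. t \<in> {0<..<T} \<longrightarrow> P t)"
  by (rule AE_lebesgue_on_iff) simp

lemma AE_closed_iff: "(AE t in lebesgue_on {0..T}. P t) \<longleftrightarrow> (AE t in MT. P t)"
proof -
  have "AE t in lebesgue. (t \<in> {0..T} \<longrightarrow> P t) = (t \<in> {0<..<T} \<longrightarrow> P t)"
    using AE_lebesgue_neq[of 0] AE_lebesgue_neq[of T] by eventually_elim auto
  then show ?thesis
    by (simp only: AE_MT_iff AE_lebesgue_on_iff[OF lebesgue_closed_interval] eventually_subst)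
qed

definition primitive :: "(real \<Rightarrow> 'a::real_normed_vector) \<Rightarrow> real \<Rightarrow> 'a" where
  "primitive F t = strong_integral (lebesgue_on {0..t}) F"

text \<open>Sobolev functions are defined by integrals over \<open>{0..t}\<close>, while the
  \<open>Lp\<close> spaces live on the open interval. Both are compared on the whole line, where the
  two extensions by zero differ at the endpoints 0 and \<open>T\<close> at most.\<close>

lemma primitive_aux:
  fixes F :: "real \<Rightarrow> 'a::banach"
  assumes F: "L1 F" and t: "t \<in> {0..T}"
  shows strongly_integrable_initial: "strongly_integrable (lebesgue_on {0..t}) F"
    and L1_initial: "L1 (\<lambda>s. indicator {0..t} s *\<^sub>R F s)"
    and primitive_eq: "primitive F t = strong_integral MT (\<lambda>s. indicator {0..t} s *\<^sub>R F s)"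
proof -
  let ?G = "\<lambda>s. indicator {0<..<T} s *\<^sub>R (indicator {0..t} s *\<^sub>R F s)"
  have 0: "{0..t} \<in> sets lebesgue" "{0<..<T} \<in> sets lebesgue" by auto
  show L: "L1 (\<lambda>s. indicator {0..t} s *\<^sub>R F s)"
  proof (rule L1_bound[OF smeas_scaleR[OF _ L1_smeas[OF F]] F])
    show "indicator {0..t} \<in> borel_measurable MT"
      by (intro measurable_restrict_space1 borel_measurable_indicator) simp
    show "AE s in MT. norm (indicator {0..t} s *\<^sub>R F s) \<le> 1 * norm (F s)"
      by (simp add: indicator_def)
  qed
  have G: "strongly_integrable lebesgue ?G"
    using L by (simp add: strongly_integrable_restrict_iff[OF 0(2)])
  have eq: "AE s in lebesgue. ?G s = indicator {0..t} s *\<^sub>R F s"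
    using AE_lebesgue_neq[of 0] AE_lebesgue_neq[of T]
    by eventually_elim (use t in \<open>auto simp: indicator_def\<close>)
  have "strongly_integrable lebesgue (\<lambda>s. indicator {0..t} s *\<^sub>R F s)"
    by (rule lebesgue.L1_cong_AE[OF G eq])
  then show R: "strongly_integrable (lebesgue_on {0..t}) F"
    by (simp add: strongly_integrable_restrict_iff[OF 0(1)])
  have "primitive F t = strong_integral lebesgue (\<lambda>s. indicator {0..t} s *\<^sub>R F s)"
    unfolding primitive_def by (rule strong_integral_restrict[OF 0(1) R])
  also have "\<dots> = strong_integral lebesgue ?G"
    by (rule lebesgue.strong_integral_cong_AE[OF G eq, symmetric])
  also have "\<dots> = strong_integral MT (\<lambda>s. indicator {0..t} s *\<^sub>R F s)"
    by (rule strong_integral_restrict[OF 0(2) L, symmetric])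
  finally show "primitive F t = strong_integral MT (\<lambda>s. indicator {0..t} s *\<^sub>R F s)" .
qed

lemma primitive_linear:
  fixes F :: "real \<Rightarrow> 'a::banach" and f :: "'a \<Rightarrow> 'b::banach"
  assumes "bounded_linear f" "L1 F" "t \<in> {0..T}"
  shows "primitive (\<lambda>s. f (F s)) t = f (primitive F t)"
proof -
  interpret I: complete_real_measure "lebesgue_on {0..t}" by simp
  show ?thesis
    unfolding primitive_def by (rule I.strong_integral_linear[OF assms(1) strongly_integrable_initial[OF assms(2,3)]])
qed

lemma primitive_add:
  fixes F G :: "real \<Rightarrow> 'a::banach"
  assumes "L1 F" "L1 G" "t \<in> {0..T}"
  shows "primitive (\<lambda>s. F s + G s) t = primitive F t + primitive G t"
proof -
  interpret I: complete_real_measure "lebesgue_on {0..t}" by simp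
  show ?thesis
    unfolding primitive_def by (intro I.strong_integral_add strongly_integrable_initial assms)
qed

lemma primitive_diff:
  fixes F G :: "real \<Rightarrow> 'a::banach"
  assumes "L1 F" "L1 G" "t \<in> {0..T}"
  shows "primitive (\<lambda>s. F s - G s) t = primitive F t - primitive G t"
proof -
  interpret I: complete_real_measure "lebesgue_on {0..t}" by simp
  show ?thesis
    unfolding primitive_def by (intro I.strong_integral_diff strongly_integrable_initial assms)
qed

lemma primitive_cong_AE:
  fixes F G :: "real \<Rightarrow> 'a::banach"
  assumes F: "L1 F" and eq: "AE t in MT. F t = G t" and t: "t \<in> {0..T}"
  shows "primitive F t = primitive G t"
proof -
  have "AE s in MT. indicator {0..t} s *\<^sub>R F s = indicator {0..t} s *\<^sub>R G s"
    using eq by eventually_elim simp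
  then show ?thesis
    unfolding primitive_eq[OF F t] primitive_eq[OF L1_cong_AE[OF F eq] t]
    by (rule strong_integral_cong_AE[OF L1_initial[OF F t]])
qed

lemma primitive_norm_le:
  fixes F :: "real \<Rightarrow> 'a::banach"
  assumes F: "L1 F" and t: "t \<in> {0..T}"
  shows "ennreal (norm (primitive F t)) \<le> (\<integral>\<^sup>+s. norm (F s) \<partial>MT)"
proof -
  have "ennreal (norm (primitive F t)) \<le> (\<integral>\<^sup>+s. norm (indicator {0..t} s *\<^sub>R F s) \<partial>MT)"
    unfolding primitive_eq[OF F t] by (rule strong_integral_norm_le[OF L1_initial[OF F t]])
  also have "\<dots> \<le> (\<integral>\<^sup>+s. norm (F s) \<partial>MT)"
    by (intro nn_integral_mono) (auto simp: indicator_def)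
  finally show ?thesis .
qed

lemma primitive_diff_le:
  fixes F G :: "real \<Rightarrow> 'a::banach"
  assumes "L1 F" "L1 G" "t \<in> {0..T}"
  shows "ennreal (norm (primitive F t - primitive G t)) \<le> (\<integral>\<^sup>+s. norm (F s - G s) \<partial>MT)"
  using primitive_norm_le[OF L1_diff[OF assms(1,2)] assms(3)] primitive_diff[OF assms] by simp

lemma primitive_0 [simp]: "primitive (F :: real \<Rightarrow> 'a::banach) 0 = 0" if "L1 F"
proof -
  have "AE s in MT. indicator {0..0} s *\<^sub>R F s = 0"
    unfolding AE_MT_iff by (auto intro!: AE_I2)
  from strong_integral_cong_AE[OF L1_initial[OF that] this] T_pos show ?thesis
    by (simp add: primitive_eq[OF that])
qed

lemma nn_integral_MT_continuous:
  assumes f: "continuous_on {0..T} f" and nn: "\<And>t. t \<in> {0..T} \<Longrightarrow> f t \<ge> 0"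
  shows "(\<integral>\<^sup>+t. ennreal (f t) \<partial>MT) = ennreal (integral {0..T} f)"
proof -
  have int: "integrable (lebesgue_on {0..T}) f"
    using continuous_imp_integrable[of 0 T f] f by simp
  have "(\<integral>\<^sup>+t. ennreal (f t) \<partial>MT) = (\<integral>\<^sup>+t. ennreal (f t) \<partial>lebesgue_on {0..T})"
    by (subst (1 2) nn_integral_restrict_space; simp?)
       (intro nn_integral_cong_AE eventually_mono[OF AE_conjI[OF AE_lebesgue_neq[of 0] AE_lebesgue_neq[of T]]],
        auto simp: indicator_def)
  also have "\<dots> = ennreal (integral\<^sup>L (lebesgue_on {0..T}) f)"
    using nn int by (intro nn_integral_eq_integral) auto
  also have "integral\<^sup>L (lebesgue_on {0..T}) f = integral {0..T} f"
    by (rule lebesgue_integral_eq_integral[OF int]) simp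
  finally show ?thesis .
qed

text \<open>Sampling \<open>F\<close> at the grid point below \<open>t\<close> gives functions with
  finitely many values on a bounded interval, whatever the size of the target space. They converge
  because \<open>F\<close> is continuous at interior points.\<close>

lemma smeas_continuous:
  fixes F :: "real \<Rightarrow> 'a::real_normed_vector"
  assumes F: "continuous_on {0..T} F"
  shows "smeas F"
  unfolding smeas_iff
proof (intro exI conjI allI)
  let ?k = "\<lambda>n t. \<lfloor>real (Suc n) * t\<rfloor>"
  let ?g = "\<lambda>n t. real_of_int (?k n t) / real (Suc n)"
  fix n
  have "simple_function MT (?k n)"
    unfolding simple_function_def
  proof (intro conjI ballI)
    have "?k n ` space MT \<subseteq> {0..\<lfloor>real (Suc n) * T\<rfloor>}"
      by (auto intro!: floor_mono mult_left_mono simp del: of_nat_Suc)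
    then show "finite (?k n ` space MT)" by (rule finite_subset) simp
    fix x
    have "?k n \<in> measurable MT (count_space UNIV)"
      by (intro measurable_restrict_space1 measurable_completion) measurable
    then show "?k n -` {x} \<inter> space MT \<in> sets MT" by (rule measurable_sets) simp
  qed
  from simple_function_compose1[OF this, of "\<lambda>k. F (real_of_int k / real (Suc n))"]
  show "simple_function MT (\<lambda>t. F (?g n t))" .
next
  let ?g = "\<lambda>n t. real_of_int \<lfloor>real (Suc n) * t\<rfloor> / real (Suc n)"
  show "AE t in MT. (\<lambda>n. F (?g n t)) \<longlonglongrightarrow> F t"
  proof (rule AE_I2)
    fix t assume "t \<in> space MT"
    then have t: "0 < t" "t < T" by auto
    have up: "?g n t \<le> t" for n
      by (simp add: divide_le_eq mult.commute del: of_nat_Suc)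
    have lo: "t - 1 / real (Suc n) \<le> ?g n t" for n
    proof -
      have "real (Suc n) * t - 1 \<le> real_of_int \<lfloor>real (Suc n) * t\<rfloor>" by linarith
      then have "(real (Suc n) * t - 1) / real (Suc n) \<le> ?g n t"
        by (intro divide_right_mono) auto
      then show ?thesis by (simp add: diff_divide_distrib del: of_nat_Suc)
    qed
    have 1: "(\<lambda>n. t - 1 / real (Suc n)) \<longlonglongrightarrow> t"
      using tendsto_diff[OF tendsto_const LIMSEQ_inverse_real_of_nat, of t] by (simp add: inverse_eq_divide)
    have "(\<lambda>n. ?g n t) \<longlonglongrightarrow> t"
      by (rule real_tendsto_sandwich[OF always_eventually[OF allI[OF lo]] always_eventually[OF allI[OF up]] 1 tendsto_const])
    moreover have "isCont F t"
      using F t by (intro continuous_on_interior) auto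
    ultimately show "(\<lambda>n. F (?g n t)) \<longlonglongrightarrow> F t"
      by (rule isCont_tendsto_compose[rotated])
  qed
qed

lemma L1_continuous:
  fixes F :: "real \<Rightarrow> 'a::real_normed_vector"
  assumes F: "continuous_on {0..T} F"
  shows "L1 F"
  using smeas_continuous[OF F] nn_integral_MT_continuous[of "\<lambda>t. norm (F t)"] F
  by (simp add: L1_def continuous_on_norm)

text \<open>Bridge between the strong integral and the gauge integral: for scalar functions both are
  the Lebesgue integral, and the bounded linear map that multiplies \<open>y\<close> by a scalar
  carries this over to vectors.\<close>

lemma primitive_scalar:
  fixes y :: "'a::banach"
  assumes \<phi>: "continuous_on {0..T} \<phi>" and t: "t \<in> {0..T}"
  shows "primitive (\<lambda>s. \<phi> s *\<^sub>R y) t = integral {0..t} \<phi> *\<^sub>R y"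
proof -
  have "continuous_on {0..t} \<phi>" using \<phi> t by (auto elim: continuous_on_subset)
  then have int: "integrable (lebesgue_on {0..t}) \<phi>"
    using continuous_imp_integrable[of 0 t \<phi>] by simp
  have "has_strong_integral (lebesgue_on {0..t}) \<phi> (integral\<^sup>L (lebesgue_on {0..t}) \<phi>)"
    by (intro has_bochner_integral_has_strong_integral has_bochner_integral_integrable int) simp
  then have "primitive \<phi> t = integral\<^sup>L (lebesgue_on {0..t}) \<phi>"
    unfolding primitive_def by (intro complete_real_measure.strong_integral_eq) simp
  also have "\<dots> = integral {0..t} \<phi>"
    by (rule lebesgue_integral_eq_integral[OF int]) simp
  finally have "primitive \<phi> t = integral {0..t} \<phi>" .
  then show ?thesis
    using primitive_linear[OF bounded_linear_scaleR_left[of y] L1_continuous[OF \<phi>] t] by simp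
qed

lemma primitive_vpoly:
  fixes P :: "real \<Rightarrow> 'a::banach"
  assumes P: "vpoly P" and t: "t \<in> {0..T}"
  shows "primitive P t = integral {0..t} P"
proof -
  obtain n y where P: "P = (\<lambda>s. \<Sum>i<n. s ^ i *\<^sub>R y i)" using P by (auto simp: vpoly_def)
  show ?thesis
    unfolding P
  proof (induction n)
    case 0
    show ?case by (simp add: primitive_def complete_real_measure.strong_integral_0)
  next
    case (Suc n)
    have "primitive (\<lambda>s. \<Sum>i<Suc n. s ^ i *\<^sub>R y i) t = primitive (\<lambda>s. \<Sum>i<n. s ^ i *\<^sub>R y i) t + primitive (\<lambda>s. s ^ n *\<^sub>R y n) t"
      by (simp, intro primitive_add L1_continuous t continuous_intros)
    also have "primitive (\<lambda>s. s ^ n *\<^sub>R y n) t = integral {0..t} (\<lambda>s. s ^ n) *\<^sub>R y n"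
      by (intro primitive_scalar t continuous_intros)
    also have "\<dots> = integral {0..t} (\<lambda>s. s ^ n *\<^sub>R y n)"
      using integral_linear[OF _ bounded_linear_scaleR_left[of "y n"], of "\<lambda>s. s ^ n" "{0..t}"]
      by (simp add: o_def integrable_continuous_interval continuous_intros)
    also have "primitive (\<lambda>s. \<Sum>i<n. s ^ i *\<^sub>R y i) t + integral {0..t} (\<lambda>s. s ^ n *\<^sub>R y n) = integral {0..t} (\<lambda>s. \<Sum>i<Suc n. s ^ i *\<^sub>R y i)"
      unfolding Suc by (simp, intro integral_add[symmetric] integrable_continuous_interval continuous_intros)
    finally show ?case .
  qed
qed

end

section \<open>Density of polynomials\<close>

context time_interval
begin

text \<open>A triangle inequality for \<open>p\<close>-th powers with the constant
  \<open>2 powr p\<close>. It takes the place of Minkowski's inequality; the constant is harmless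
  where only finiteness or convergence to 0 is deduced.\<close>

lemma nn_integral_powr_triangle:
  assumes F: "smeas F" and G: "smeas G" and p: "p \<ge> 0"
    and le: "\<And>t. t \<in> {0<..<T} \<Longrightarrow> norm (H t) \<le> norm (F t) + norm (G t)"
  shows "(\<integral>\<^sup>+t. ennreal (norm (H t) powr p) \<partial>MT) \<le>
    ennreal (2 powr p) * ((\<integral>\<^sup>+t. ennreal (norm (F t) powr p) \<partial>MT) + (\<integral>\<^sup>+t. ennreal (norm (G t) powr p) \<partial>MT))"
proof -
  have "(\<integral>\<^sup>+t. ennreal (norm (H t) powr p) \<partial>MT) \<le>
      (\<integral>\<^sup>+t. ennreal (2 powr p) * (ennreal (norm (F t) powr p) + ennreal (norm (G t) powr p)) \<partial>MT)"
  proof (rule nn_integral_mono)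
    fix t assume "t \<in> space MT"
    then have "norm (H t) powr p \<le> (norm (F t) + norm (G t)) powr p"
      using p le by (intro powr_mono2) auto
    also have "\<dots> \<le> 2 powr p * (norm (F t) powr p + norm (G t) powr p)"
      using p by (intro powr_add_le) auto
    finally show "ennreal (norm (H t) powr p) \<le> ennreal (2 powr p) * (ennreal (norm (F t) powr p) + ennreal (norm (G t) powr p))"
      by (simp flip: ennreal_plus ennreal_mult)
  qed
  also have "\<dots> = ennreal (2 powr p) * (\<integral>\<^sup>+t. ennreal (norm (F t) powr p) + ennreal (norm (G t) powr p) \<partial>MT)"
    by (intro nn_integral_cmult borel_measurable_add smeas_ennreal_norm_powr F G)
  also have "(\<integral>\<^sup>+t. ennreal (norm (F t) powr p) + ennreal (norm (G t) powr p) \<partial>MT) =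
     (\<integral>\<^sup>+t. ennreal (norm (F t) powr p) \<partial>MT) + (\<integral>\<^sup>+t. ennreal (norm (G t) powr p) \<partial>MT)"
    by (intro nn_integral_add smeas_ennreal_norm_powr F G)
  finally show ?thesis .
qed

definition approximable :: "real \<Rightarrow> (real \<Rightarrow> 'a::real_normed_vector) \<Rightarrow> bool" where
  "approximable p F \<longleftrightarrow> (\<forall>e>0. \<exists>P. vpoly P \<and> (\<integral>\<^sup>+t. ennreal (norm (F t - P t) powr p) \<partial>MT) < ennreal e)"

lemma smeas_vpoly: "vpoly P \<Longrightarrow> smeas P"
  by (intro smeas_continuous vpoly_continuous)

text \<open>Origin of the tolerance \<open>e / (2 * 2 powr p)\<close>: one factor 2 for the two
  errors, and \<open>2 powr p\<close> for the constant of the triangle inequality.\<close>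

lemma two_powr_bound:
  assumes "x < ennreal (e / (2 * 2 powr p))" "y < ennreal (e / (2 * 2 powr p))" "e > 0"
  shows "ennreal (2 powr p) * (x + y) < ennreal e"
proof -
  have "x + y < ennreal (e / (2 * 2 powr p)) + ennreal (e / (2 * 2 powr p))"
    using assms by (intro add_strict_mono)
  also have "\<dots> = ennreal (e / 2 powr p)"
    using assms(3) by (simp flip: ennreal_plus)
  finally have "ennreal (2 powr p) * (x + y) < ennreal (2 powr p) * ennreal (e / 2 powr p)"
    by (intro ennreal_mult_strict_left_mono) (auto simp: less_top)
  also have "\<dots> = ennreal e"
    using assms(3) by (simp flip: ennreal_mult)
  finally show ?thesis .
qed

lemma approximable_add:
  assumes F: "approximable p F" "smeas F" and G: "approximable p G" "smeas G" and p: "p \<ge> 0"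
  shows "approximable p (\<lambda>t. F t + G t)"
  unfolding approximable_def
proof (intro allI impI)
  fix e :: real assume e: "e > 0"
  then have e': "e / (2 * 2 powr p) > 0" by simp
  obtain P where P: "vpoly P" "(\<integral>\<^sup>+t. ennreal (norm (F t - P t) powr p) \<partial>MT) < ennreal (e / (2 * 2 powr p))"
    using F e' unfolding approximable_def by blast
  obtain Q where Q: "vpoly Q" "(\<integral>\<^sup>+t. ennreal (norm (G t - Q t) powr p) \<partial>MT) < ennreal (e / (2 * 2 powr p))"
    using G e' unfolding approximable_def by blast
  have "(\<integral>\<^sup>+t. ennreal (norm (F t + G t - (P t + Q t)) powr p) \<partial>MT) \<le>
     ennreal (2 powr p) * ((\<integral>\<^sup>+t. ennreal (norm (F t - P t) powr p) \<partial>MT) + (\<integral>\<^sup>+t. ennreal (norm (G t - Q t) powr p) \<partial>MT))"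
    by (intro nn_integral_powr_triangle smeas_diff F G p smeas_vpoly P Q norm_diff_triangle_ineq)
  also have "\<dots> < ennreal e" by (rule two_powr_bound[OF P(2) Q(2) e])
  finally show "\<exists>P. vpoly P \<and> (\<integral>\<^sup>+t. ennreal (norm (F t + G t - P t) powr p) \<partial>MT) < ennreal e"
    using vpoly_add[OF P(1) Q(1)] by blast
qed

lemma approximable_trans:
  assumes F: "smeas F" and p: "p \<ge> 0"
    and G: "\<And>e. e > 0 \<Longrightarrow> \<exists>G. smeas G \<and> approximable p G \<and> (\<integral>\<^sup>+t. ennreal (norm (F t - G t) powr p) \<partial>MT) < ennreal e"
  shows "approximable p F"
  unfolding approximable_def
proof (intro allI impI)
  fix e :: real assume e: "e > 0"
  then have e': "e / (2 * 2 powr p) > 0" by simp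
  obtain G where G: "smeas G" "approximable p G" "(\<integral>\<^sup>+t. ennreal (norm (F t - G t) powr p) \<partial>MT) < ennreal (e / (2 * 2 powr p))"
    using G[OF e'] by blast
  obtain P where P: "vpoly P" "(\<integral>\<^sup>+t. ennreal (norm (G t - P t) powr p) \<partial>MT) < ennreal (e / (2 * 2 powr p))"
    using G e' unfolding approximable_def by blast
  have "(\<integral>\<^sup>+t. ennreal (norm (F t - P t) powr p) \<partial>MT) \<le>
     ennreal (2 powr p) * ((\<integral>\<^sup>+t. ennreal (norm (F t - G t) powr p) \<partial>MT) + (\<integral>\<^sup>+t. ennreal (norm (G t - P t) powr p) \<partial>MT))"
  proof (intro nn_integral_powr_triangle smeas_diff F G p smeas_vpoly P)
    show "norm (F t - P t) \<le> norm (F t - G t) + norm (G t - P t)" for t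
      using norm_triangle_ineq[of "F t - G t" "G t - P t"] by simp
  qed
  also have "\<dots> < ennreal e" by (rule two_powr_bound[OF G(3) P(2) e])
  finally show "\<exists>P. vpoly P \<and> (\<integral>\<^sup>+t. ennreal (norm (F t - P t) powr p) \<partial>MT) < ennreal e"
    using P by blast
qed

lemma real_polynomial_vpoly:
  fixes c :: "'a::real_normed_vector" and f :: "real \<Rightarrow> real"
  assumes "real_polynomial_function f"
  shows "vpoly (\<lambda>s. f s *\<^sub>R c)"
proof -
  obtain a n where f: "f = (\<lambda>x. \<Sum>i\<le>n. a i * x ^ i)"
    using assms unfolding real_polynomial_function_iff_sum by blast
  have "f s *\<^sub>R c = (\<Sum>i<Suc n. s ^ i *\<^sub>R (a i *\<^sub>R c))" for s
    by (simp add: f lessThan_Suc_atMost scaleR_sum_left mult.commute del: sum.lessThan_Suc)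
  then show ?thesis
    unfolding vpoly_def by (intro exI[of _ "Suc n"] exI[of _ "\<lambda>i. a i *\<^sub>R c"]) auto
qed

text \<open>By regularity the set lies between a closed set \<open>C\<close> and an open set
  \<open>U\<close> that differ little from it. A Urysohn function \<open>g\<close> for the two
  differs from the indicator only on the small remainder, and there by at most 1; Weierstrass
  approximation on \<open>{0..T}\<close> then replaces \<open>g\<close> by a polynomial.\<close>

lemma indicator_polynomial_approx:
  assumes A: "A \<in> sets MT" and p: "p \<ge> 1" and e: "e > 0"
  shows "\<exists>f. real_polynomial_function f \<and> (\<integral>\<^sup>+t. ennreal (norm (indicator A t - f t :: real) powr p) \<partial>MT) < ennreal e"
proof -
  define e1 where "e1 = e / (2 * 2 powr p)"
  have e1: "e1 > 0" using e by (simp add: e1_def)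
  \<comment> \<open>The bound by 1 makes the \<open>p\<close>-th power of an error below
    \<open>d\<close> at most the error itself; the other bound makes its integral over an interval
    of length \<open>T\<close> at most \<open>e1 / 2\<close>.\<close>
  define d where "d = min 1 (e1 / (2 * T))"
  have d: "d > 0" using e1 T_pos by (simp add: d_def)
  have AL: "A \<in> sets lebesgue" using A by (auto simp: sets_restrict_space)
  obtain U where U: "open U" "A \<subseteq> U" "U - A \<in> lmeasurable" "emeasure lebesgue (U - A) < ennreal (e1 / 2)"
    using sets_lebesgue_outer_open[OF AL, of "e1 / 2"] e1 by auto
  obtain C where C: "closed C" "C \<subseteq> A" "A - C \<in> lmeasurable" "emeasure lebesgue (A - C) < ennreal (e1 / 2)"
    using sets_lebesgue_inner_closed[OF AL, of "e1 / 2"] e1 by auto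
  obtain g :: "real \<Rightarrow> real" where g: "continuous_on UNIV g" "\<And>x. g x \<in> closed_segment 1 0"
     "\<And>x. x \<in> C \<Longrightarrow> g x = 1" "\<And>x. x \<in> - U \<Longrightarrow> g x = 0"
    using Urysohn[of C "- U" "1 :: real" 0] C U by (auto simp: closed_Compl)
  have g01: "0 \<le> g x" "g x \<le> 1" for x using g(2)[of x] by (auto simp: closed_segment_eq_real_ivl)
  have "compact {0..T}" by simp
  then obtain f where f: "real_polynomial_function f" "\<And>x. x \<in> {0..T} \<Longrightarrow> \<bar>g x - f x\<bar> < d"
    using Stone_Weierstrass_real_polynomial_function[of "{0..T}" g d] continuous_on_subset[OF g(1)] d by auto
  have sA: "smeas (indicator A :: real \<Rightarrow> real)"
    using A by (intro smeas_real borel_measurable_indicator)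
  have sg: "smeas g" by (intro smeas_continuous continuous_on_subset[OF g(1)]) auto
  have sf: "smeas f"
    using smeas_vpoly[OF real_polynomial_vpoly[OF f(1), of "1 :: real"]] by simp
  have meas: "(U - A) \<union> (A - C) \<in> sets lebesgue" using U C by blast
  have 1: "(\<integral>\<^sup>+t. ennreal (norm (indicator A t - g t) powr p) \<partial>MT) < ennreal (e / (2 * 2 powr p))"
  proof -
    have "(\<integral>\<^sup>+t. ennreal (norm (indicator A t - g t) powr p) \<partial>MT) \<le> (\<integral>\<^sup>+t. indicator ((U - A) \<union> (A - C)) t \<partial>MT)"
    proof (rule nn_integral_mono)
      fix t
      show "ennreal (norm (indicator A t - g t) powr p) \<le> indicator ((U - A) \<union> (A - C)) t"
      proof (cases "t \<in> (U - A) \<union> (A - C)")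
        case True
        have "norm (indicator A t - g t) \<le> 1" using g01[of t] by (auto simp: indicator_def)
        then have "norm (indicator A t - g t) powr p \<le> 1 powr p" using p by (intro powr_mono2) auto
        with True show ?thesis by simp
      next
        case False
        then have "indicator A t = g t" using g(3,4)[of t] C(2) U(2) by (auto simp: indicator_def)
        then show ?thesis using p by simp
      qed
    qed
    also have "\<dots> \<le> (\<integral>\<^sup>+t. indicator ((U - A) \<union> (A - C)) t \<partial>lebesgue)"
      by (subst nn_integral_restrict_space) (auto intro!: nn_integral_mono simp: indicator_def)
    also have "\<dots> = emeasure lebesgue ((U - A) \<union> (A - C))" using meas by simp
    also have "\<dots> \<le> emeasure lebesgue (U - A) + emeasure lebesgue (A - C)"
      using U C by (intro emeasure_subadditive) auto
    also have "\<dots> < ennreal (e1 / 2) + ennreal (e1 / 2)"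
      by (intro add_strict_mono U C)
    also have "\<dots> = ennreal e1" using e1 by (simp flip: ennreal_plus)
    finally show ?thesis by (simp add: e1_def)
  qed
  have 2: "(\<integral>\<^sup>+t. ennreal (norm (g t - f t) powr p) \<partial>MT) < ennreal (e / (2 * 2 powr p))"
  proof -
    have "(\<integral>\<^sup>+t. ennreal (norm (g t - f t) powr p) \<partial>MT) \<le> (\<integral>\<^sup>+t. ennreal d \<partial>MT)"
    proof (rule nn_integral_mono)
      fix t assume "t \<in> space MT"
      then have le: "norm (g t - f t) \<le> d" using f(2)[of t] by auto
      have d1: "d \<le> 1" by (simp add: d_def)
      have "norm (g t - f t) powr p \<le> norm (g t - f t) powr 1"
        using p le d1 by (intro powr_mono') auto
      also have "\<dots> \<le> d" using le by simp
      finally show "ennreal (norm (g t - f t) powr p) \<le> ennreal d" by (rule ennreal_leI)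
    qed
    also have "\<dots> = ennreal (d * T)" using d T_pos emeasure_MT by (simp add: ennreal_mult)
    also have "d * T \<le> e1 / 2"
    proof -
      have "d * T \<le> e1 / (2 * T) * T" using T_pos by (intro mult_right_mono) (auto simp: d_def)
      then show ?thesis using T_pos by simp
    qed
    also have "ennreal (e1 / 2) < ennreal e1" using e1 by (intro ennreal_lessI) auto
    finally show ?thesis by (simp add: e1_def ennreal_leI)
  qed
  have "(\<integral>\<^sup>+t. ennreal (norm (indicator A t - f t) powr p) \<partial>MT) \<le>
     ennreal (2 powr p) * ((\<integral>\<^sup>+t. ennreal (norm (indicator A t - g t) powr p) \<partial>MT) + (\<integral>\<^sup>+t. ennreal (norm (g t - f t) powr p) \<partial>MT))"
  proof (intro nn_integral_powr_triangle smeas_diff sA sg sf)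
    show "norm (indicator A t - f t) \<le> norm (indicator A t - g t) + norm (g t - f t)" for t
      using norm_triangle_ineq[of "indicator A t - g t" "g t - f t"] by simp
  qed (use p in simp)
  also have "\<dots> < ennreal e" by (rule two_powr_bound[OF 1 2 e])
  finally show ?thesis using f(1) by blast
qed

lemma approximable_indicator:
  fixes c :: "'a::real_normed_vector"
  assumes A: "A \<in> sets MT" and p: "p \<ge> 1"
  shows "approximable p (\<lambda>t. indicator A t *\<^sub>R c)"
  unfolding approximable_def
proof (intro allI impI)
  fix e :: real assume e: "e > 0"
  \<comment> \<open>Adding 1 keeps the divisor in \<open>e / k\<close> positive when
    \<open>c = 0\<close>.\<close>
  define k where "k = norm c powr p + 1"
  have k: "k > 0" by (simp add: k_def add_nonneg_pos)
  obtain f where f: "real_polynomial_function f" "(\<integral>\<^sup>+t. ennreal (norm (indicator A t - f t :: real) powr p) \<partial>MT) < ennreal (e / k)"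
    using indicator_polynomial_approx[OF A p, of "e / k"] e k by auto
  have sf: "smeas (\<lambda>t. indicator A t - f t)"
    using A smeas_vpoly[OF real_polynomial_vpoly[OF f(1), of "1 :: real"]]
    by (intro smeas_diff smeas_real[of "indicator A"] borel_measurable_indicator) auto
  have "(\<integral>\<^sup>+t. ennreal (norm (indicator A t *\<^sub>R c - f t *\<^sub>R c) powr p) \<partial>MT) \<le> (\<integral>\<^sup>+t. ennreal k * ennreal (norm (indicator A t - f t) powr p) \<partial>MT)"
  proof (rule nn_integral_mono)
    fix t
    have "norm (indicator A t *\<^sub>R c - f t *\<^sub>R c) powr p = norm c powr p * norm (indicator A t - f t) powr p"
      by (simp add: powr_mult mult.commute flip: scaleR_diff_left)
    also have "\<dots> \<le> k * norm (indicator A t - f t) powr p"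
      by (intro mult_right_mono) (auto simp: k_def)
    finally show "ennreal (norm (indicator A t *\<^sub>R c - f t *\<^sub>R c) powr p) \<le> ennreal k * ennreal (norm (indicator A t - f t) powr p)"
      using k by (simp flip: ennreal_mult)
  qed
  also have "\<dots> = ennreal k * (\<integral>\<^sup>+t. ennreal (norm (indicator A t - f t) powr p) \<partial>MT)"
    by (rule nn_integral_cmult[OF smeas_ennreal_norm_powr[OF sf]])
  also have "\<dots> < ennreal k * ennreal (e / k)"
    using f(2) k by (intro ennreal_mult_strict_left_mono) auto
  also have "\<dots> = ennreal e" using e k by (simp flip: ennreal_mult)
  finally show "\<exists>P. vpoly P \<and> (\<integral>\<^sup>+t. ennreal (norm (indicator A t *\<^sub>R c - P t) powr p) \<partial>MT) < ennreal e"
    using real_polynomial_vpoly[OF f(1), of c] by blast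
qed

lemma approximable_cong:
  assumes "approximable p F" "\<And>t. t \<in> {0<..<T} \<Longrightarrow> F t = G t"
  shows "approximable p G"
proof -
  have "(\<integral>\<^sup>+t. ennreal (norm (F t - P t) powr p) \<partial>MT) = (\<integral>\<^sup>+t. ennreal (norm (G t - P t) powr p) \<partial>MT)" for P
    using assms(2) by (intro nn_integral_cong) simp
  then show ?thesis
    using assms(1) by (simp add: approximable_def)
qed

text \<open>On the interval a simple function is the finite sum of its values times the indicators
  of its level sets.\<close>

lemma approximable_simple:
  fixes S :: "real \<Rightarrow> 'a::real_normed_vector"
  assumes S: "simple_function MT S" and p: "p \<ge> 1"
  shows "approximable p S"
proof -
  define A where "A = (\<lambda>y. S -` {y} \<inter> space MT)"
  have A: "A y \<in> sets MT" for y
    unfolding A_def using S by (rule simple_functionD)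
  have fin: "finite (S ` space MT)" using S by (rule simple_functionD)
  have "approximable p (\<lambda>t. \<Sum>y\<in>Y. indicator (A y) t *\<^sub>R y) \<and> smeas (\<lambda>t. \<Sum>y\<in>Y. indicator (A y) t *\<^sub>R y)" if "finite Y" for Y
    using that
  proof (induction Y)
    case empty
    show ?case
      using p vpoly_0 by (auto simp: approximable_def intro!: exI[of _ "\<lambda>_. 0"])
  next
    case (insert y Y)
    have "smeas (\<lambda>t. indicator (A y) t *\<^sub>R y)"
      using A by (intro smeas_scaleR borel_measurable_indicator smeas_const)
    moreover have "(\<lambda>t. \<Sum>z\<in>insert y Y. indicator (A z) t *\<^sub>R z) = (\<lambda>t. indicator (A y) t *\<^sub>R y + (\<Sum>z\<in>Y. indicator (A z) t *\<^sub>R z))"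
      by (intro ext sum.insert) (use insert in auto)
    ultimately show ?case
      using insert p approximable_indicator[OF A p, of y y] by (simp only: approximable_add smeas_add)
  qed
  from this[OF fin] have "approximable p (\<lambda>t. \<Sum>y\<in>S ` space MT. indicator (A y) t *\<^sub>R y)" ..
  then show ?thesis
  proof (rule approximable_cong)
    fix t assume t: "t \<in> {0<..<T}"
    have "(\<Sum>y\<in>S ` space MT. indicator (A y) t *\<^sub>R y) = (\<Sum>y\<in>S ` space MT. if y = S t then y else 0)"
      using t by (intro sum.cong) (auto simp: A_def indicator_def)
    also have "\<dots> = S t" using fin t by (simp add: sum.delta)
    finally show "(\<Sum>y\<in>S ` space MT. indicator (A y) t *\<^sub>R y) = S t" .
  qed
qed

lemma approximable_Lp:
  fixes F :: "real \<Rightarrow> 'a::real_normed_vector"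
  assumes F: "smeas F" and p: "p \<ge> 1" and fin: "(\<integral>\<^sup>+t. ennreal (norm (F t) powr p) \<partial>MT) < \<infinity>"
  shows "approximable p F"
proof (rule approximable_trans[OF F])
  fix e :: real assume e: "e > 0"
  obtain S where S: "\<forall>n. simple_function MT (S n)" "(\<lambda>n. \<integral>\<^sup>+t. ennreal (norm (F t - S n t) powr p) \<partial>MT) \<longlonglongrightarrow> 0"
    using smeas_approx[OF F _ fin] p by auto
  have "\<forall>\<^sub>F n in sequentially. (\<integral>\<^sup>+t. ennreal (norm (F t - S n t) powr p) \<partial>MT) < ennreal e"
    using e by (intro order_tendstoD(2)[OF S(2)]) auto
  then obtain n where "(\<integral>\<^sup>+t. ennreal (norm (F t - S n t) powr p) \<partial>MT) < ennreal e"
    unfolding eventually_sequentially by blast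
  then show "\<exists>G. smeas G \<and> approximable p G \<and> (\<integral>\<^sup>+t. ennreal (norm (F t - G t) powr p) \<partial>MT) < ennreal e"
    using S(1) smeas_simple approximable_simple[OF _ p] by blast
qed (use p in simp)

lemma L1_approx_sequence:
  fixes F :: "real \<Rightarrow> 'a::real_normed_vector"
  assumes F: "L1 F"
  obtains P where "\<forall>k. vpoly (P k)" "(\<lambda>k. \<integral>\<^sup>+t. ennreal (norm (F t - P k t)) \<partial>MT) \<longlonglongrightarrow> 0"
proof -
  have "approximable 1 F"
    using F by (intro approximable_Lp) (auto simp: L1_def)
  then have "\<exists>P. vpoly P \<and> (\<integral>\<^sup>+t. ennreal (norm (F t - P t)) \<partial>MT) < ennreal (1 / real (Suc k))" for k
    unfolding approximable_def by simp
  then obtain P where P: "\<And>k. vpoly (P k) \<and> (\<integral>\<^sup>+t. ennreal (norm (F t - P k t)) \<partial>MT) < ennreal (1 / real (Suc k))"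
    by metis
  have "(\<lambda>k. \<integral>\<^sup>+t. ennreal (norm (F t - P k t)) \<partial>MT) \<longlonglongrightarrow> 0"
  proof (rule tendsto_sandwich[OF _ _ tendsto_const])
    have "(\<lambda>k. ennreal (1 / real (Suc k))) \<longlonglongrightarrow> ennreal 0"
      using LIMSEQ_inverse_real_of_nat by (intro tendsto_ennrealI) (simp add: inverse_eq_divide)
    then show "(\<lambda>k. ennreal (1 / real (Suc k))) \<longlonglongrightarrow> 0" by simp
    show "\<forall>\<^sub>F k in sequentially. (\<integral>\<^sup>+t. ennreal (norm (F t - P k t)) \<partial>MT) \<le> ennreal (1 / real (Suc k))"
      using P by (intro always_eventually allI less_imp_le) blast
  qed simp
  with P show thesis using that by blast
qed

text \<open>Both integrals agree on polynomials, and both change by at most the \<open>L1\<close>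
  distance of the integrands; density of polynomials in \<open>L1\<close> does the rest.\<close>

lemma primitive_continuous_eq_integral:
  fixes v :: "real \<Rightarrow> 'a::banach"
  assumes v: "continuous_on {0..T} v" and t: "t \<in> {0..T}"
  shows "primitive v t = integral {0..t} v"
proof -
  have L: "L1 v" by (rule L1_continuous[OF v])
  obtain P where P: "\<forall>k. vpoly (P k)" "(\<lambda>k. \<integral>\<^sup>+t. ennreal (norm (v t - P k t)) \<partial>MT) \<longlonglongrightarrow> 0"
    by (rule L1_approx_sequence[OF L])
  have le: "ennreal (norm (primitive v t - integral {0..t} v)) \<le> 2 * (\<integral>\<^sup>+t. ennreal (norm (v t - P k t)) \<partial>MT)" for k
  proof -
    have cP: "continuous_on {0..T} (P k)" using P by (intro vpoly_continuous) auto
    have c: "continuous_on {0..T} (\<lambda>t. v t - P k t)" by (intro continuous_on_diff v cP)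
    have sub: "{0..t} \<subseteq> {0..T}" using t by auto
    have "norm (integral {0..t} (\<lambda>t. v t - P k t)) \<le> integral {0..t} (\<lambda>t. norm (v t - P k t))"
      by (intro integral_norm_bound_integral integrable_continuous_interval continuous_on_norm continuous_on_subset[OF c sub]) auto
    also have "\<dots> \<le> integral {0..T} (\<lambda>t. norm (v t - P k t))"
      using sub by (intro integral_subset_le integrable_continuous_interval continuous_on_norm continuous_on_subset[OF c]) auto
    also have "ennreal \<dots> = (\<integral>\<^sup>+t. ennreal (norm (v t - P k t)) \<partial>MT)"
      by (intro nn_integral_MT_continuous[symmetric] continuous_on_norm c) auto
    finally have 1: "ennreal (norm (integral {0..t} (\<lambda>t. v t - P k t))) \<le> (\<integral>\<^sup>+t. ennreal (norm (v t - P k t)) \<partial>MT)"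
      by (simp add: ennreal_leI)
    have "integral {0..t} (\<lambda>t. v t - P k t) = integral {0..t} v - integral {0..t} (P k)"
      using sub by (intro integral_diff integrable_continuous_interval continuous_on_subset[OF v] continuous_on_subset[OF cP])
    then have "norm (primitive v t - integral {0..t} v) \<le> norm (primitive v t - primitive (P k) t) + norm (integral {0..t} (\<lambda>t. v t - P k t))"
      using primitive_vpoly[of "P k" t] P t norm_triangle_ineq4[of "primitive v t - primitive (P k) t" "integral {0..t} v - primitive (P k) t"] by simp
    then have "ennreal (norm (primitive v t - integral {0..t} v)) \<le> ennreal (norm (primitive v t - primitive (P k) t)) + ennreal (norm (integral {0..t} (\<lambda>t. v t - P k t)))"
      by (simp flip: ennreal_plus)
    also have "\<dots> \<le> (\<integral>\<^sup>+t. ennreal (norm (v t - P k t)) \<partial>MT) + (\<integral>\<^sup>+t. ennreal (norm (v t - P k t)) \<partial>MT)"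
      by (intro add_mono 1 primitive_diff_le L L1_continuous cP t)
    finally show ?thesis by (simp add: mult_2)
  qed
  have "(\<lambda>k. 2 * (\<integral>\<^sup>+t. ennreal (norm (v t - P k t)) \<partial>MT)) \<longlonglongrightarrow> 2 * 0"
    by (intro ennreal_tendsto_cmult P) simp
  then have "ennreal (norm (primitive v t - integral {0..t} v)) \<le> 2 * 0"
    by (rule LIMSEQ_le_const) (use le in blast)
  then show ?thesis by simp
qed

text \<open>The Borel sets with this property contain the intervals, over which the integral is a
  difference of two primitives. They are closed under complements, since the integral over the whole
  interval vanishes, and under countable disjoint unions, by dominated convergence along finite
  unions.\<close>

lemma strong_integral_indicator_0:
  fixes F :: "real \<Rightarrow> 'a::banach"
  assumes F: "L1 F" and zero: "\<And>t. t \<in> {0..T} \<Longrightarrow> primitive F t = 0" and A: "A \<in> sets borel"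
  shows "strong_integral MT (\<lambda>s. indicator A s *\<^sub>R F s) = 0"
proof -
  have ind: "L1 (\<lambda>s. indicator A s *\<^sub>R F s)" if "A \<in> sets borel" for A
  proof (rule L1_bound[OF smeas_scaleR[OF _ L1_smeas[OF F]] F])
    show "indicator A \<in> borel_measurable MT"
      using that by (intro measurable_restrict_space1 borel_measurable_indicator) simp
    show "AE s in MT. norm (indicator A s *\<^sub>R F s) \<le> 1 * norm (F s)"
      by (simp add: indicator_def)
  qed
  have total: "strong_integral MT F = 0"
  proof -
    have "primitive F T = strong_integral MT F"
    proof -
      have T: "T \<in> {0..T}" using T_pos by simp
      show ?thesis
        unfolding primitive_eq[OF F T]
        by (intro strong_integral_cong_AE L1_initial F T AE_I2) (auto simp: indicator_def)
    qed
    then show ?thesis using zero[of T] T_pos by simp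
  qed
  show ?thesis
    using A
  proof (induction rule: borel_set_induct)
    case empty
    show ?case by simp
  next
    case (interval a b)
    \<comment> \<open>Clamping the endpoints to \<open>{0..T}\<close> brings them into the range
      where the primitive is known to vanish.\<close>
    define c where "c = (\<lambda>x. max 0 (min x T))"
    have c: "c x \<in> {0..T}" for x using T_pos by (auto simp: c_def)
    have eq: "AE s in MT. indicator {0..c b} s *\<^sub>R F s - indicator {0..c a} s *\<^sub>R F s = indicator {a..b} s *\<^sub>R F s"
      unfolding AE_MT_iff using AE_lebesgue_neq[of a]
      by eventually_elim (use interval in \<open>auto simp: c_def indicator_def max_def min_def\<close>)
    have "strong_integral MT (\<lambda>s. indicator {a..b} s *\<^sub>R F s) = strong_integral MT (\<lambda>s. indicator {0..c b} s *\<^sub>R F s - indicator {0..c a} s *\<^sub>R F s)"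
      by (intro strong_integral_cong_AE[OF _ eq, symmetric] L1_diff L1_initial F c)
    also have "\<dots> = primitive F (c b) - primitive F (c a)"
      by (subst strong_integral_diff) (auto intro!: L1_initial F c simp: primitive_eq[OF F c])
    also have "\<dots> = 0" by (simp add: zero[OF c])
    finally show ?case .
  next
    case (compl A)
    have "strong_integral MT (\<lambda>s. indicator (- A) s *\<^sub>R F s) = strong_integral MT (\<lambda>s. F s - indicator A s *\<^sub>R F s)"
      by (intro arg_cong[where f="strong_integral MT"] ext) (auto simp: indicator_def)
    also have "\<dots> = 0"
      using compl total by (subst strong_integral_diff[OF F ind]) auto
    finally show ?case .
  next
    case (union A)
    define V where "V = (\<lambda>n. \<Union>i<n. A i)"
    have V: "V n \<in> sets borel" for n using union(2) by (auto simp: V_def)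
    have zV: "strong_integral MT (\<lambda>s. indicator (V n) s *\<^sub>R F s) = 0" for n
    proof (induction n)
      case 0
      show ?case by (simp add: V_def)
    next
      case (Suc n)
      have "indicator (V (Suc n)) s *\<^sub>R F s = indicator (V n) s *\<^sub>R F s + indicator (A n) s *\<^sub>R F s" for s
      proof -
        have "V n \<inter> A n = {}"
        proof -
          have "A i \<inter> A n = {}" if "i < n" for i
            using disjoint_family_onD[OF union(1), of i n] that by simp
          then show ?thesis unfolding V_def by blast
        qed
        moreover have "V (Suc n) = V n \<union> A n" by (auto simp: V_def lessThan_Suc)
        ultimately show ?thesis by (auto simp: indicator_def)
      qed
      then show ?case
        using strong_integral_add[OF ind[OF V] ind[OF union(2)], of n n] Suc union(3) by simp
    qed
    have U: "(\<Union>i. A i) \<in> sets borel" using union(2) by auto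
    have lim: "(\<lambda>n. \<integral>\<^sup>+s. ennreal (norm (indicator (\<Union>i. A i) s *\<^sub>R F s - indicator (V n) s *\<^sub>R F s)) \<partial>MT) \<longlonglongrightarrow> (\<integral>\<^sup>+s. 0 \<partial>MT)"
    proof (rule nn_integral_dominated_convergence[where w="\<lambda>s. ennreal (norm (F s))"])
      show "(\<lambda>s. ennreal (norm (F s))) \<in> borel_measurable MT"
        by (rule smeas_ennreal_norm[OF L1_smeas[OF F]])
      show "(\<integral>\<^sup>+s. ennreal (norm (F s)) \<partial>MT) < \<infinity>" using F by (simp add: L1_def)
      show "(\<lambda>s. ennreal (norm (indicator (\<Union>i. A i) s *\<^sub>R F s - indicator (V n) s *\<^sub>R F s))) \<in> borel_measurable MT" for n
        by (intro smeas_ennreal_norm smeas_diff L1_smeas ind U V)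
      show "AE s in MT. ennreal (norm (indicator (\<Union>i. A i) s *\<^sub>R F s - indicator (V n) s *\<^sub>R F s)) \<le> ennreal (norm (F s))" for n
        by (intro AE_I2 ennreal_leI) (auto simp: indicator_def V_def)
      show "AE s in MT. (\<lambda>n. ennreal (norm (indicator (\<Union>i. A i) s *\<^sub>R F s - indicator (V n) s *\<^sub>R F s))) \<longlonglongrightarrow> 0"
      proof (rule AE_I2)
        fix s
        have "\<forall>\<^sub>F n in sequentially. ennreal (norm (indicator (\<Union>i. A i) s *\<^sub>R F s - indicator (V n) s *\<^sub>R F s)) = 0"
        proof (cases "s \<in> (\<Union>i. A i)")
          case True
          then obtain i where "s \<in> A i" by blast
          then have "s \<in> V n" if "n > i" for n using that by (auto simp: V_def)
          with True show ?thesis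
            unfolding eventually_sequentially by (intro exI[of _ "Suc i"]) auto
        next
          case False
          then have "s \<notin> V n" for n by (auto simp: V_def)
          with False show ?thesis by simp
        qed
        then show "(\<lambda>n. ennreal (norm (indicator (\<Union>i. A i) s *\<^sub>R F s - indicator (V n) s *\<^sub>R F s))) \<longlonglongrightarrow> 0"
          by (rule tendsto_eventually)
      qed
    qed simp
    have "ennreal (norm (strong_integral MT (\<lambda>s. indicator (\<Union>i. A i) s *\<^sub>R F s))) \<le>
       (\<integral>\<^sup>+s. ennreal (norm (indicator (\<Union>i. A i) s *\<^sub>R F s - indicator (V n) s *\<^sub>R F s)) \<partial>MT)" for n
      using strong_integral_diff_le[OF ind[OF U] ind[OF V], of n] by (simp add: zV)
    then have "ennreal (norm (strong_integral MT (\<lambda>s. indicator (\<Union>i. A i) s *\<^sub>R F s))) \<le> (\<integral>\<^sup>+s. 0 \<partial>MT)"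
      by (intro LIMSEQ_le_const[OF lim]) blast
    then show ?case by simp
  qed
qed

text \<open>
  Where \<open>F \<noteq> 0\<close>, some value \<open>c \<noteq> 0\<close> of the approximating simple functions satisfies
  \<open>\<parallel>F - c\<parallel> < \<parallel>c\<parallel> / 2\<close>; there are countably many such \<open>c\<close>, and for each the set of these points is
  null because \<open>F\<close> integrates to \<open>0\<close> over it.
\<close>

lemma AE_zero_if_primitive_zero:
  fixes F :: "real \<Rightarrow> 'a::banach"
  assumes F: "L1 F" and zero: "\<And>t. t \<in> {0..T} \<Longrightarrow> primitive F t = 0"
  shows "AE t in MT. F t = 0"
proof -
  have sF: "smeas F" using F by (rule L1_smeas)
  define N where "N = (\<lambda>c. {t \<in> space MT. norm (F t - c) < norm c / 2})"
  have N: "N c \<in> sets MT" for c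
    unfolding N_def using smeas_norm[OF smeas_diff[OF sF smeas_const[of c]]] by measurable
  have null: "AE t in MT. t \<notin> N c" if c: "c \<noteq> 0" for c
  proof -
    have "N c \<in> sets lebesgue" using N[of c] by (simp add: sets_restrict_space_iff)
    \<comment> \<open>Vanishing integrals are known over Borel sets, while \<open>N c\<close> is
      only Lebesgue measurable; it is replaced by a Borel set that differs from it by a null
      set.\<close>
    then obtain S N0 N' where *: "N c = S \<union> N0" "N0 \<subseteq> N'" "N' \<in> null_sets lborel" "S \<in> sets lborel"
      by (rule sets_completionE)
    have "AE t in lebesgue. t \<notin> N'"
      using *(3) by (intro AE_completion AE_not_in)
    then have eq: "AE t in MT. indicator S t = (indicator (N c) t :: real)"
      unfolding AE_MT_iff by eventually_elim (use * in \<open>auto simp: indicator_def\<close>)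
    have indN: "(indicator (N c) :: real \<Rightarrow> real) \<in> borel_measurable MT"
      using N by (rule borel_measurable_indicator)
    have LF: "L1 (\<lambda>t. indicator (N c) t *\<^sub>R F t)"
      by (rule L1_bound[OF smeas_scaleR[OF indN sF] F, of 1]) (simp add: indicator_def)
    have Lc: "L1 (\<lambda>t. indicator (N c) t *\<^sub>R c)"
      by (rule L1_bound[OF smeas_scaleR[OF indN smeas_const] L1_continuous[OF continuous_on_const[of _ c]], where c=1])
        (simp add: indicator_def)
    have "strong_integral MT (\<lambda>t. indicator (N c) t *\<^sub>R F t) = strong_integral MT (\<lambda>t. indicator S t *\<^sub>R F t)"
      by (rule strong_integral_cong_AE[OF LF]) (use eq in \<open>auto elim: AE_mp\<close>)
    also have "\<dots> = 0"
      using * by (intro strong_integral_indicator_0 F zero) auto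
    finally have 0: "strong_integral MT (\<lambda>t. indicator (N c) t *\<^sub>R F t) = 0" .
    have fin: "emeasure MT (N c) \<noteq> \<infinity>"
      using emeasure_space[of MT "N c"] emeasure_MT by (auto simp: top_unique)
    define m where "m = measure MT (N c)"
    have em: "emeasure MT (N c) = ennreal m"
      using fin by (simp add: m_def emeasure_eq_ennreal_measure)
    have "has_strong_integral MT (indicator (N c) :: real \<Rightarrow> real) m"
      unfolding m_def using N fin
      by (intro has_bochner_integral_has_strong_integral has_bochner_integral_real_indicator) (auto simp: complete_real_measure_axioms less_top)
    from has_strong_integral_linear[OF bounded_linear_scaleR_left[of c] this]
    have "strong_integral MT (\<lambda>t. indicator (N c) t *\<^sub>R c) = m *\<^sub>R c"
      by (rule strong_integral_eq)
    with strong_integral_diff_le[OF Lc LF] 0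
    have "ennreal (norm (m *\<^sub>R c)) \<le> (\<integral>\<^sup>+t. norm (indicator (N c) t *\<^sub>R c - indicator (N c) t *\<^sub>R F t) \<partial>MT)"
      by simp
    also have "\<dots> \<le> (\<integral>\<^sup>+t. ennreal (norm c / 2) * indicator (N c) t \<partial>MT)"
      by (intro nn_integral_mono) (auto simp: indicator_def N_def norm_minus_commute intro!: ennreal_leI less_imp_le)
    also have "\<dots> = ennreal (norm c / 2) * ennreal m"
      using N by (simp add: nn_integral_cmult_indicator em)
    also have "\<dots> = ennreal (norm c / 2 * m)" by (rule ennreal_mult[symmetric]) (auto simp: m_def)
    \<comment> \<open>Over \<open>N c\<close> the constant \<open>c\<close> integrates to a vector
      of norm \<open>m * norm c\<close>, but it is within \<open>norm c / 2\<close> of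
      \<open>F\<close>, whose integral there is 0. Only \<open>m = 0\<close> is compatible with
      this.\<close>
    finally have "m * norm c \<le> norm c / 2 * m"
      by (subst (asm) ennreal_le_iff) (auto simp: m_def)
    then have "m * norm c \<le> 0" by simp
    then have "m \<le> 0" using c by (simp add: mult_le_0_iff)
    then have "m = 0" using measure_nonneg[of MT "N c"] by (simp add: m_def)
    then have "N c \<in> null_sets MT" using em N by (auto simp: null_sets_def)
    then show ?thesis by (rule AE_not_in)
  qed
  obtain S where S: "\<forall>n. simple_function MT (S n)" "AE t in MT. (\<lambda>n. S n t) \<longlonglongrightarrow> F t"
    using sF by (rule smeasE)
  define C where "C = (\<Union>n. S n ` space MT) - {0}"
  have "countable C"
    unfolding C_def using simple_functionD(1)[OF S(1)[rule_format]]
    by (intro countable_Diff countable_UN countableI_type countable_finite)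
  then have "AE t in MT. \<forall>c\<in>C. t \<notin> N c"
    using null by (subst AE_ball_countable) (auto simp: C_def)
  then show ?thesis
    using S(2) AE_space
  proof eventually_elim
    case (elim t)
    show ?case
    proof (rule ccontr)
      assume nz: "F t \<noteq> 0"
      have "\<forall>\<^sub>F n in sequentially. dist (S n t) (F t) < norm (F t) / 4"
        using nz by (intro tendstoD[OF elim(2)]) simp
      then obtain n where n: "norm (F t - S n t) < norm (F t) / 4"
        unfolding eventually_sequentially by (auto simp: dist_norm norm_minus_commute)
      \<comment> \<open>With an error below a quarter of \<open>norm (F t)\<close>, the norm of
        \<open>S n t\<close> exceeds three quarters of it, so the error is less than a third of
        \<open>norm (S n t)\<close> and \<open>t\<close> lies in the corresponding set
        \<open>N\<close>.\<close>
      have "norm (F t) \<le> norm (S n t) + norm (F t - S n t)"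
        using norm_triangle_sub[of "F t" "S n t"] .
      moreover have "norm (F t) > 0" using nz by simp
      ultimately have "norm (F t - S n t) < norm (S n t) / 2" "norm (S n t) > 0"
        using n by linarith+
      moreover from this(2) have "S n t \<in> C" unfolding C_def using elim(3) by (auto intro!: exI[of _ n] imageI)
      ultimately show False using elim(1,3) by (auto simp: N_def)
    qed
  qed
qed

end

section \<open>Exponentials of bounded operators\<close>

primrec bpow :: "('a::real_normed_vector \<Rightarrow>\<^sub>L 'a) \<Rightarrow> nat \<Rightarrow> ('a \<Rightarrow>\<^sub>L 'a)" where
  "bpow P 0 = id_blinfun"
| "bpow P (Suc k) = P o\<^sub>L bpow P k"

lemma norm_bpow_le: "norm (bpow P k) \<le> norm P ^ k"
proof (induction k)
  case 0
  show ?case by (simp add: norm_blinfun_id_le)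
next
  case (Suc k)
  have "norm (bpow P (Suc k)) \<le> norm P * norm (bpow P k)"
    by (simp add: norm_blinfun_compose)
  also have "\<dots> \<le> norm P * norm P ^ k"
    by (intro mult_left_mono Suc) auto
  finally show ?case by simp
qed

lemma bpow_scaleR: "bpow (c *\<^sub>R P) k = c ^ k *\<^sub>R bpow P k"
  by (induction k) (auto simp: blinfun_eqI scaleR_blinfun.rep_eq blinfun.scaleR_right intro!: blinfun_eqI)

lemma bpow_commute: "Q o\<^sub>L P = P o\<^sub>L Q \<Longrightarrow> Q o\<^sub>L bpow P k = bpow P k o\<^sub>L Q"
proof (induction k)
  case (Suc k)
  then show ?case
    by (auto intro!: blinfun_eqI dest!: arg_cong[where f=blinfun_apply] simp: fun_eq_iff)
qed (auto intro!: blinfun_eqI)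

definition bexp :: "('a::banach \<Rightarrow>\<^sub>L 'a) \<Rightarrow> real \<Rightarrow> ('a \<Rightarrow>\<^sub>L 'a)" where
  "bexp P t = (\<Sum>k. (t ^ k / fact k) *\<^sub>R bpow P k)"

lemma bexp_summable_norm:
  fixes P :: "'a::banach \<Rightarrow>\<^sub>L 'a"
  shows "summable (\<lambda>k. norm ((t ^ k / fact k) *\<^sub>R bpow P k))"
proof (rule summable_comparison_test')
  show "summable (\<lambda>k. inverse (fact k) * (\<bar>t\<bar> * norm P) ^ k)"
    using summable_exp[of "\<bar>t\<bar> * norm P"] .
  show "norm (norm ((t ^ k / fact k) *\<^sub>R bpow P k)) \<le> inverse (fact k) * (\<bar>t\<bar> * norm P) ^ k" for k
    using norm_bpow_le[of P k]
    by (simp add: power_abs power_mult_distrib field_simps mult_left_mono)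
qed

lemma bexp_summable:
  fixes P :: "'a::banach \<Rightarrow>\<^sub>L 'a"
  shows "summable (\<lambda>k. (t ^ k / fact k) *\<^sub>R bpow P k)"
  using bexp_summable_norm by (rule summable_norm_cancel)

lemma bexp_0 [simp]: "bexp P 0 = id_blinfun"
proof -
  have "bexp P 0 = (\<Sum>k\<in>{0}. (0 ^ k / fact k) *\<^sub>R bpow P k)"
    unfolding bexp_def by (rule suminf_finite) auto
  then show ?thesis by simp
qed

lemma bexp_commute:
  fixes P :: "'a::banach \<Rightarrow>\<^sub>L 'a"
  assumes "Q o\<^sub>L P = P o\<^sub>L Q"
  shows "Q o\<^sub>L bexp P t = bexp P t o\<^sub>L Q"
proof -
  have "Q o\<^sub>L bexp P t = (\<Sum>k. Q o\<^sub>L ((t ^ k / fact k) *\<^sub>R bpow P k))"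
    unfolding bexp_def
    by (rule bounded_linear.suminf[OF bounded_bilinear.bounded_linear_right[OF bounded_bilinear_blinfun_compose] bexp_summable])
  also have "\<dots> = (\<Sum>k. ((t ^ k / fact k) *\<^sub>R bpow P k) o\<^sub>L Q)"
  proof (intro arg_cong[where f=suminf] ext)
    fix k
    show "Q o\<^sub>L ((t ^ k / fact k) *\<^sub>R bpow P k) = ((t ^ k / fact k) *\<^sub>R bpow P k) o\<^sub>L Q"
      using bpow_commute[OF assms, of k]
      by (simp add: bounded_bilinear.scaleR_left[OF bounded_bilinear_blinfun_compose]
          bounded_bilinear.scaleR_right[OF bounded_bilinear_blinfun_compose])
  qed
  also have "\<dots> = bexp P t o\<^sub>L Q"
    unfolding bexp_def
    by (rule bounded_linear.suminf[symmetric, OF bounded_bilinear.bounded_linear_left[OF bounded_bilinear_blinfun_compose] bexp_summable])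
  finally show ?thesis .
qed

text \<open>Bounds on all powers produce the prefactor \<open>C\<close> only once. An estimate by
  the norm of \<open>P\<close> alone would put \<open>C\<close> into the exponent, and the growth
  could no longer be cancelled by a scalar exponential.\<close>

lemma bexp_norm_le:
  fixes P :: "'a::banach \<Rightarrow>\<^sub>L 'a"
  assumes "\<And>k. norm (bpow P k) \<le> C * b ^ k" and "t \<ge> 0"
  shows "norm (bexp P t) \<le> C * exp (b * t)"
proof -
  have s: "(\<lambda>k. C * (b * t) ^ k /\<^sub>R fact k) sums (C * exp (b * t))"
    using sums_mult[OF exp_converges[of "b * t"], of C] by (simp add: mult.left_commute)
  have "norm (bexp P t) \<le> (\<Sum>k. norm ((t ^ k / fact k) *\<^sub>R bpow P k))"
    unfolding bexp_def by (rule summable_norm[OF bexp_summable_norm])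
  also have "\<dots> \<le> (\<Sum>k. C * (b * t) ^ k /\<^sub>R fact k)"
  proof (rule suminf_le[OF _ bexp_summable_norm sums_summable[OF s]])
    fix k
    have "t ^ k * norm (bpow P k) \<le> t ^ k * (C * b ^ k)"
      using assms by (intro mult_left_mono) auto
    then show "norm ((t ^ k / fact k) *\<^sub>R bpow P k) \<le> C * (b * t) ^ k /\<^sub>R fact k"
      using assms(2) by (simp add: power_mult_distrib field_simps)
  qed
  also have "\<dots> = C * exp (b * t)"
    using sums_unique[OF s] by simp
  finally show ?thesis .
qed

text \<open>Termwise differentiation, justified by uniform convergence on a bounded interval around
  \<open>t\<close>; the derived series is the exponential series, shifted by one and multiplied by
  \<open>P\<close>.\<close>

lemma bexp_has_vector_derivative:
  fixes P :: "'a::banach \<Rightarrow>\<^sub>L 'a"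
  shows "(bexp P has_vector_derivative (P o\<^sub>L bexp P t)) (at t)"
proof -
  define N where "N = \<bar>t\<bar> + 1"
  define S where "S = {-N<..<N}"
  define f' where "f' = (\<lambda>k x. (real k * x ^ (k - 1) / fact k) *\<^sub>R bpow P k)"
  have Suc_f': "f' (Suc k) x = P o\<^sub>L ((x ^ k / fact k) *\<^sub>R bpow P k)" for k x
  proof -
    have "real (Suc k) * x ^ k / fact (Suc k) = x ^ k / fact k"
      by (simp add: fact_Suc del: of_nat_Suc)
    then show ?thesis
      by (simp add: f'_def bounded_bilinear.scaleR_right[OF bounded_bilinear_blinfun_compose] del: of_nat_Suc fact_Suc)
  qed
  have lim0: "uniform_limit S (\<lambda>n x. \<Sum>k<n. (x ^ k / fact k) *\<^sub>R bpow P k) (bexp P) sequentially"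
    unfolding bexp_def
  proof (rule Weierstrass_m_test)
    show "summable (\<lambda>k. inverse (fact k) * (N * norm P) ^ k)"
      using summable_exp[of "N * norm P"] .
    show "norm ((x ^ k / fact k) *\<^sub>R bpow P k) \<le> inverse (fact k) * (N * norm P) ^ k" if "x \<in> S" for k x
    proof -
      have "\<bar>x\<bar> ^ k * norm (bpow P k) \<le> N ^ k * norm P ^ k"
        using that norm_bpow_le[of P k] unfolding S_def N_def
        by (intro mult_mono power_mono) auto
      then show ?thesis
        by (simp add: power_abs power_mult_distrib field_simps)
    qed
  qed
  have lim: "uniform_limit S (\<lambda>n x. \<Sum>k<n. f' k x) (\<lambda>x. P o\<^sub>L bexp P x) sequentially"
  proof -
    have "uniform_limit S (\<lambda>n x. P o\<^sub>L (\<Sum>k<n. (x ^ k / fact k) *\<^sub>R bpow P k)) (\<lambda>x. P o\<^sub>L bexp P x) sequentially"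
      by (rule bounded_linear.uniform_limit[OF bounded_bilinear.bounded_linear_right[OF bounded_bilinear_blinfun_compose] lim0])
    \<comment> \<open>The derived partial sums carry one more term, the vanishing derivative of the
      constant term, hence \<open>Suc n\<close>; the shift is undone afterwards, since limits ignore
      it.\<close>
    also have "(\<lambda>n x. P o\<^sub>L (\<Sum>k<n. (x ^ k / fact k) *\<^sub>R bpow P k)) = (\<lambda>n x. \<Sum>k<Suc n. f' k x)"
    proof (intro ext)
      fix n x
      have "(\<Sum>k<Suc n. f' k x) = f' 0 x + (\<Sum>k<n. f' (Suc k) x)"
        by (rule sum.lessThan_Suc_shift)
      also have "\<dots> = (\<Sum>k<n. P o\<^sub>L ((x ^ k / fact k) *\<^sub>R bpow P k))"
        by (simp add: Suc_f') (simp add: f'_def)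
      finally show "P o\<^sub>L (\<Sum>k<n. (x ^ k / fact k) *\<^sub>R bpow P k) = (\<Sum>k<Suc n. f' k x)"
        by (simp add: bounded_bilinear.sum_right[OF bounded_bilinear_blinfun_compose])
    qed
    finally show ?thesis
      unfolding uniform_limit_iff eventually_sequentially
      by (metis Suc_le_D Suc_le_mono)
  qed
  have tS: "t \<in> S" and oS: "open S" "convex S"
    by (auto simp: S_def N_def)
  have "\<exists>g. \<forall>x\<in>S. (\<lambda>n. (x ^ n / fact n) *\<^sub>R bpow P n) sums g x \<and> (g has_derivative (\<lambda>h. h *\<^sub>R (P o\<^sub>L bexp P x))) (at x within S)"
  proof (rule has_derivative_series[OF oS(2) _ _ tS, where f'="\<lambda>n x h. h *\<^sub>R f' n x"])
    fix n x assume "x \<in> S"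
    have "((\<lambda>x. x ^ n / fact n) has_real_derivative (real n * x ^ (n - 1) / fact n)) (at x within S)"
      by (auto intro!: derivative_eq_intros)
    from has_vector_derivative_scaleR[OF this has_vector_derivative_const[of "bpow P n"]]
    show "((\<lambda>x. (x ^ n / fact n) *\<^sub>R bpow P n) has_derivative (\<lambda>h. h *\<^sub>R f' n x)) (at x within S)"
      by (simp add: has_vector_derivative_def f'_def)
  next
    fix e :: real assume "e > 0"
    with lim have "\<forall>\<^sub>F n in sequentially. \<forall>x\<in>S. dist (\<Sum>k<n. f' k x) (P o\<^sub>L bexp P x) < e"
      by (auto simp: uniform_limit_iff)
    then show "\<forall>\<^sub>F n in sequentially. \<forall>x\<in>S. \<forall>h. norm ((\<Sum>i<n. h *\<^sub>R f' i x) - h *\<^sub>R (P o\<^sub>L bexp P x)) \<le> e * norm h"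
    proof eventually_elim
      case (elim n)
      show ?case
      proof (intro ballI allI)
        fix x h assume "x \<in> S"
        with elim have "norm ((\<Sum>k<n. f' k x) - (P o\<^sub>L bexp P x)) \<le> e"
          by (auto simp: dist_norm less_imp_le)
        then have "\<bar>h\<bar> * norm ((\<Sum>k<n. f' k x) - (P o\<^sub>L bexp P x)) \<le> \<bar>h\<bar> * e"
          by (rule mult_left_mono) auto
        then show "norm ((\<Sum>i<n. h *\<^sub>R f' i x) - h *\<^sub>R (P o\<^sub>L bexp P x)) \<le> e * norm h"
          by (simp add: scaleR_sum_right[symmetric] scaleR_diff_right[symmetric] mult.commute)
      qed
    qed
  next
    show "(\<lambda>n. (t ^ n / fact n) *\<^sub>R bpow P n) sums bexp P t"
      unfolding bexp_def by (rule summable_sums[OF bexp_summable])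
  qed
  then obtain g where g: "\<And>x. x \<in> S \<Longrightarrow> (\<lambda>n. (x ^ n / fact n) *\<^sub>R bpow P n) sums g x"
     "(g has_derivative (\<lambda>h. h *\<^sub>R (P o\<^sub>L bexp P t))) (at t within S)"
    using tS by blast
  have "g x = bexp P x" if "x \<in> S" for x
    using sums_unique[OF g(1)[OF that]] by (simp add: bexp_def)
  then have "(bexp P has_derivative (\<lambda>h. h *\<^sub>R (P o\<^sub>L bexp P t))) (at t within S)"
    using g(2) tS by (metis has_derivative_transform)
  then show ?thesis
    using at_within_open[OF tS oS(1)] by (simp add: has_vector_derivative_def)
qed

lemma blinfun_tendsto_closure:
  fixes L :: "nat \<Rightarrow> ('a::real_normed_vector \<Rightarrow>\<^sub>L 'b::real_normed_vector)"
  assumes bd: "\<forall>\<^sub>F n in sequentially. norm (L n) \<le> K"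
    and lim: "\<And>z. z \<in> X \<Longrightarrow> (\<lambda>n. L n z) \<longlonglongrightarrow> blinfun_apply L' z" and x: "x \<in> closure X"
  shows "(\<lambda>n. L n x) \<longlonglongrightarrow> blinfun_apply L' x"
proof (rule tendstoI)
  fix e :: real assume e: "e > 0"
  \<comment> \<open>The sign of \<open>K\<close> is not known, hence the absolute value; adding 1
    makes the divisor in \<open>e / (2 * M)\<close> positive.\<close>
  define M where "M = \<bar>K\<bar> + norm L' + 1"
  have M: "M > 0" unfolding M_def by (smt (verit) norm_ge_zero)
  obtain z where z: "z \<in> X" "dist z x < e / (2 * M)"
    using x e M by (meson closure_approachable divide_pos_pos mult_pos_pos zero_less_numeral)
  have "\<forall>\<^sub>F n in sequentially. dist (L n z) (L' z) < e / 2"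
    using lim[OF z(1)] e half_gt_zero by (blast dest: tendstoD)
  with bd show "\<forall>\<^sub>F n in sequentially. dist (L n x) (L' x) < e"
  proof eventually_elim
    case (elim n)
    have "dist (L n x) (L' x) = norm (L n (x - z) - L' (x - z) + (L n z - L' z))"
      by (simp add: dist_norm blinfun.diff_right)
    also have "\<dots> \<le> norm (L n (x - z)) + norm (L' (x - z)) + norm (L n z - L' z)"
      by (meson norm_triangle_ineq norm_triangle_ineq4 add_mono order_trans order_refl)
    also have "norm (L n (x - z)) \<le> \<bar>K\<bar> * norm (x - z)"
      using norm_blinfun[of "L n" "x - z"] elim by (smt (verit) mult_right_mono norm_ge_zero)
    also have "norm (L' (x - z)) \<le> norm L' * norm (x - z)"
      by (rule norm_blinfun)
    also have "\<bar>K\<bar> * norm (x - z) + norm L' * norm (x - z) + norm (L n z - L' z) \<le> M * norm (x - z) + norm (L n z - L' z)"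
      by (simp add: M_def algebra_simps)
    also have "M * norm (x - z) < e / 2"
      using z(2) M by (simp add: dist_norm norm_minus_commute field_simps)
    also have "norm (L n z - L' z) < e / 2" using elim by (simp add: dist_norm)
    finally show ?case by simp
  qed
qed

section \<open>The semigroup on the closure of the domain\<close>

lemma bpow_1: "bpow P 1 = P"
  by (intro blinfun_eqI) simp

lemma norm_diff_add_le: "norm (a - b + c :: 'a::real_normed_vector) \<le> norm a + norm b + norm c"
  by (smt (verit) norm_triangle_ineq norm_triangle_ineq4)

lemma eventually_large: "\<forall>\<^sub>F n in sequentially. real n \<ge> c"
  using filterlim_real_sequentially by (simp add: filterlim_at_top)

text \<open>The hypotheses in working form: the resolvent is a family of bounded operators,
  closedness is sequential, and the constants are normalised so that \<open>w \<ge> 0\<close> and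
  \<open>C \<ge> 1\<close>. The second normalisation lets the bound on powers include the zeroth
  one.\<close>

locale hy_operator = time_interval T
  for D :: "'a::banach set" and A :: "'a \<Rightarrow> 'a" and R :: "real \<Rightarrow> 'a \<Rightarrow>\<^sub>L 'a" and w C T :: real +
  assumes subspace_D: "subspace D"
    and A_add: "x \<in> D \<Longrightarrow> y \<in> D \<Longrightarrow> A (x + y) = A x + A y"
    and A_scale: "x \<in> D \<Longrightarrow> A (c *\<^sub>R x) = c *\<^sub>R A x"
    and A_closed: "(\<And>n. X n \<in> D) \<Longrightarrow> X \<longlonglongrightarrow> x \<Longrightarrow> (\<lambda>n. A (X n)) \<longlonglongrightarrow> y \<Longrightarrow> x \<in> D \<and> A x = y"
    and R_in_D: "w < l \<Longrightarrow> R l x \<in> D"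
    and A_R: "w < l \<Longrightarrow> A (R l x) = l *\<^sub>R R l x - x"
    and R_A: "w < l \<Longrightarrow> x \<in> D \<Longrightarrow> R l (A x) = l *\<^sub>R R l x - x"
    and R_pow_le: "w < l \<Longrightarrow> norm (bpow (R l) k) \<le> C / (l - w) ^ k"
    and w_nonneg: "w \<ge> 0" and C_ge_1: "C \<ge> 1"
begin

lemma A_0 [simp]: "A 0 = 0"
  using A_scale[of 0 0] subspace_0[OF subspace_D] by simp

lemma A_diff: "x \<in> D \<Longrightarrow> y \<in> D \<Longrightarrow> A (x - y) = A x - A y"
  using A_add[of x "-1 *\<^sub>R y"] A_scale[of y "-1"] subspace_scale[OF subspace_D, of y "-1"] by simp

lemma resolvent_identity:
  assumes "w < l" "w < m"
  shows "(m - l) *\<^sub>R R m (R l x) = R l x - R m x"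
  using R_A[OF assms(2) R_in_D[OF assms(1)], of x]
  by (simp add: A_R[OF assms(1)] blinfun.diff_right blinfun.scaleR_right algebra_simps)

text \<open>Exchanging \<open>l\<close> and \<open>m\<close> in the resolvent identity only changes
  the sign of both sides.\<close>

lemma R_commute:
  assumes "w < l" "w < m"
  shows "R l (R m x) = R m (R l x)"
proof (cases "l = m")
  case False
  have "(m - l) *\<^sub>R R m (R l x) = - ((l - m) *\<^sub>R R l (R m x))"
    unfolding resolvent_identity[OF assms] resolvent_identity[OF assms(2,1)] by simp
  then have "(m - l) *\<^sub>R R m (R l x) = (m - l) *\<^sub>R R l (R m x)"
    by (simp flip: scaleR_minus_left)
  then show ?thesis using False by simp
qed simp

lemma R_eq_shift: "w < l \<Longrightarrow> x \<in> D \<Longrightarrow> x = R l (l *\<^sub>R x - A x)"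
  using R_A[of l x] by (simp add: blinfun.diff_right blinfun.scaleR_right)

lemma norm_R_le: "w < l \<Longrightarrow> norm (R l) \<le> C / (l - w)"
  using R_pow_le[of l 1] bpow_1[of "R l"] by simp

text \<open>The operator \<open>A R(l)\<close> in bounded form; on \<open>D\<close> it also equals
  \<open>R(l) A\<close>.\<close>

definition AR :: "real \<Rightarrow> 'a \<Rightarrow>\<^sub>L 'a" where "AR l = l *\<^sub>R R l - id_blinfun"

lemma AR_apply: "AR l x = l *\<^sub>R R l x - x"
  by (simp add: AR_def blinfun.diff_left blinfun.scaleR_left)

lemma A_R': "w < l \<Longrightarrow> A (R l x) = AR l x"
  by (simp add: AR_apply A_R)

lemma R_A': "w < l \<Longrightarrow> x \<in> D \<Longrightarrow> R l (A x) = AR l x"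
  by (simp add: AR_apply R_A)

text \<open>The operators \<open>l R(l)\<close> map everything into \<open>D\<close> and tend to the
  identity on the closure of \<open>D\<close>; they are the smoothing device of the proof.\<close>

definition J :: "real \<Rightarrow> 'a \<Rightarrow>\<^sub>L 'a" where "J l = l *\<^sub>R R l"

lemma J_apply: "J l x = l *\<^sub>R R l x"
  by (simp add: J_def blinfun.scaleR_left)

lemma J_in_D: "w < l \<Longrightarrow> J l x \<in> D"
  by (simp add: J_apply R_in_D subspace_scale[OF subspace_D])

text \<open>Origin of the threshold \<open>2 * w + 1\<close>: it gives \<open>l > w\<close>,
  \<open>l > 0\<close> and \<open>l / (l - w) \<le> 2\<close>.\<close>

lemma norm_J_le:
  assumes "l \<ge> 2 * w + 1"
  shows "norm (J l) \<le> 2 * C"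
proof -
  have l: "l > w" "l > 0" "l / (l - w) \<le> 2" using assms w_nonneg by (auto simp: field_simps)
  have "norm (J l) \<le> l * (C / (l - w))"
    using l norm_R_le[OF l(1)] unfolding J_def norm_scaleR by (intro mult_mono) auto
  also have "\<dots> = l / (l - w) * C" by simp
  also have "\<dots> \<le> 2 * C" using l C_ge_1 by (intro mult_right_mono) auto
  finally show ?thesis .
qed

lemma inverse_shift_tendsto: "(\<lambda>n. c / (real n - w)) \<longlonglongrightarrow> 0"
  by real_asymp

text \<open>On \<open>D\<close> the error is \<open>R(n) A x\<close>, of order
  \<open>1 / n\<close>.\<close>

lemma J_tendsto_D:
  assumes "x \<in> D"
  shows "(\<lambda>n. J (real n) x) \<longlonglongrightarrow> x"
proof -
  have "(\<lambda>n. J (real n) x - x) \<longlonglongrightarrow> 0"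
  proof (rule Lim_null_comparison)
    show "(\<lambda>n. C * norm (A x) / (real n - w)) \<longlonglongrightarrow> 0"
      by (rule inverse_shift_tendsto)
    show "\<forall>\<^sub>F n in sequentially. norm (J (real n) x - x) \<le> C * norm (A x) / (real n - w)"
      using eventually_large[of "2 * w + 1"]
    proof eventually_elim
      case (elim n)
      then have n: "w < real n" using w_nonneg by simp
      have "J n x - x = R n (A x)" using R_A[OF n assms] by (simp add: J_apply)
      then show ?case
        using norm_blinfun[of "R n" "A x"] mult_right_mono[OF norm_R_le[OF n], of "norm (A x)"] by simp
    qed
  qed
  then show ?thesis by (simp add: LIM_zero_iff)
qed

lemma J_tendsto:
  assumes "x \<in> closure D"
  shows "(\<lambda>n. J (real n) x) \<longlonglongrightarrow> x"
proof -
  have "(\<lambda>n. J (real n) x) \<longlonglongrightarrow> id_blinfun x"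
  proof (rule blinfun_tendsto_closure[OF _ _ assms])
    show "\<forall>\<^sub>F n in sequentially. norm (J (real n)) \<le> 2 * C"
      using eventually_large[of "2 * w + 1"] by eventually_elim (rule norm_J_le)
    show "\<And>z. z \<in> D \<Longrightarrow> (\<lambda>n. J (real n) z) \<longlonglongrightarrow> blinfun_apply id_blinfun z"
      using J_tendsto_D by simp
  qed
  then show ?thesis by simp
qed

lemma J_J_tendsto:
  assumes "x \<in> closure D"
  shows "(\<lambda>n. J (real n) (J (real n) x)) \<longlonglongrightarrow> x"
proof -
  have "(\<lambda>n. J (real n) (J (real n) x - x)) \<longlonglongrightarrow> 0"
  proof (rule Lim_null_comparison)
    show "(\<lambda>n. 2 * C * norm (J (real n) x - x)) \<longlonglongrightarrow> 0"
      using tendsto_mult_right_zero[OF tendsto_norm_zero[OF LIM_zero[OF J_tendsto[OF assms]]]] .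
    show "\<forall>\<^sub>F n in sequentially. norm (J (real n) (J (real n) x - x)) \<le> 2 * C * norm (J (real n) x - x)"
      using eventually_large[of "2 * w + 1"]
    proof eventually_elim
      case (elim n)
      then show ?case
        using norm_blinfun[of "J n" "J n x - x"] mult_right_mono[OF norm_J_le[OF elim], of "norm (J n x - x)"] by simp
    qed
  qed
  from tendsto_add[OF this J_tendsto[OF assms]] show ?thesis
    by (simp add: blinfun.diff_right)
qed

text \<open>The Yosida approximation \<open>l A R(l)\<close> in bounded form. For
  \<open>l > w\<close> it equals \<open>A J(l)\<close> everywhere and \<open>J(l) A\<close> on
  \<open>D\<close>.\<close>

definition B :: "real \<Rightarrow> 'a \<Rightarrow>\<^sub>L 'a" where "B l = l\<^sup>2 *\<^sub>R R l - l *\<^sub>R id_blinfun"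

text \<open>
  The group \<open>exp(t B l)\<close>.  The factor \<open>exp(- l t)\<close> is split off so that the bound on the powers of
  the resolvent controls the remaining power series.
\<close>

definition E :: "real \<Rightarrow> real \<Rightarrow> 'a \<Rightarrow>\<^sub>L 'a" where
  "E l t = exp (- l * t) *\<^sub>R bexp (l\<^sup>2 *\<^sub>R R l) t"

lemma B_apply: "B l x = l\<^sup>2 *\<^sub>R R l x - l *\<^sub>R x"
  by (simp add: B_def blinfun.diff_left blinfun.scaleR_left)

lemma B_eq_A_J: "w < l \<Longrightarrow> B l x = A (J l x)"
  by (simp add: B_apply J_apply A_scale R_in_D A_R power2_eq_square scaleR_diff_right)

lemma B_eq_J_A: "w < l \<Longrightarrow> x \<in> D \<Longrightarrow> B l x = J l (A x)"
  by (simp add: B_apply J_apply R_A power2_eq_square scaleR_diff_right)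

lemma E_0 [simp]: "E l 0 = id_blinfun"
  by (simp add: E_def)

lemma E_commute_op:
  assumes "Q o\<^sub>L R l = R l o\<^sub>L Q"
  shows "Q o\<^sub>L E l t = E l t o\<^sub>L Q"
proof -
  have "Q o\<^sub>L (l\<^sup>2 *\<^sub>R R l) = (l\<^sup>2 *\<^sub>R R l) o\<^sub>L Q"
    using assms by (simp add: bounded_bilinear.scaleR_left[OF bounded_bilinear_blinfun_compose]
          bounded_bilinear.scaleR_right[OF bounded_bilinear_blinfun_compose])
  from bexp_commute[OF this, of t] show ?thesis
    by (simp add: E_def bounded_bilinear.scaleR_left[OF bounded_bilinear_blinfun_compose]
          bounded_bilinear.scaleR_right[OF bounded_bilinear_blinfun_compose])
qed

lemma E_commute_R:
  assumes "w < l" "w < m"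
  shows "R m (E l t x) = E l t (R m x)"
proof -
  have "R m o\<^sub>L R l = R l o\<^sub>L R m" using R_commute[OF assms(2,1)] by (intro blinfun_eqI) simp
  from E_commute_op[OF this, of t] show ?thesis
    by (metis blinfun_apply_blinfun_compose)
qed

lemma E_commute_B:
  assumes "w < l" "w < m"
  shows "B m (E l t x) = E l t (B m x)"
  by (simp add: B_apply E_commute_R[OF assms] blinfun.diff_right blinfun.scaleR_right)

text \<open>The growth rate \<open>l^2 / (l - w)\<close> of the power series minus the rate
  \<open>l\<close> that was split off is \<open>w * (l / (l - w))\<close>, which is at most
  \<open>2 * w\<close> above the threshold. The bound is therefore uniform in
  \<open>l\<close>.\<close>

lemma norm_E_le:
  assumes "l \<ge> 2 * w + 1" "t \<in> {0..T}"
  shows "norm (E l t) \<le> C * exp (2 * w * T)"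
proof -
  have l: "l > w" "l > 0" using assms w_nonneg by auto
  have "norm (bexp (l\<^sup>2 *\<^sub>R R l) t) \<le> C * exp ((l\<^sup>2 / (l - w)) * t)"
  proof (rule bexp_norm_le)
    fix k
    have "norm (bpow (l\<^sup>2 *\<^sub>R R l) k) \<le> (l\<^sup>2) ^ k * (C / (l - w) ^ k)"
      using mult_left_mono[OF R_pow_le[OF l(1), of k], of "(l\<^sup>2) ^ k"] by (simp add: bpow_scaleR)
    then show "norm (bpow (l\<^sup>2 *\<^sub>R R l) k) \<le> C * (l\<^sup>2 / (l - w)) ^ k"
      by (simp add: power_divide mult.commute)
  qed (use assms in auto)
  then have "norm (E l t) \<le> exp (- l * t) * (C * exp ((l\<^sup>2 / (l - w)) * t))"
    by (simp add: E_def)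
  also have "\<dots> = C * exp ((l\<^sup>2 / (l - w) - l) * t)"
    by (simp add: exp_add[symmetric] algebra_simps)
  also have "l\<^sup>2 / (l - w) - l = w * (l / (l - w))"
    using l by (simp add: field_simps power2_eq_square)
  also have "exp (w * (l / (l - w)) * t) \<le> exp (2 * w * T)"
  proof -
    have "l / (l - w) \<le> 2" using assms l w_nonneg by (simp add: field_simps)
    then have "w * (l / (l - w)) * t \<le> w * 2 * T"
      using assms w_nonneg l by (intro mult_mono) auto
    then show ?thesis by (simp add: mult.commute mult.left_commute)
  qed
  finally show ?thesis using C_ge_1 by simp
qed

definition K :: real where "K = C * exp (2 * w * T)"

lemma K_ge_1: "K \<ge> 1"
proof -
  have "1 * 1 \<le> C * exp (2 * w * T)"
    using C_ge_1 w_nonneg T_pos by (intro mult_mono) auto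
  then show ?thesis by (simp add: K_def)
qed

lemma norm_E_apply_le:
  assumes "l \<ge> 2 * w + 1" "t \<in> {0..T}"
  shows "norm (E l t x) \<le> K * norm x"
  using norm_blinfun[of "E l t" x] norm_E_le[OF assms] unfolding K_def
  by (meson mult_right_mono norm_ge_zero order_trans)

lemma E_has_vector_derivative:
  "(E l has_vector_derivative (B l o\<^sub>L E l t)) (at t within S)"
proof -
  have "((\<lambda>t. exp (- l * t)) has_real_derivative (- l * exp (- l * t))) (at t)"
    by (auto intro!: derivative_eq_intros)
  from has_vector_derivative_scaleR[OF this bexp_has_vector_derivative[of "l\<^sup>2 *\<^sub>R R l" t]]
  have "(E l has_vector_derivative (exp (- l * t) *\<^sub>R (l\<^sup>2 *\<^sub>R R l o\<^sub>L bexp (l\<^sup>2 *\<^sub>R R l) t) +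
         (- l * exp (- l * t)) *\<^sub>R bexp (l\<^sup>2 *\<^sub>R R l) t)) (at t)"
    by (simp add: E_def[abs_def])
  also have "exp (- l * t) *\<^sub>R (l\<^sup>2 *\<^sub>R R l o\<^sub>L bexp (l\<^sup>2 *\<^sub>R R l) t) +
         (- l * exp (- l * t)) *\<^sub>R bexp (l\<^sup>2 *\<^sub>R R l) t = B l o\<^sub>L E l t"
    by (intro blinfun_eqI) (simp add: E_def B_def blinfun.bilinear_simps scaleR_blinfun.rep_eq algebra_simps)
  finally show ?thesis by (rule has_vector_derivative_at_within)
qed

lemma E_apply_has_vector_derivative:
  "((\<lambda>t. E l t x) has_vector_derivative B l (E l t x)) (at t within S)"
  using bounded_linear.has_vector_derivative[OF blinfun.bounded_linear_left[of x] E_has_vector_derivative[of l t S]]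
  by simp

lemma E_reverse_has_vector_derivative:
  "((\<lambda>s. E l (t - s)) has_vector_derivative - (B l o\<^sub>L E l (t - s))) (at s within S)"
proof -
  have "((\<lambda>s. t - s) has_vector_derivative (- 1)) (at s within S)"
    by (auto intro!: derivative_eq_intros simp: has_real_derivative_iff_has_vector_derivative[symmetric])
  from vector_diff_chain_within[OF this E_has_vector_derivative]
  show ?thesis by (simp add: o_def)
qed

lemma continuous_on_E: "continuous_on S (\<lambda>t. E l t x)"
  unfolding continuous_on_eq_continuous_within
  by (blast intro: E_apply_has_vector_derivative has_vector_derivative_continuous)

text \<open>The curve \<open>E m (t - s) (E l s x)\<close> runs from \<open>E m t x\<close> to
  \<open>E l t x\<close>. All operators commute, so its derivative is
  \<open>E m (t - s) (E l s (B l x - B m x))\<close>; the two exponentials contribute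
  \<open>K^2\<close> and the length of the interval contributes \<open>T\<close>.\<close>

lemma E_diff_le:
  assumes "l \<ge> 2 * w + 1" "m \<ge> 2 * w + 1" "t \<in> {0..T}"
  shows "norm (E l t x - E m t x) \<le> T * K\<^sup>2 * norm (B l x - B m x)"
proof -
  have lm: "w < l" "w < m" using assms w_nonneg by auto
  define d where "d = (\<lambda>s. E m (t - s) (E l s x))"
  have d': "(d has_vector_derivative E m (t - s) (E l s (B l x - B m x))) (at s within {0..t})" for s
  proof -
    have "(d has_vector_derivative E m (t - s) (B l (E l s x)) + (- (B m o\<^sub>L E m (t - s))) (E l s x)) (at s within {0..t})"
      unfolding d_def
      by (rule bounded_bilinear.has_vector_derivative[OF bounded_bilinear_blinfun_apply
            E_reverse_has_vector_derivative E_apply_has_vector_derivative])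
    moreover have "E m (t - s) (B l (E l s x)) + (- (B m o\<^sub>L E m (t - s))) (E l s x) = E m (t - s) (E l s (B l x - B m x))"
      by (simp add: blinfun.minus_left blinfun.diff_right E_commute_B lm)
    ultimately show ?thesis by simp
  qed
  have "norm (d t - d 0) \<le> K\<^sup>2 * norm (B l x - B m x) * norm (t - 0)"
  proof (rule differentiable_bound[where S="{0..t}"])
    fix s assume s: "s \<in> {0..t}"
    show "(d has_derivative (\<lambda>h. h *\<^sub>R E m (t - s) (E l s (B l x - B m x)))) (at s within {0..t})"
      using d' by (simp add: has_vector_derivative_def)
    have "norm (E m (t - s) (E l s (B l x - B m x))) \<le> K * (K * norm (B l x - B m x))"
    proof -
      have "norm (E m (t - s) (E l s (B l x - B m x))) \<le> K * norm (E l s (B l x - B m x))"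
        using assms s by (intro norm_E_apply_le) auto
      also have "\<dots> \<le> K * (K * norm (B l x - B m x))"
        using assms s K_ge_1 by (intro mult_left_mono norm_E_apply_le) auto
      finally show ?thesis .
    qed
    moreover have "0 \<le> K * (K * norm (B l x - B m x))"
      using K_ge_1 by simp
    ultimately show "onorm (\<lambda>h. h *\<^sub>R E m (t - s) (E l s (B l x - B m x))) \<le> K\<^sup>2 * norm (B l x - B m x)"
      by (intro onorm_bound) (auto simp: power2_eq_square mult_left_mono mult.assoc mult.commute[of _ "\<bar>_\<bar>"])
  qed (use assms in auto)
  also have "\<dots> \<le> T * (K\<^sup>2 * norm (B l x - B m x))"
    using assms by (simp add: mult.commute[of _ t] mult_right_mono)
  finally show ?thesis by (simp add: d_def mult.assoc)
qed

text \<open>For \<open>x\<close> in \<open>D\<close> the smoothed vectors \<open>J n x\<close> lie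
  in the domain of the square of \<open>A\<close>, because \<open>A (J n x) = J n (A x)\<close>. The
  second condition \<open>A x \<in> D\<close> is what makes \<open>J n (A x)\<close> converge when
  \<open>D\<close> is not dense.\<close>

lemma dense_D2:
  assumes "z \<in> closure D"
  shows "z \<in> closure {x \<in> D. A x \<in> D}"
proof -
  have *: "x \<in> closure {x \<in> D. A x \<in> D}" if x: "x \<in> D" for x
  proof -
    obtain N where N: "real N \<ge> 2 * w + 1" using real_arch_simple by blast
    have 1: "(\<lambda>n. J (real (n + N)) x) \<longlonglongrightarrow> x"
      by (rule LIMSEQ_ignore_initial_segment[OF J_tendsto_D[OF x]])
    have 2: "J (real (n + N)) x \<in> {x \<in> D. A x \<in> D}" for n
    proof -
      have n: "w < real (n + N)" using N w_nonneg by simp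
      show ?thesis
        using J_in_D[OF n] B_eq_A_J[OF n, of x] B_eq_J_A[OF n x] by auto
    qed
    show ?thesis
      unfolding closure_sequential by (intro exI[of _ "\<lambda>n. J (real (n + N)) x"] conjI allI 1 2)
  qed
  then have "closure D \<subseteq> closure {x \<in> D. A x \<in> D}"
    by (metis (no_types, lifting) closure_closure closure_mono subsetI)
  with assms show ?thesis by blast
qed

text \<open>At a nearby \<open>x\<close> with \<open>A x\<close> in \<open>D\<close> the vectors
  \<open>B n x = J n (A x)\<close> converge, so the exponentials are Cauchy uniformly in time there.
  Passing from \<open>x\<close> back to \<open>z\<close> costs at most \<open>e / 4\<close> for each
  of the two exponentials, thanks to their common bound \<open>K\<close>.\<close>

lemma E_Cauchy:
  assumes z: "z \<in> closure D"
  shows "uniformly_Cauchy_on {0..T} (\<lambda>n t. E (real n) t z)"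
  unfolding uniformly_Cauchy_on_def
proof (intro allI impI)
  fix e :: real assume e: "e > 0"
  obtain x where x: "x \<in> D" "A x \<in> D" "dist x z < e / (4 * K)"
  proof -
    have "e / (4 * K) > 0" using e K_ge_1 by simp
    with dense_D2[OF z] show thesis unfolding closure_approachable using that by blast
  qed
  have "Cauchy (\<lambda>n. J (real n) (A x))"
    using J_tendsto_D[OF x(2)] by (auto intro: LIMSEQ_imp_Cauchy)
  moreover have "e / (2 * T * K\<^sup>2) > 0" using e T_pos K_ge_1 by simp
  ultimately obtain M where M: "\<And>m n. m \<ge> M \<Longrightarrow> n \<ge> M \<Longrightarrow> norm (J (real m) (A x) - J (real n) (A x)) < e / (2 * T * K\<^sup>2)"
    by (meson CauchyD)
  obtain N where N: "real N \<ge> 2 * w + 1" using real_arch_simple by blast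
  show "\<exists>M. \<forall>t\<in>{0..T}. \<forall>m\<ge>M. \<forall>n\<ge>M. dist (E (real m) t z) (E (real n) t z) < e"
  proof (intro exI[of _ "max M N"] ballI allI impI)
    fix t m n assume t: "t \<in> {0..T}" and mn: "m \<ge> max M N" "n \<ge> max M N"
    have m: "real m \<ge> 2 * w + 1" "real n \<ge> 2 * w + 1" using N mn by auto
    then have w: "w < real m" "w < real n" using w_nonneg by auto
    have "norm (E m t x - E n t x) \<le> T * K\<^sup>2 * norm (B m x - B n x)"
      by (rule E_diff_le[OF m t])
    also have "\<dots> = T * K\<^sup>2 * norm (J m (A x) - J n (A x))"
      by (simp add: B_eq_J_A w x)
    also have "\<dots> < T * K\<^sup>2 * (e / (2 * T * K\<^sup>2))"
      using M mn T_pos K_ge_1 by (intro mult_strict_left_mono) auto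
    also have "\<dots> = e / 2" using T_pos K_ge_1 by simp
    finally have 1: "norm (E m t x - E n t x) < e / 2" .
    have "K * norm (z - x) < e / 4"
      using x(3) K_ge_1 by (simp add: dist_norm norm_minus_commute field_simps)
    then have 2: "norm (E m t (z - x)) < e / 4" "norm (E n t (z - x)) < e / 4"
      using norm_E_apply_le[OF m(1) t, of "z - x"] norm_E_apply_le[OF m(2) t, of "z - x"] by linarith+
    have "E m t z - E n t z = E m t (z - x) - E n t (z - x) + (E m t x - E n t x)"
      by (simp add: blinfun.diff_right)
    then have "norm (E m t z - E n t z) \<le> norm (E m t (z - x)) + norm (E n t (z - x)) + norm (E m t x - E n t x)"
      by (simp only: norm_diff_add_le)
    with 1 2 show "dist (E m t z) (E n t z) < e" by (simp add: dist_norm)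
  qed
qed

text \<open>The semigroup on the closure of \<open>D\<close>, for times in \<open>{0..T}\<close>;
  for other arguments \<open>lim\<close> carries no information.\<close>

definition S :: "'a \<Rightarrow> real \<Rightarrow> 'a" where "S z t = lim (\<lambda>n. E (real n) t z)"

lemma E_uniform_limit:
  assumes "z \<in> closure D"
  shows "uniform_limit {0..T} (\<lambda>n t. E (real n) t z) (S z) sequentially"
  using Cauchy_uniformly_convergent[OF E_Cauchy[OF assms]]
  unfolding S_def[abs_def] by (simp add: uniformly_convergent_uniform_limit_iff)

lemma E_tendsto: "z \<in> closure D \<Longrightarrow> t \<in> {0..T} \<Longrightarrow> (\<lambda>n. E (real n) t z) \<longlonglongrightarrow> S z t"
  by (rule tendsto_uniform_limitI[OF E_uniform_limit])

lemma continuous_on_S: "z \<in> closure D \<Longrightarrow> continuous_on {0..T} (S z)"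
  by (rule uniform_limit_theorem[OF _ E_uniform_limit]) (auto simp: continuous_on_E)

text \<open>Integrating the equation for the exponential gives
  \<open>E n t z - z = A (J n I)\<close>, where \<open>I\<close> is the integral of
  \<open>E n s z\<close>. Since \<open>J n\<close> commutes with \<open>E n\<close> it can be moved
  onto \<open>z\<close>, so \<open>J n I\<close> has the same limit as \<open>I\<close>, and
  closedness of \<open>A\<close> applies.\<close>

lemma S_integral:
  assumes z: "z \<in> closure D" and t: "t \<in> {0..T}"
  shows "integral {0..t} (S z) \<in> D \<and> A (integral {0..t} (S z)) = S z t - z"
proof -
  \<comment> \<open>Shifting the index by \<open>N\<close> puts the whole sequence above the
    threshold, so that each of its members lies in \<open>D\<close>, as closedness requires.\<close>
  obtain N where N: "real N \<ge> 2 * w + 1" using real_arch_simple by blast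
  have w: "w < real (n + N)" and ge: "real (n + N) \<ge> 2 * w + 1" for n using N w_nonneg by auto
  define X where "X = (\<lambda>n. integral {0..t} (\<lambda>s. E (real (n + N)) s z))"
  have sub: "{0..t} \<subseteq> {0..T}" using t by auto
  have ul: "uniform_limit {0..t} (\<lambda>n s. E (real (n + N)) s z) (S z) sequentially"
    using uniform_limit_on_subset[OF E_uniform_limit[OF z] sub]
    unfolding uniform_limit_iff eventually_sequentially by (meson trans_le_add1)
  obtain I I' where I: "\<And>n. ((\<lambda>s. E (real (n + N)) s z) has_integral I n) {0..t}"
    "(S z has_integral I') {0..t}" "I \<longlonglongrightarrow> I'"
    by (rule uniform_limit_integral[OF ul]) (auto simp: continuous_on_E)
  define Y where "Y = (\<lambda>n. J (real (n + N)) (I n))"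
  have Y_D: "Y n \<in> D" for n
    unfolding Y_def by (rule J_in_D[OF w])
  have "Y \<longlonglongrightarrow> I'"
  proof -
    have Y_diff: "norm (Y n - I n) \<le> K * norm (J (real (n + N)) z - z) * T" for n
    proof -
      have 1: "((\<lambda>s. E (real (n + N)) s (J (real (n + N)) z - z)) has_integral (Y n - I n)) {0..t}"
      proof -
        have "((\<lambda>s. J (real (n + N)) (E (real (n + N)) s z) - E (real (n + N)) s z) has_integral (Y n - I n)) {0..t}"
          unfolding Y_def using has_integral_linear[OF I(1) blinfun.bounded_linear_right]
          by (intro has_integral_diff I(1)) (simp add: o_def)
        moreover have "J (real (n + N)) (E (real (n + N)) s z) - E (real (n + N)) s z = E (real (n + N)) s (J (real (n + N)) z - z)" for s
          using E_commute_R[OF w w, of n n s z] by (simp add: J_apply blinfun.diff_right blinfun.scaleR_right)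
        ultimately show ?thesis by simp
      qed
      have "norm (Y n - I n) \<le> (K * norm (J (real (n + N)) z - z)) * measure lborel {0..t}"
      proof (rule has_integral_bound_real[OF _ finite.emptyI 1])
        show "0 \<le> K * norm (J (real (n + N)) z - z)" using K_ge_1 by simp
        show "norm (E (real (n + N)) s (J (real (n + N)) z - z)) \<le> K * norm (J (real (n + N)) z - z)" if "s \<in> {0..t} - {}" for s
          using that t by (intro norm_E_apply_le ge) auto
      qed
      also have "\<dots> \<le> (K * norm (J (real (n + N)) z - z)) * T"
        using t K_ge_1 by (intro mult_left_mono) auto
      finally show ?thesis .
    qed
    have "(\<lambda>n. K * norm (J (real (n + N)) z - z) * T) \<longlonglongrightarrow> 0"
      by (intro tendsto_mult_left_zero tendsto_mult_right_zero tendsto_norm_zero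
          LIM_zero[OF LIMSEQ_ignore_initial_segment[OF J_tendsto[OF z], of N]])
    then have "(\<lambda>n. Y n - I n) \<longlonglongrightarrow> 0"
      using Y_diff by (auto intro: Lim_null_comparison[of _ "\<lambda>n. K * norm (J (real (n + N)) z - z) * T", rotated])
    from tendsto_add[OF this I(3)] show ?thesis by simp
  qed
  moreover have "(\<lambda>n. A (Y n)) \<longlonglongrightarrow> S z t - z"
  proof -
    have "A (Y n) = E (real (n + N)) t z - z" for n
    proof -
      have "((\<lambda>s. B (real (n + N)) (E (real (n + N)) s z)) has_integral (E (real (n + N)) t z - E (real (n + N)) 0 z)) {0..t}"
        using t by (intro fundamental_theorem_of_calculus E_apply_has_vector_derivative) auto
      moreover have "((\<lambda>s. B (real (n + N)) (E (real (n + N)) s z)) has_integral B (real (n + N)) (I n)) {0..t}"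
        using has_integral_linear[OF I(1) blinfun.bounded_linear_right] by (simp add: o_def)
      ultimately have "B (real (n + N)) (I n) = E (real (n + N)) t z - E (real (n + N)) 0 z"
        by (rule has_integral_unique[rotated])
      then show ?thesis
        using B_eq_A_J[OF w, of n "I n"] by (simp add: Y_def)
    qed
    then show ?thesis
      using LIMSEQ_ignore_initial_segment[OF E_tendsto[OF z t], of N]
      by (auto intro!: tendsto_diff)
  qed
  ultimately have "I' \<in> D \<and> A I' = S z t - z"
    using A_closed Y_D by blast
  then show ?thesis using I(2) by (simp add: integral_unique)
qed

end

section \<open>Integrated solutions\<close>

text \<open>Difference quotients stay in the subspace. This is applied to the integral of an
  integrated solution, which lies in \<open>D\<close>: the values of the solution itself then lie in
  the closure of \<open>D\<close>.\<close>

lemma derivative_in_closure_subspace: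
  fixes f :: "real \<Rightarrow> 'a::real_normed_vector"
  assumes f': "(f has_vector_derivative f') (at t within {a..b})"
    and V: "subspace V" "\<And>s. s \<in> {a..b} \<Longrightarrow> f s \<in> V" and t: "t \<in> {a..b}" "a < b"
  shows "f' \<in> closure V"
  unfolding closure_approachable
proof (intro allI impI)
  fix e :: real assume "e > 0"
  then obtain d where d: "d > 0" "\<And>y. y \<in> {a..b} \<Longrightarrow> norm (y - t) < d \<Longrightarrow> norm (f y - f t - (y - t) *\<^sub>R f') \<le> e / 2 * norm (y - t)"
    using f' unfolding has_vector_derivative_def has_derivative_within_alt by (meson half_gt_zero)
  \<comment> \<open>A point to the right of \<open>t\<close> if there is room, otherwise one to the
    left.\<close>
  obtain y where y: "y \<in> {a..b}" "y \<noteq> t" "norm (y - t) < d"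
  proof (cases "t < b")
    case True
    then show thesis
      using d(1) t by (intro that[of "min b (t + d / 2)"]) (auto simp: min_def)
  next
    case False
    then show thesis
      using d(1) t by (intro that[of "max a (t - d / 2)"]) (auto simp: max_def)
  qed
  let ?q = "(1 / (y - t)) *\<^sub>R (f y - f t)"
  have "?q - f' = (1 / (y - t)) *\<^sub>R (f y - f t - (y - t) *\<^sub>R f')"
    using y by (simp add: scaleR_diff_right)
  then have "norm (?q - f') \<le> e / 2"
    using d(2)[OF y(1,3)] y(2) by (simp add: pos_divide_le_eq del: scaleR_diff_right)
  moreover have "?q \<in> V"
    using V y t by (intro subspace_scale subspace_diff) auto
  ultimately show "\<exists>z\<in>V. dist z f' < e"
    using \<open>e > 0\<close> by (intro bexI[of _ ?q]) (auto simp: dist_norm)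
qed

section \<open>The integrated equation with polynomial forcing\<close>

context hy_operator
begin

text \<open>Written as \<open>R l (l g - A g)\<close>, the integrand \<open>g\<close> is the image
  of a continuous function under a bounded operator, which can be pulled out of the
  integral.\<close>

lemma integral_in_D:
  fixes t :: real
  assumes g: "\<And>s. s \<in> {0..t} \<Longrightarrow> g s \<in> D" "continuous_on {0..t} g" "continuous_on {0..t} (\<lambda>s. A (g s))"
  shows "integral {0..t} g \<in> D \<and> A (integral {0..t} g) = integral {0..t} (\<lambda>s. A (g s))"
proof -
  define l where "l = w + 1"
  have l: "w < l" by (simp add: l_def)
  note int = integrable_continuous_interval[OF g(2)] integrable_continuous_interval[OF g(3)]
  have "integral {0..t} g = integral {0..t} (\<lambda>s. R l (l *\<^sub>R g s - A (g s)))"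
    using R_eq_shift[OF l] g(1) by (intro integral_cong) auto
  also have "\<dots> = R l (integral {0..t} (\<lambda>s. l *\<^sub>R g s - A (g s)))"
    using integral_linear[OF integrable_diff[OF integrable_cmul[OF int(1), of l] int(2)] blinfun.bounded_linear_right[of "R l"]]
    by (simp add: o_def)
  finally have eq: "integral {0..t} g = R l (integral {0..t} (\<lambda>s. l *\<^sub>R g s - A (g s)))" .
  have "A (integral {0..t} g) = l *\<^sub>R integral {0..t} g - integral {0..t} (\<lambda>s. l *\<^sub>R g s - A (g s))"
    unfolding eq A_R[OF l] ..
  also have "integral {0..t} (\<lambda>s. l *\<^sub>R g s - A (g s)) = l *\<^sub>R integral {0..t} g - integral {0..t} (\<lambda>s. A (g s))"
    by (simp add: integral_diff int integrable_cmul)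
  finally show ?thesis using eq R_in_D[OF l] by simp
qed

text \<open>
  The integrated form of \<open>v' = A v + F'\<close>, \<open>v(0) = x\<close>.  Only the primitive \<open>F\<close> of the forcing enters,
  so that limits of solutions can be taken without any convergence of derivatives.
\<close>

definition mild_solution :: "'a \<Rightarrow> (real \<Rightarrow> 'a) \<Rightarrow> (real \<Rightarrow> 'a) \<Rightarrow> bool" where
  "mild_solution x F v \<longleftrightarrow> continuous_on {0..T} v \<and>
     (\<forall>t\<in>{0..T}. integral {0..t} v \<in> D \<and> v t = x + A (integral {0..t} v) + F t)"

lemma mild_continuous: "mild_solution x F v \<Longrightarrow> continuous_on {0..T} v"
  by (simp add: mild_solution_def)

lemma mild_integrable: "mild_solution x F v \<Longrightarrow> t \<in> {0..T} \<Longrightarrow> v integrable_on {0..t}"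
  by (auto simp: mild_solution_def intro!: integrable_continuous_interval elim: continuous_on_subset)

lemma mild_add:
  assumes 1: "mild_solution x F v" and 2: "mild_solution y G u"
  shows "mild_solution (x + y) (\<lambda>t. F t + G t) (\<lambda>t. v t + u t)"
  unfolding mild_solution_def
proof (intro conjI ballI)
  fix t assume t: "t \<in> {0..T}"
  have *: "integral {0..t} (\<lambda>t. v t + u t) = integral {0..t} v + integral {0..t} u"
    using 1 2 t by (intro integral_add mild_integrable)
  show "integral {0..t} (\<lambda>t. v t + u t) \<in> D"
    unfolding * using 1 2 t by (intro subspace_add[OF subspace_D]) (auto simp: mild_solution_def)
  show "v t + u t = x + y + A (integral {0..t} (\<lambda>t. v t + u t)) + (F t + G t)"
    unfolding * using 1 2 t by (auto simp: mild_solution_def A_add)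
qed (use 1 2 in \<open>auto simp: mild_solution_def intro: continuous_on_add\<close>)

lemma mild_scale:
  assumes 1: "mild_solution x F v"
  shows "mild_solution (c *\<^sub>R x) (\<lambda>t. c *\<^sub>R F t) (\<lambda>t. c *\<^sub>R v t)"
  unfolding mild_solution_def
proof (intro conjI ballI)
  fix t assume t: "t \<in> {0..T}"
  have *: "integral {0..t} (\<lambda>t. c *\<^sub>R v t) = c *\<^sub>R integral {0..t} v"
    by simp
  show "integral {0..t} (\<lambda>t. c *\<^sub>R v t) \<in> D"
    unfolding * using 1 t by (intro subspace_scale[OF subspace_D]) (auto simp: mild_solution_def)
  show "c *\<^sub>R v t = c *\<^sub>R x + A (integral {0..t} (\<lambda>t. c *\<^sub>R v t)) + c *\<^sub>R F t"
    unfolding * using 1 t by (auto simp: mild_solution_def A_scale scaleR_add_right)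
qed (use 1 in \<open>auto simp: mild_solution_def intro: continuous_on_scaleR\<close>)

lemma mild_diff:
  assumes 1: "mild_solution x F v" and 2: "mild_solution y G u"
  shows "mild_solution (x - y) (\<lambda>t. F t - G t) (\<lambda>t. v t - u t)"
  using mild_add[OF 1 mild_scale[OF 2, of "-1"]] by simp

lemma mild_cong: "mild_solution x F v \<Longrightarrow> (\<And>t. t \<in> {0..T} \<Longrightarrow> F t = G t) \<Longrightarrow> mild_solution x G v"
  by (simp add: mild_solution_def)

lemma mild_homogeneous: "z \<in> closure D \<Longrightarrow> mild_solution z (\<lambda>_. 0) (S z)"
  using S_integral by (auto simp: mild_solution_def continuous_on_S)

lemma mild_has_vector_derivative:
  "mild_solution x F v \<Longrightarrow> t \<in> {0..T} \<Longrightarrow> ((\<lambda>t. integral {0..t} v) has_vector_derivative v t) (at t within {0..T})"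
  by (rule integral_has_vector_derivative[OF mild_continuous])

lemma continuous_on_integral_0: "continuous_on {0..T} (v :: real \<Rightarrow> 'a) \<Longrightarrow> continuous_on {0..T} (\<lambda>t. integral {0..t} v)"
  by (auto intro!: indefinite_integral_continuous_1 integrable_continuous_interval)

lemma mild_in_closure: "mild_solution x F v \<Longrightarrow> t \<in> {0..T} \<Longrightarrow> v t \<in> closure D"
  using T_pos by (intro derivative_in_closure_subspace[OF mild_has_vector_derivative subspace_D]) (auto simp: mild_solution_def)

text \<open>Integration in time raises the degree of the forcing by one. The initial value is 0, so
  no term linear in time arises, and \<open>A\<close> passes under the integral because
  \<open>A (?V s) = v s - F s\<close> is continuous in \<open>s\<close>.\<close>

lemma mild_integrate:
  assumes v: "mild_solution 0 F v" and F: "continuous_on {0..T} F"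
  shows "mild_solution 0 (\<lambda>t. integral {0..t} F) (\<lambda>t. integral {0..t} v)"
  unfolding mild_solution_def
proof (intro conjI ballI)
  let ?V = "\<lambda>t. integral {0..t} v"
  have cv: "continuous_on {0..T} v" using v by (rule mild_continuous)
  show cV: "continuous_on {0..T} ?V" by (rule continuous_on_integral_0[OF cv])
  fix t assume t: "t \<in> {0..T}"
  then have sub: "{0..t} \<subseteq> {0..T}" by auto
  have A: "A (?V s) = v s - F s" if "s \<in> {0..t}" for s
    using v that t by (auto simp: mild_solution_def)
  have "continuous_on {0..t} (\<lambda>s. v s - F s)"
    using sub by (intro continuous_on_diff continuous_on_subset[OF cv] continuous_on_subset[OF F])
  then have "continuous_on {0..t} (\<lambda>s. A (?V s))"
    using A by (elim continuous_on_eq) auto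
  then have *: "integral {0..t} ?V \<in> D \<and> A (integral {0..t} ?V) = integral {0..t} (\<lambda>s. A (?V s))"
    using v t sub by (intro integral_in_D continuous_on_subset[OF cV]) (auto simp: mild_solution_def)
  have "integral {0..t} (\<lambda>s. A (?V s)) = integral {0..t} (\<lambda>s. v s - F s)"
    using A by (intro integral_cong) auto
  also have "\<dots> = ?V t - integral {0..t} F"
    using sub by (intro integral_diff integrable_continuous_interval continuous_on_subset[OF cv] continuous_on_subset[OF F])
  finally show "integral {0..t} ?V \<in> D" "?V t = 0 + A (integral {0..t} ?V) + integral {0..t} F"
    using * by auto
qed

text \<open>Formally the solution is the integral of \<open>S y\<close>, but \<open>y\<close> need
  not lie in the closure of \<open>D\<close>. With \<open>z = R l y\<close> one has
  \<open>y = l z - A z\<close>, and the formal integral becomes \<open>l I - (S z - z)\<close>, in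
  which only the semigroup at \<open>z\<close> occurs.\<close>

lemma mild_constant_forcing: "\<exists>v. mild_solution 0 (\<lambda>t. t *\<^sub>R y) v"
proof -
  define l where "l = w + 1"
  have l: "w < l" by (simp add: l_def)
  define z where "z = R l y"
  have zD: "z \<in> D" by (simp add: z_def R_in_D l)
  have zc: "z \<in> closure D" using zD closure_subset by blast
  define I where "I = (\<lambda>t. integral {0..t} (S z))"
  have cS: "continuous_on {0..T} (S z)" by (rule continuous_on_S[OF zc])
  have cI: "continuous_on {0..T} I" unfolding I_def by (rule continuous_on_integral_0[OF cS])
  have I: "I t \<in> D" "A (I t) = S z t - z" if "t \<in> {0..T}" for t
    using S_integral[OF zc that] by (auto simp: I_def)
  define v where "v = (\<lambda>t. l *\<^sub>R I t - S z t + z)"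
  have "mild_solution 0 (\<lambda>t. t *\<^sub>R y) v"
    unfolding mild_solution_def
  proof (intro conjI ballI)
    show "continuous_on {0..T} v"
      unfolding v_def by (intro continuous_intros cI cS)
    fix t assume t: "t \<in> {0..T}"
    then have sub: "{0..t} \<subseteq> {0..T}" by auto
    note int = integrable_continuous_interval[OF continuous_on_subset[OF cI sub]]
      integrable_continuous_interval[OF continuous_on_subset[OF cS sub]]
    have "continuous_on {0..t} (\<lambda>s. S z s - z)"
      using sub by (intro continuous_intros continuous_on_subset[OF cS])
    then have "continuous_on {0..t} (\<lambda>s. A (I s))"
      using I sub by (elim continuous_on_eq) auto
    then have 1: "integral {0..t} I \<in> D \<and> A (integral {0..t} I) = integral {0..t} (\<lambda>s. A (I s))"
      using I sub by (intro integral_in_D continuous_on_subset[OF cI]) auto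
    have "integral {0..t} (\<lambda>s. A (I s)) = integral {0..t} (\<lambda>s. S z s - z)"
      using I sub by (intro integral_cong) auto
    also have "\<dots> = I t - t *\<^sub>R z"
      using int t by (subst integral_diff) (auto simp: I_def)
    finally have AI: "A (integral {0..t} I) = I t - t *\<^sub>R z" using 1 by simp
    have intv: "integral {0..t} v = l *\<^sub>R integral {0..t} I - I t + t *\<^sub>R z"
      unfolding v_def using int t
      by (subst integral_add integral_diff; auto simp: I_def intro!: integrable_diff integrable_cmul)+
    show "integral {0..t} v \<in> D"
      unfolding intv using 1 I t zD
      by (intro subspace_add[OF subspace_D] subspace_diff[OF subspace_D] subspace_scale[OF subspace_D]) auto
    have "A (integral {0..t} v) = l *\<^sub>R (I t - t *\<^sub>R z) - (S z t - z) + t *\<^sub>R A z"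
      unfolding intv using 1 I t zD AI
      by (simp add: A_add A_diff A_scale subspace_add[OF subspace_D] subspace_diff[OF subspace_D] subspace_scale[OF subspace_D])
    also have "A z = l *\<^sub>R z - y"
      by (simp add: z_def A_R l)
    finally show "v t = 0 + A (integral {0..t} v) + t *\<^sub>R y"
      by (simp add: v_def algebra_simps)
  qed
  then show ?thesis by blast
qed

lemma integral_monomial:
  assumes "t \<ge> 0"
  shows "integral {0..t} (\<lambda>s. (s ^ k / fact k) *\<^sub>R (y :: 'a)) = (t ^ Suc k / fact (Suc k)) *\<^sub>R y"
proof (rule integral_unique)
  have "((\<lambda>s. (s ^ Suc k / fact (Suc k)) *\<^sub>R y) has_vector_derivative (s ^ k / fact k) *\<^sub>R y) (at s within {0..t})" for s
  proof -
    have "((\<lambda>s. s ^ Suc k / fact (Suc k)) has_real_derivative real (Suc k) * s ^ k / fact (Suc k)) (at s within {0..t})"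
      using DERIV_cdivide[OF DERIV_pow[of "Suc k" s "{0..t}"], of "fact (Suc k)"] by simp
    moreover have "real (Suc k) * s ^ k / fact (Suc k) = s ^ k / fact k"
      by (simp add: fact_Suc del: of_nat_Suc)
    ultimately have "((\<lambda>s. s ^ Suc k / fact (Suc k)) has_real_derivative s ^ k / fact k) (at s within {0..t})"
      by (simp only:)
    from has_vector_derivative_scaleR[OF this has_vector_derivative_const[of y]] show ?thesis by simp
  qed
  from fundamental_theorem_of_calculus[OF assms this]
  show "((\<lambda>s. (s ^ k / fact k) *\<^sub>R y) has_integral (t ^ Suc k / fact (Suc k)) *\<^sub>R y) {0..t}"
    by simp
qed

text \<open>The forcing enters through its primitive, so the power \<open>Suc k\<close> belongs to
  the forcing \<open>t ^ k / fact k\<close>. The factorials make the induction step a plain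
  integration.\<close>

lemma mild_monomial_forcing: "\<exists>v. mild_solution 0 (\<lambda>t. (t ^ Suc k / fact (Suc k)) *\<^sub>R y) v"
proof (induction k)
  case 0
  show ?case using mild_constant_forcing[of y] by simp
next
  case (Suc k)
  then obtain v where "mild_solution 0 (\<lambda>t. (t ^ Suc k / fact (Suc k)) *\<^sub>R y) v" by blast
  then have "mild_solution 0 (\<lambda>t. integral {0..t} (\<lambda>t. (t ^ Suc k / fact (Suc k)) *\<^sub>R y)) (\<lambda>t. integral {0..t} v)"
    by (rule mild_integrate) (intro continuous_intros, auto)
  then show ?case
    by (intro exI) (rule mild_cong, assumption, rule integral_monomial, simp)
qed

lemma mild_polynomial_forcing:
  fixes y :: "nat \<Rightarrow> 'a"
  shows "\<exists>v. mild_solution 0 (\<lambda>t. integral {0..t} (\<lambda>s. \<Sum>i<n. s ^ i *\<^sub>R y i)) v"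
proof -
  have "\<exists>v. mild_solution 0 (\<lambda>t. \<Sum>i<n. fact i *\<^sub>R ((t ^ Suc i / fact (Suc i)) *\<^sub>R y i)) v"
  proof (induction n)
    case 0
    have "mild_solution 0 (\<lambda>_. 0) (S 0)"
      using mild_homogeneous[of 0] subspace_0[OF subspace_D] closure_subset by blast
    then show ?case by auto
  next
    case (Suc n)
    then obtain v where v: "mild_solution 0 (\<lambda>t. \<Sum>i<n. fact i *\<^sub>R ((t ^ Suc i / fact (Suc i)) *\<^sub>R y i)) v" by blast
    obtain u where u: "mild_solution 0 (\<lambda>t. (t ^ Suc n / fact (Suc n)) *\<^sub>R y n) u"
      using mild_monomial_forcing by blast
    from mild_add[OF v mild_scale[OF u, of "fact n"]] show ?case by auto
  qed
  then obtain v where v: "mild_solution 0 (\<lambda>t. \<Sum>i<n. fact i *\<^sub>R ((t ^ Suc i / fact (Suc i)) *\<^sub>R y i)) v" by blast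
  have "mild_solution 0 (\<lambda>t. integral {0..t} (\<lambda>s. \<Sum>i<n. s ^ i *\<^sub>R y i)) v"
  proof (rule mild_cong[OF v])
    fix t assume "t \<in> {0..T}"
    then have t: "t \<ge> 0" by simp
    have "integral {0..t} (\<lambda>s. \<Sum>i<n. s ^ i *\<^sub>R y i) = (\<Sum>i<n. integral {0..t} (\<lambda>s. s ^ i *\<^sub>R y i))"
      by (intro integral_sum integrable_continuous_interval continuous_intros) auto
    also have "\<dots> = (\<Sum>i<n. fact i *\<^sub>R ((t ^ Suc i / fact (Suc i)) *\<^sub>R y i))"
    proof (intro sum.cong refl)
      fix i
      have "integral {0..t} (\<lambda>s. s ^ i *\<^sub>R y i) = integral {0..t} (\<lambda>s. fact i *\<^sub>R ((s ^ i / fact i) *\<^sub>R y i))"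
        by simp
      also have "\<dots> = fact i *\<^sub>R integral {0..t} (\<lambda>s. (s ^ i / fact i) *\<^sub>R y i)"
        by (rule integral_cmul)
      also have "\<dots> = fact i *\<^sub>R ((t ^ Suc i / fact (Suc i)) *\<^sub>R y i)"
        by (simp only: integral_monomial[OF t])
      finally show "integral {0..t} (\<lambda>s. s ^ i *\<^sub>R y i) = fact i *\<^sub>R ((t ^ Suc i / fact (Suc i)) *\<^sub>R y i)" .
    qed
    finally show "(\<Sum>i<n. fact i *\<^sub>R ((t ^ Suc i / fact (Suc i)) *\<^sub>R y i)) = integral {0..t} (\<lambda>s. \<Sum>i<n. s ^ i *\<^sub>R y i)" ..
  qed
  then show ?thesis by blast
qed

section \<open>Limits of integrated solutions, the a priori estimate and uniqueness\<close>

lemma mild_limit: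
  assumes mild_solution: "\<And>k. mild_solution (x k) (F k) (v k)" and x: "x \<longlonglongrightarrow> x'"
    and F: "\<And>t. t \<in> {0..T} \<Longrightarrow> (\<lambda>k. F k t) \<longlonglongrightarrow> F' t"
    and v: "uniform_limit {0..T} v v' sequentially"
  shows "mild_solution x' F' v'"
  unfolding mild_solution_def
proof (intro conjI ballI)
  show "continuous_on {0..T} v'"
    using mild_continuous[OF mild_solution] by (intro uniform_limit_theorem[OF _ v]) auto
  fix t assume t: "t \<in> {0..T}"
  then have sub: "{0..t} \<subseteq> {0..T}" by auto
  obtain I I' where I: "\<And>k. (v k has_integral I k) {0..t}" "(v' has_integral I') {0..t}" "I \<longlonglongrightarrow> I'"
    using uniform_limit_integral[OF uniform_limit_on_subset[OF v sub] continuous_on_subset[OF mild_continuous[OF mild_solution] sub]]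
    by (metis trivial_limit_sequentially)
  have int: "integral {0..t} (v k) = I k" "integral {0..t} v' = I'" for k
    using I by (auto simp: integral_unique)
  have "(\<lambda>k. v k t - x k - F k t) \<longlonglongrightarrow> v' t - x' - F' t"
    by (intro tendsto_diff x F t tendsto_uniform_limitI[OF v])
  moreover have "v k t - x k - F k t = A (I k)" for k
    using mild_solution[of k] t int by (auto simp: mild_solution_def)
  ultimately have "(\<lambda>k. A (I k)) \<longlonglongrightarrow> v' t - x' - F' t" by simp
  moreover have "I k \<in> D" for k
    using mild_solution[of k] t unfolding int(1)[symmetric] by (auto simp: mild_solution_def)
  ultimately have "I' \<in> D \<and> A I' = v' t - x' - F' t"
    using A_closed I(3) by blast
  then show "integral {0..t} v' \<in> D" "v' t = x' + A (integral {0..t} v') + F' t"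
    by (auto simp: int)
qed

text \<open>This is \<open>(A - B n) R(l)^2 = - R(n) (A R(l))^2\<close>, with all products written
  as bounded operators: the error of the Yosida approximation on the range of \<open>R(l)^2\<close>.
  The factor \<open>R(n)\<close> makes it decay like \<open>1 / n\<close>. By the resolvent identity
  both sides reduce to combinations of \<open>a\<close>, \<open>b\<close> and
  \<open>p\<close>.\<close>

lemma AR_R_diff:
  assumes "w < l" "w < n"
  shows "R l (AR l x) - B n (R l (R l x)) = - R n (AR l (AR l x))"
proof -
  note c = R_commute[OF assms]
  have "(l - n) *\<^sub>R R n (R l y) = R n y - R l y" for y
    using resolvent_identity[OF assms(2,1), of y] c by simp
  then have id: "R n y = R l y + (l - n) *\<^sub>R R n (R l y)" for y
    by (simp add: algebra_simps)
  define a where "a = R l x"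
  define b where "b = R l a"
  define p where "p = R n b"
  have 1: "R n a = b + (l - n) *\<^sub>R p" using id[of a] by (simp add: b_def p_def)
  have 2: "R n x = a + (l - n) *\<^sub>R R n a" using id[of x] by (simp add: a_def)
  have "R l (AR l x) = l *\<^sub>R b - a"
    by (simp add: AR_apply a_def b_def blinfun.diff_right blinfun.scaleR_right)
  moreover have "B n (R l (R l x)) = n\<^sup>2 *\<^sub>R p - n *\<^sub>R b"
    by (simp add: B_apply a_def b_def p_def)
  moreover have "R n (AR l (AR l x)) = l\<^sup>2 *\<^sub>R p - l *\<^sub>R R n a - l *\<^sub>R R n a + R n x"
  proof -
    have "AR l (AR l x) = l\<^sup>2 *\<^sub>R b - l *\<^sub>R a - l *\<^sub>R a + x"
      by (simp add: AR_apply a_def b_def blinfun.diff_right blinfun.scaleR_right power2_eq_square algebra_simps)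
    then show ?thesis
      by (simp add: p_def blinfun.diff_right blinfun.add_right blinfun.scaleR_right)
  qed
  ultimately show ?thesis
    unfolding 2 1 by (simp only:) (simp add: power2_eq_square algebra_simps)
qed

text \<open>
  Apply \<open>R(l)\<^sup>2\<close>: then \<open>R(l)\<^sup>2 v\<close> is differentiable and the error of the Yosida approximation is
  \<open>O(1/n)\<close> on it, so that differentiating \<open>E n (t - s) (R(l)\<^sup>2 v(s))\<close> in \<open>s\<close> gives the bound as
  \<open>n \<longrightarrow> \<infinity>\<close>.  The factors \<open>l R(l)\<close> are removed by \<open>l \<longrightarrow> \<infinity>\<close>.
\<close>

lemma mild_apriori:
  assumes v: "mild_solution x F v" and g: "continuous_on {0..T} g"
    and F: "\<And>t. t \<in> {0..T} \<Longrightarrow> F t = integral {0..t} g" and t: "t \<in> {0..T}"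
  shows "norm (v t) \<le> 4 * C\<^sup>2 * K * (norm x + integral {0..T} (\<lambda>s. norm (g s)))"
proof -
  define N where "N = norm x + integral {0..T} (\<lambda>s. norm (g s))"
  have cv: "continuous_on {0..T} v" by (rule mild_continuous[OF v])
  have cng: "continuous_on {0..T} (\<lambda>s. norm (g s))" using g by (intro continuous_intros)
  have sub: "{0..t} \<subseteq> {0..T}" using t by auto
  have g0: "integral {0..t} (\<lambda>s. norm (g s)) \<le> integral {0..T} (\<lambda>s. norm (g s))"
    using t by (intro integral_subset_le integrable_continuous_interval continuous_on_subset[OF cng]) auto
  obtain M where M: "\<And>s. s \<in> {0..T} \<Longrightarrow> norm (v s) \<le> M"
  proof -
    have "bounded (v ` {0..T})"
      by (intro compact_imp_bounded compact_continuous_image cv compact_Icc)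
    then show thesis unfolding bounded_iff by (metis that imageI)
  qed
  \<comment> \<open>The factor \<open>norm (R l o R l)\<close>, the norm of the composition, has to
    be kept: multiplied by \<open>l^2\<close> it becomes the norm of the composition of
    \<open>J l\<close> with itself, which stays bounded as \<open>l\<close> grows.\<close>
  have RR: "norm (R l (R l (v t))) \<le> K * (norm (R l o\<^sub>L R l) * N)" if l: "w < l" for l
  proof -
    define P where "P = R l o\<^sub>L R l"
    define y where "y = (\<lambda>s. P (v s))"
    define y' where "y' = (\<lambda>s. R l (AR l (v s)) + P (g s))"
    have y': "(y has_vector_derivative y' s) (at s within {0..t})" if s: "s \<in> {0..t}" for s
    proof -
      have sT: "s \<in> {0..T}" using s t by auto
      \<comment> \<open>The operator \<open>P\<close> applied to the integrated equation. Only
        bounded operators act on the integrals, so this expression can be differentiated although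
        \<open>v\<close> itself need not be differentiable.\<close>
      let ?z = "\<lambda>s. P x + R l (AR l (integral {0..s} v)) + P (integral {0..s} g)"
      have V': "((\<lambda>s. integral {0..s} v) has_vector_derivative v s) (at s within {0..t})"
        using mild_has_vector_derivative[OF v sT] has_vector_derivative_within_subset[OF _ sub] by blast
      have G': "((\<lambda>s. integral {0..s} g) has_vector_derivative g s) (at s within {0..t})"
        using integral_has_vector_derivative[OF g sT] has_vector_derivative_within_subset[OF _ sub] by blast
      have "(?z has_vector_derivative 0 + R l (AR l (v s)) + P (g s)) (at s within {0..t})"
        by (intro has_vector_derivative_add has_vector_derivative_const
            bounded_linear.has_vector_derivative[OF blinfun.bounded_linear_right] V' G')
      moreover have "y r = ?z r" if "r \<in> {0..t}" for r
      proof -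
        have r: "r \<in> {0..T}" using that t by auto
        have "v r = x + A (integral {0..r} v) + integral {0..r} g" "integral {0..r} v \<in> D"
          using v r F by (auto simp: mild_solution_def)
        then show ?thesis
          by (simp add: y_def P_def blinfun.add_right R_A'[OF l])
      qed
      ultimately show ?thesis
        using s unfolding y'_def by (auto intro: has_vector_derivative_transform)
    qed
    have bound: "norm (y t) \<le> K * (norm P * N) + T * (K * (C * (norm (AR l) * (norm (AR l) * M)))) / (real n - w)"
      if n: "real n \<ge> 2 * w + 1" for n
    proof -
      have nw: "w < real n" using n w_nonneg by simp
      \<comment> \<open>At \<open>s = t\<close> this is \<open>y t\<close>, at \<open>s = 0\<close>
        it is \<open>E n t (P x)\<close>; what remains in its derivative is the forcing and the
        Yosida error.\<close>
      define d where "d = (\<lambda>s. E n (t - s) (y s))"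
      define d' where "d' = (\<lambda>s. E n (t - s) (P (g s) - R n (AR l (AR l (v s)))))"
      have "(d has_vector_derivative d' s) (at s within {0..t})" if s: "s \<in> {0..t}" for s
      proof -
        have "(d has_vector_derivative E n (t - s) (y' s) + (- (B n o\<^sub>L E n (t - s))) (y s)) (at s within {0..t})"
          unfolding d_def
          by (rule bounded_bilinear.has_vector_derivative[OF bounded_bilinear_blinfun_apply
                E_reverse_has_vector_derivative y'[OF s]])
        moreover have "E n (t - s) (y' s) + (- (B n o\<^sub>L E n (t - s))) (y s)
            = E n (t - s) (P (g s) + (R l (AR l (v s)) - B n (R l (R l (v s)))))"
          by (simp add: y_def y'_def P_def blinfun.minus_left blinfun.diff_right blinfun.add_right E_commute_B nw)
        ultimately show ?thesis
          by (simp add: d'_def AR_R_diff[OF l nw])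
      qed
      then have d_int: "(d' has_integral (d t - d 0)) {0..t}"
        using t by (intro fundamental_theorem_of_calculus) auto
      define c where "c = C / (real n - w) * (norm (AR l) * (norm (AR l) * M))"
      have c0: "c \<ge> 0"
      proof -
        have "M \<ge> 0" using M[OF t] norm_ge_zero order_trans by blast
        then show ?thesis using nw C_ge_1 by (simp add: c_def)
      qed
      have d'_le: "norm (d' s) \<le> K * (norm P * norm (g s) + c)" if s: "s \<in> {0..t}" for s
      proof -
        have "norm (R n (AR l (AR l (v s)))) \<le> C / (real n - w) * norm (AR l (AR l (v s)))"
          using norm_blinfun[of "R n"] mult_right_mono[OF norm_R_le[OF nw]] by (meson norm_ge_zero order_trans)
        also have "norm (AR l (AR l (v s))) \<le> norm (AR l) * (norm (AR l) * M)"
          using s t M by (intro order_trans[OF norm_blinfun] mult_left_mono order_trans[OF norm_blinfun]) auto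
        finally have 1: "norm (R n (AR l (AR l (v s)))) \<le> c"
          using nw C_ge_1 by (simp add: c_def mult_left_mono divide_right_mono)
        have "norm (d' s) \<le> K * norm (P (g s) - R n (AR l (AR l (v s))))"
          unfolding d'_def using s t by (intro norm_E_apply_le n) auto
        also have "norm (P (g s) - R n (AR l (AR l (v s)))) \<le> norm P * norm (g s) + c"
          using norm_triangle_ineq4[of "P (g s)" "R n (AR l (AR l (v s)))"] norm_blinfun[of P "g s"] 1 by simp
        finally show ?thesis using K_ge_1 by (simp add: mult_left_mono)
      qed
      have "norm (d t - d 0) \<le> integral {0..t} (\<lambda>s. K * (norm P * norm (g s) + c))"
      proof -
        have "norm (integral {0..t} d') \<le> integral {0..t} (\<lambda>s. K * (norm P * norm (g s) + c))"
        proof (rule integral_norm_bound_integral)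
          show "(\<lambda>s. K * (norm P * norm (g s) + c)) integrable_on {0..t}"
            by (intro integrable_continuous_interval continuous_intros continuous_on_subset[OF g sub])
        qed (use d_int d'_le in auto)
        then show ?thesis using d_int by (simp add: integral_unique)
      qed
      also have "\<dots> = K * (norm P * integral {0..t} (\<lambda>s. norm (g s)) + t * c)"
      proof -
        have "(\<lambda>s. norm (g s)) integrable_on {0..t}"
          by (intro integrable_continuous_interval continuous_on_subset[OF cng sub])
        moreover have "((\<lambda>s::real. c) has_integral t * c) {0..t}"
          using has_integral_const_real[of c 0 t] t by simp
        ultimately have "((\<lambda>s. K * (norm P * norm (g s) + c)) has_integral K * (norm P * integral {0..t} (\<lambda>s. norm (g s)) + t * c)) {0..t}"
          by (intro has_integral_mult_right has_integral_add) (auto simp: has_integral_integral)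
        then show ?thesis by (rule integral_unique)
      qed
      also have "\<dots> \<le> K * (norm P * integral {0..T} (\<lambda>s. norm (g s)) + T * c)"
        using t c0 K_ge_1 g0 by (intro mult_left_mono add_mono mult_right_mono) auto
      finally have 1: "norm (d t - d 0) \<le> K * (norm P * integral {0..T} (\<lambda>s. norm (g s)) + T * c)" .
      have "v 0 = x"
        using v F[of 0] T_pos by (auto simp: mild_solution_def)
      then have "norm (d 0) \<le> K * (norm P * norm x)"
        unfolding d_def y_def using t n K_ge_1
        by (intro order_trans[OF norm_E_apply_le] mult_left_mono) (auto simp: norm_blinfun)
      moreover have "d t = y t" by (simp add: d_def)
      ultimately have "norm (y t) \<le> K * (norm P * integral {0..T} (\<lambda>s. norm (g s)) + T * c) + K * (norm P * norm x)"
        using 1 norm_triangle_sub[of "d t" "d 0"] by simp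
      also have "\<dots> = K * (norm P * N) + T * (K * (C * (norm (AR l) * (norm (AR l) * M)))) / (real n - w)"
        by (simp add: N_def c_def algebra_simps)
      finally show ?thesis .
    qed
    \<comment> \<open>The limit in \<open>n\<close> removes the only term that depends on the bound
      \<open>M\<close> of the unknown solution.\<close>
    have "(\<lambda>n. K * (norm P * N) + T * (K * (C * (norm (AR l) * (norm (AR l) * M)))) / (real n - w)) \<longlonglongrightarrow> K * (norm P * N) + 0"
      by (intro tendsto_add tendsto_const inverse_shift_tendsto)
    moreover have "\<exists>n0. \<forall>n\<ge>n0. norm (y t) \<le> K * (norm P * N) + T * (K * (C * (norm (AR l) * (norm (AR l) * M)))) / (real n - w)"
      using eventually_large[of "2 * w + 1"] bound unfolding eventually_sequentially by blast
    ultimately have "norm (y t) \<le> K * (norm P * N) + 0"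
      by (rule LIMSEQ_le_const)
    then show ?thesis by (simp add: y_def P_def)
  qed
  have N0: "N \<ge> 0"
    unfolding N_def by (intro add_nonneg_nonneg integral_nonneg integrable_continuous_interval cng) auto
  have "norm (J n (J n (v t))) \<le> 4 * C\<^sup>2 * K * N" if n: "real n \<ge> 2 * w + 1" for n
  proof -
    have nw: "w < real n" using n w_nonneg by simp
    have "norm (J n (J n (v t))) = real n ^ 2 * norm (R n (R n (v t)))"
      by (simp add: J_apply blinfun.scaleR_right power2_eq_square)
    also have "\<dots> \<le> real n ^ 2 * (K * (norm (R n o\<^sub>L R n) * N))"
      by (intro mult_left_mono RR nw) auto
    also have "\<dots> = K * N * norm (J n o\<^sub>L J n)"
    proof -
      have "J n o\<^sub>L J n = (real n)\<^sup>2 *\<^sub>R (R n o\<^sub>L R n)"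
        by (intro blinfun_eqI) (simp add: J_apply blinfun.scaleR_right blinfun.scaleR_left power2_eq_square)
      then show ?thesis by simp
    qed
    also have "\<dots> \<le> K * N * (2 * C * (2 * C))"
      using norm_J_le[OF n] N0 K_ge_1 C_ge_1
      by (intro mult_left_mono order_trans[OF norm_blinfun_compose] mult_mono) auto
    finally show ?thesis by (simp add: power2_eq_square algebra_simps)
  qed
  then have "\<exists>n0. \<forall>n\<ge>n0. norm (J (real n) (J (real n) (v t))) \<le> 4 * C\<^sup>2 * K * N"
    using eventually_large[of "2 * w + 1"] unfolding eventually_sequentially by blast
  then show ?thesis
    using LIMSEQ_le_const2[OF tendsto_norm[OF J_J_tendsto[OF mild_in_closure[OF v t]]]] by (simp add: N_def)
qed

lemma mild_unique:
  assumes "mild_solution x F v" "mild_solution x F u" "t \<in> {0..T}"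
  shows "v t = u t"
proof -
  have "mild_solution 0 (\<lambda>_. 0) (\<lambda>t. v t - u t)"
    using mild_diff[OF assms(1,2)] by simp
  from mild_apriori[OF this, of "\<lambda>_. 0", OF _ _ assms(3)] show ?thesis by simp
qed

end

section \<open>Integrable forcing, and the link with strict solutions\<close>

context hy_operator
begin

text \<open>Two factors \<open>J\<close>, each bounded by \<open>2 * C\<close>, together with the
  bound \<open>K\<close> of the exponentials.\<close>

definition K2 :: real where "K2 = 4 * C\<^sup>2 * K"

lemma K2_pos: "K2 > 0"
  using K_ge_1 C_ge_1 by (simp add: K2_def)

lemma mild_apriori_nn:
  assumes v: "mild_solution x F v" and g: "continuous_on {0..T} g"
    and F: "\<And>t. t \<in> {0..T} \<Longrightarrow> F t = integral {0..t} g" and t: "t \<in> {0..T}"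
  shows "ennreal (norm (v t)) \<le> ennreal K2 * (ennreal (norm x) + (\<integral>\<^sup>+s. norm (g s) \<partial>MT))"
proof -
  have "(\<integral>\<^sup>+s. norm (g s) \<partial>MT) = ennreal (integral {0..T} (\<lambda>s. norm (g s)))"
    using g by (intro nn_integral_MT_continuous continuous_on_norm) auto
  moreover have "integral {0..T} (\<lambda>s. norm (g s)) \<ge> 0"
    by (intro integral_nonneg integrable_continuous_interval continuous_on_norm g) auto
  ultimately have "ennreal K2 * (ennreal (norm x) + (\<integral>\<^sup>+s. norm (g s) \<partial>MT)) = ennreal (K2 * (norm x + integral {0..T} (\<lambda>s. norm (g s))))"
    using K2_pos by (simp flip: ennreal_plus ennreal_mult)
  then show ?thesis
    using mild_apriori[OF v g F t] by (simp add: K2_def ennreal_leI)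
qed

lemma mild_vpoly_exists:
  assumes x: "x \<in> closure D" and P: "vpoly P"
  shows "\<exists>v. mild_solution x (\<lambda>t. integral {0..t} P) v"
proof -
  obtain n y where P: "P = (\<lambda>s. \<Sum>i<n. s ^ i *\<^sub>R y i)" using P by (auto simp: vpoly_def)
  obtain u where "mild_solution 0 (\<lambda>t. integral {0..t} P) u"
    using mild_polynomial_forcing[of y n] P by blast
  from mild_add[OF mild_homogeneous[OF x] this] show ?thesis by auto
qed

text \<open>The a priori estimate, applied to differences of solutions with polynomial forcing,
  gives uniform convergence. Existence and bound are proved together because the estimate so far
  covers continuous forcing; the solution constructed as a limit inherits it.\<close>

lemma mild_L1_exists_bound:
  assumes x: "x \<in> closure D" and f: "L1 f"
  shows "\<exists>v. mild_solution x (primitive f) v \<and> (\<forall>t\<in>{0..T}. ennreal (norm (v t)) \<le> ennreal K2 * (ennreal (norm x) + (\<integral>\<^sup>+s. norm (f s) \<partial>MT)))"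
proof -
  obtain P where P: "\<forall>k. vpoly (P k)" "(\<lambda>k. \<integral>\<^sup>+t. ennreal (norm (f t - P k t)) \<partial>MT) \<longlonglongrightarrow> 0"
    by (rule L1_approx_sequence[OF f])
  define d where "d = (\<lambda>k. \<integral>\<^sup>+t. ennreal (norm (f t - P k t)) \<partial>MT)"
  have d: "d \<longlonglongrightarrow> 0" using P(2) by (simp add: d_def)
  have cP: "continuous_on {0..T} (P k)" for k using P(1) by (intro vpoly_continuous) auto
  have sf: "smeas f" and sP: "smeas (P k)" for k
    using f P(1) by (auto intro: L1_smeas smeas_vpoly)
  have "\<forall>k. \<exists>v. mild_solution x (\<lambda>t. integral {0..t} (P k)) v"
    using mild_vpoly_exists[OF x] P(1) by blast
  then obtain v where v: "\<And>k. mild_solution x (\<lambda>t. integral {0..t} (P k)) (v k)" by metis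
  have diff: "ennreal (norm (v k t - v l t)) \<le> ennreal K2 * (d k + d l)" if t: "t \<in> {0..T}" for k l t
  proof -
    have "mild_solution 0 (\<lambda>t. integral {0..t} (P k) - integral {0..t} (P l)) (\<lambda>t. v k t - v l t)"
      using mild_diff[OF v v, of k l] by simp
    then have "ennreal (norm (v k t - v l t)) \<le> ennreal K2 * (ennreal (norm (0::'a)) + (\<integral>\<^sup>+s. norm (P k s - P l s) \<partial>MT))"
    proof (rule mild_apriori_nn)
      show "continuous_on {0..T} (\<lambda>s. P k s - P l s)" by (intro continuous_on_diff cP)
      fix t assume "t \<in> {0..T}"
      then have sub: "{0..t} \<subseteq> {0..T}" by auto
      show "integral {0..t} (P k) - integral {0..t} (P l) = integral {0..t} (\<lambda>s. P k s - P l s)"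
        by (intro integral_diff[symmetric] integrable_continuous_interval continuous_on_subset[OF cP sub])
    qed fact
    also have "\<dots> \<le> ennreal K2 * (d k + d l)"
    proof -
      have "(\<integral>\<^sup>+s. norm (P k s - P l s) \<partial>MT) \<le> d k + d l"
        unfolding d_def
      proof (intro nn_integral_norm_triangle smeas_diff sf sP)
        show "norm (P k s - P l s) \<le> norm (f s - P k s) + norm (f s - P l s)" for s
          using norm_triangle_ineq4[of "f s - P l s" "f s - P k s"] by simp
      qed
      then show ?thesis by (intro mult_left_mono) auto
    qed
    finally show ?thesis .
  qed
  have "uniformly_Cauchy_on {0..T} v"
    unfolding uniformly_Cauchy_on_def
  proof (intro allI impI)
    fix e :: real assume e: "e > 0"
    define e' where "e' = e / (2 * K2)"
    have e': "e' > 0" using e K2_pos by (simp add: e'_def)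
    have "\<forall>\<^sub>F k in sequentially. d k < ennreal e'"
      using e' by (intro order_tendstoD(2)[OF d]) auto
    then obtain M where M: "\<And>k. k \<ge> M \<Longrightarrow> d k < ennreal e'" unfolding eventually_sequentially by blast
    show "\<exists>M. \<forall>t\<in>{0..T}. \<forall>m\<ge>M. \<forall>n\<ge>M. dist (v m t) (v n t) < e"
    proof (intro exI[of _ M] ballI allI impI)
      fix t m n assume t: "t \<in> {0..T}" "m \<ge> M" "n \<ge> M"
      have "ennreal (norm (v m t - v n t)) \<le> ennreal K2 * (d m + d n)" by (rule diff[OF t(1)])
      also have "\<dots> < ennreal K2 * (ennreal e' + ennreal e')"
      proof (rule ennreal_mult_strict_left_mono)
        show "d m + d n < ennreal e' + ennreal e'" using M t by (intro add_strict_mono) auto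
      qed (use K2_pos in auto)
      also have "\<dots> = ennreal e"
        using e' K2_pos by (simp add: e'_def flip: ennreal_plus ennreal_mult)
      finally show "dist (v m t) (v n t) < e" using e by (simp add: dist_norm ennreal_less_iff)
    qed
  qed
  then obtain v' where v': "uniform_limit {0..T} v v' sequentially"
    using Cauchy_uniformly_convergent uniformly_convergent_on_def by metis
  have "mild_solution x (primitive f) v'"
  proof (rule mild_limit[OF v tendsto_const _ v'])
    fix t assume t: "t \<in> {0..T}"
    have "(\<lambda>k. primitive (P k) t - primitive f t) \<longlonglongrightarrow> 0"
    proof (rule tendsto_norm_zero_cancel)
      have "(\<lambda>k. ennreal (norm (primitive (P k) t - primitive f t))) \<longlonglongrightarrow> 0"
      proof (rule tendsto_sandwich[OF _ _ tendsto_const d])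
        show "\<forall>\<^sub>F k in sequentially. ennreal (norm (primitive (P k) t - primitive f t)) \<le> d k"
          using primitive_diff_le[OF f L1_continuous[OF cP] t] by (simp add: d_def norm_minus_commute)
      qed simp
      then show "(\<lambda>k. norm (primitive (P k) t - primitive f t)) \<longlonglongrightarrow> 0"
        using tendsto_ennreal_iff[of "\<lambda>k. norm (primitive (P k) t - primitive f t)" sequentially 0] by simp
    qed
    then have "(\<lambda>k. primitive (P k) t) \<longlonglongrightarrow> primitive f t" by (simp add: LIM_zero_iff)
    then show "(\<lambda>k. integral {0..t} (P k)) \<longlonglongrightarrow> primitive f t"
      by (simp only: primitive_vpoly[OF P(1)[rule_format] t])
  qed
  moreover have "ennreal (norm (v' t)) \<le> ennreal K2 * (ennreal (norm x) + (\<integral>\<^sup>+s. norm (f s) \<partial>MT))" if t: "t \<in> {0..T}" for t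
  proof -
    have lim: "(\<lambda>k. ennreal (norm (v k t))) \<longlonglongrightarrow> ennreal (norm (v' t))"
      by (intro tendsto_ennrealI tendsto_norm tendsto_uniform_limitI[OF v' t])
    have lim': "(\<lambda>k. ennreal K2 * (ennreal (norm x) + ((\<integral>\<^sup>+s. norm (f s) \<partial>MT) + d k))) \<longlonglongrightarrow>
        ennreal K2 * (ennreal (norm x) + ((\<integral>\<^sup>+s. norm (f s) \<partial>MT) + 0))"
      by (intro ennreal_tendsto_cmult tendsto_add tendsto_const d) auto
    have "ennreal (norm (v k t)) \<le> ennreal K2 * (ennreal (norm x) + ((\<integral>\<^sup>+s. norm (f s) \<partial>MT) + d k))" for k
    proof -
      have "ennreal (norm (v k t)) \<le> ennreal K2 * (ennreal (norm x) + (\<integral>\<^sup>+s. norm (P k s) \<partial>MT))"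
        by (rule mild_apriori_nn[OF v cP refl t])
      also have "(\<integral>\<^sup>+s. norm (P k s) \<partial>MT) \<le> (\<integral>\<^sup>+s. norm (f s) \<partial>MT) + d k"
        unfolding d_def
      proof (intro nn_integral_norm_triangle smeas_diff sf sP)
        show "norm (P k s) \<le> norm (f s) + norm (f s - P k s)" for s
          using norm_triangle_ineq4[of "f s" "f s - P k s"] by simp
      qed
      finally show ?thesis by (simp add: add_left_mono mult_left_mono)
    qed
    then have "ennreal (norm (v' t)) \<le> ennreal K2 * (ennreal (norm x) + ((\<integral>\<^sup>+s. norm (f s) \<partial>MT) + 0))"
      by (intro LIMSEQ_le[OF lim lim']) blast
    then show ?thesis by simp
  qed
  ultimately show ?thesis by blast
qed

lemma mild_at_0: "mild_solution x (primitive f) v \<Longrightarrow> L1 f \<Longrightarrow> v 0 = x"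
  using T_pos by (auto simp: mild_solution_def)

text \<open>The value at time 0 shows that \<open>x\<close> lies in the closure of \<open>D\<close>.
  Hence a solution with the bound exists, and uniqueness identifies it with
  \<open>v\<close>.\<close>

lemma mild_L1_bound:
  assumes v: "mild_solution x (primitive f) v" and f: "L1 f" and t: "t \<in> {0..T}"
  shows "ennreal (norm (v t)) \<le> ennreal K2 * (ennreal (norm x) + (\<integral>\<^sup>+s. norm (f s) \<partial>MT))"
proof -
  have "x \<in> closure D"
    using mild_in_closure[OF v, of 0] mild_at_0[OF v f] T_pos by simp
  then obtain u where u: "mild_solution x (primitive f) u" "\<forall>t\<in>{0..T}. ennreal (norm (u t)) \<le> ennreal K2 * (ennreal (norm x) + (\<integral>\<^sup>+s. norm (f s) \<partial>MT))"
    using mild_L1_exists_bound[OF _ f] by blast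
  with mild_unique[OF v u(1) t] t show ?thesis by simp
qed

lemma mild_L1_diff:
  assumes "mild_solution x (primitive f) v" "mild_solution y (primitive g) u" "L1 f" "L1 g"
  shows "mild_solution (x - y) (primitive (\<lambda>s. f s - g s)) (\<lambda>t. v t - u t)"
  by (rule mild_cong[OF mild_diff[OF assms(1,2)]]) (simp only: primitive_diff assms)

text \<open>
  The identity \<open>u = R(l)(l u - G + f)\<close> replaces an appeal to closedness under the Bochner integral.
\<close>

lemma strong_solution_mild:
  assumes u: "continuous_on {0..T} u" "\<And>t. t \<in> {0..T} \<Longrightarrow> u t = x + primitive G t"
    and L: "L1 G" "L1 f" and D: "AE t in MT. u t \<in> D" and eq: "AE t in MT. G t = A (u t) + f t"
  shows "mild_solution x (primitive f) u"
  unfolding mild_solution_def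
proof (intro conjI ballI u)
  fix t assume t: "t \<in> {0..T}"
  define l where "l = w + 1"
  have l: "w < l" by (simp add: l_def)
  have Lu: "L1 u" by (rule L1_continuous[OF u(1)])
  have Lh: "L1 (\<lambda>s. l *\<^sub>R u s - G s + f s)"
    by (intro L1_add L1_diff L1_scaleR L Lu)
  have "AE s in MT. u s = R l (l *\<^sub>R u s - G s + f s)"
    using D eq by eventually_elim (simp add: algebra_simps R_eq_shift[OF l, symmetric])
  then have "primitive u t = primitive (\<lambda>s. R l (l *\<^sub>R u s - G s + f s)) t"
    by (rule primitive_cong_AE[OF Lu _ t])
  also have "\<dots> = R l (primitive (\<lambda>s. l *\<^sub>R u s - G s + f s) t)"
    by (rule primitive_linear[OF blinfun.bounded_linear_right Lh t])
  also have "primitive (\<lambda>s. l *\<^sub>R u s - G s + f s) t = l *\<^sub>R primitive u t - primitive G t + primitive f t"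
    using primitive_linear[OF bounded_linear_scaleR_right Lu t, of l]
      primitive_add[OF L1_diff[OF L1_scaleR[OF Lu] L(1)] L(2) t, of l] primitive_diff[OF L1_scaleR[OF Lu] L(1) t, of l]
    by (simp only:)
  finally have I: "primitive u t = R l (l *\<^sub>R primitive u t - primitive G t + primitive f t)" .
  then have "A (primitive u t) = l *\<^sub>R primitive u t - (l *\<^sub>R primitive u t - primitive G t + primitive f t)"
    using A_R[OF l, of "l *\<^sub>R primitive u t - primitive G t + primitive f t"] by simp
  moreover have "primitive u t \<in> D" using I R_in_D[OF l] by metis
  ultimately show "integral {0..t} u \<in> D" "u t = x + A (integral {0..t} u) + primitive f t"
    using u(2)[OF t] by (auto simp: primitive_continuous_eq_integral[OF u(1) t, symmetric])
qed

lemma mild_strong_solution: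
  assumes v: "mild_solution (A x + f0) (primitive g) v" and x: "x \<in> D" and t: "t \<in> {0..T}"
  shows "x + primitive v t \<in> D" "A (x + primitive v t) = v t - (f0 + primitive g t)"
proof -
  have *: "integral {0..t} v \<in> D" "v t = (A x + f0) + A (integral {0..t} v) + primitive g t"
    using v t by (auto simp: mild_solution_def)
  have I: "primitive v t = integral {0..t} v"
    by (rule primitive_continuous_eq_integral[OF mild_continuous[OF v] t])
  show "x + primitive v t \<in> D" unfolding I by (rule subspace_add[OF subspace_D x *(1)])
  show "A (x + primitive v t) = v t - (f0 + primitive g t)"
    unfolding I A_add[OF x *(1)] using *(2) by simp
qed

end

section \<open>Sobolev functions in time, and the comparison of \<open>L1\<close> with
  \<open>Lp\<close>\<close>

context time_interval
begin

text \<open>The primitives of approximating polynomials converge uniformly, since the difference of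
  two primitives is bounded by the \<open>L1\<close> distance at every time.\<close>

lemma continuous_on_primitive:
  fixes F :: "real \<Rightarrow> 'a::banach"
  assumes F: "L1 F"
  shows "continuous_on {0..T} (primitive F)"
proof -
  obtain P where P: "\<forall>k. vpoly (P k)" "(\<lambda>k. \<integral>\<^sup>+t. ennreal (norm (F t - P k t)) \<partial>MT) \<longlonglongrightarrow> 0"
    by (rule L1_approx_sequence[OF F])
  have cP: "continuous_on {0..T} (P k)" for k using P(1) by (intro vpoly_continuous) auto
  have "uniform_limit {0..T} (\<lambda>k. primitive (P k)) (primitive F) sequentially"
  proof (rule uniform_limitI)
    fix e :: real assume e: "e > 0"
    have "\<forall>\<^sub>F k in sequentially. (\<integral>\<^sup>+t. ennreal (norm (F t - P k t)) \<partial>MT) < ennreal e"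
      using e by (intro order_tendstoD(2)[OF P(2)]) auto
    then show "\<forall>\<^sub>F k in sequentially. \<forall>t\<in>{0..T}. dist (primitive (P k) t) (primitive F t) < e"
    proof eventually_elim
      case (elim k)
      show ?case
      proof
        fix t assume t: "t \<in> {0..T}"
        have "ennreal (norm (primitive F t - primitive (P k) t)) < ennreal e"
          using primitive_diff_le[OF F L1_continuous[OF cP] t] elim by (rule le_less_trans)
        then show "dist (primitive (P k) t) (primitive F t) < e"
          using e by (simp add: dist_norm norm_minus_commute ennreal_less_iff)
      qed
    qed
  qed
  moreover have "continuous_on {0..T} (primitive (P k))" for k
  proof -
    have "continuous_on {0..T} (\<lambda>t. integral {0..t} (P k))"
      by (auto intro!: indefinite_integral_continuous_1 integrable_continuous_interval cP)
    then show ?thesis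
      by (rule continuous_on_eq) (use P(1) in \<open>simp add: primitive_vpoly\<close>)
  qed
  ultimately show ?thesis
    by (intro uniform_limit_theorem[of _ "\<lambda>k. primitive (P k)"]) auto
qed

lemma Lp_space_iff: "F \<in> Lp_space T p UNIV norm \<longleftrightarrow> smeas F \<and> (\<integral>\<^sup>+t. ennreal (norm (F t) powr p) \<partial>MT) < \<infinity>"
  by (simp add: Lp_space_def Lp_norm_pow_def)

text \<open>Where \<open>norm (F t)\<close> exceeds \<open>c\<close>, it is at most
  \<open>c powr (1 - p)\<close> times its \<open>p\<close>-th power. The threshold is left free so
  that it can be optimised.\<close>

lemma nn_integral_norm_le_powr:
  assumes F: "smeas F" and p: "p \<ge> 1" and c: "c > 0"
  shows "(\<integral>\<^sup>+t. ennreal (norm (F t)) \<partial>MT) \<le> ennreal (c * T) + ennreal (c powr (1 - p)) * Lp_norm_pow T p norm F"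
proof -
  have "(\<integral>\<^sup>+t. ennreal (norm (F t)) \<partial>MT) \<le> (\<integral>\<^sup>+t. ennreal c + ennreal (c powr (1 - p)) * ennreal (norm (F t) powr p) \<partial>MT)"
  proof (rule nn_integral_mono)
    fix t
    have "norm (F t) \<le> c + c powr (1 - p) * norm (F t) powr p"
    proof (cases "norm (F t) \<le> c")
      case False
      then have "norm (F t) > 0" using c by linarith
      then have "norm (F t) = norm (F t) powr (1 - p) * norm (F t) powr p"
        by (simp flip: powr_add)
      also have "\<dots> \<le> c powr (1 - p) * norm (F t) powr p"
        using False c p by (intro mult_right_mono powr_mono2') auto
      finally show ?thesis using c by simp
    qed (simp add: add_increasing2)
    then have "ennreal (norm (F t)) \<le> ennreal (c + c powr (1 - p) * norm (F t) powr p)" by (rule ennreal_leI)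
    then show "ennreal (norm (F t)) \<le> ennreal c + ennreal (c powr (1 - p)) * ennreal (norm (F t) powr p)"
      using c by (simp add: ennreal_mult)
  qed
  also have "\<dots> = (\<integral>\<^sup>+t. ennreal c \<partial>MT) + (\<integral>\<^sup>+t. ennreal (c powr (1 - p)) * ennreal (norm (F t) powr p) \<partial>MT)"
    using smeas_ennreal_norm_powr[OF F] by (intro nn_integral_add) auto
  also have "(\<integral>\<^sup>+t. ennreal (c powr (1 - p)) * ennreal (norm (F t) powr p) \<partial>MT) = ennreal (c powr (1 - p)) * Lp_norm_pow T p norm F"
    unfolding Lp_norm_pow_def by (rule nn_integral_cmult[OF smeas_ennreal_norm_powr[OF F]])
  also have "(\<integral>\<^sup>+t. ennreal c \<partial>MT) = ennreal (c * T)"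
    using c T_pos emeasure_MT by (simp add: ennreal_mult)
  finally show ?thesis .
qed

lemma Lp_L1:
  assumes "F \<in> Lp_space T p UNIV norm" "p \<ge> 1"
  shows "L1 F"
  using nn_integral_norm_le_powr[of F p 1] assms
  by (auto simp: Lp_space_iff L1_def Lp_norm_pow_def elim!: le_less_trans)

text \<open>The threshold \<open>X powr (1 / p)\<close> balances the two terms of the preceding
  estimate and gives Hoelder's inequality on an interval of length \<open>T\<close> with the
  constant \<open>T + 1\<close>. For \<open>X = 0\<close> arbitrarily small thresholds are used
  instead.\<close>

lemma L1_norm_powr_le:
  assumes F: "F \<in> Lp_space T p UNIV norm" and p: "p \<ge> 1"
  shows "ennreal (enn2real (\<integral>\<^sup>+t. ennreal (norm (F t)) \<partial>MT) powr p) \<le> ennreal ((T + 1) powr p) * Lp_norm_pow T p norm F"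
proof -
  define X where "X = enn2real (Lp_norm_pow T p norm F)"
  define Y where "Y = enn2real (\<integral>\<^sup>+t. ennreal (norm (F t)) \<partial>MT)"
  have X: "Lp_norm_pow T p norm F = ennreal X" "X \<ge> 0"
    using F by (auto simp: X_def Lp_space_def less_top)
  have Y: "(\<integral>\<^sup>+t. ennreal (norm (F t)) \<partial>MT) = ennreal Y" "Y \<ge> 0"
    using Lp_L1[OF F p] by (auto simp: Y_def L1_def less_top)
  have le: "Y \<le> c * T + c powr (1 - p) * X" if c: "c > 0" for c
  proof -
    have "ennreal Y \<le> ennreal (c * T) + ennreal (c powr (1 - p)) * ennreal X"
      using nn_integral_norm_le_powr[of F p c] F c p unfolding X Y by (simp add: Lp_space_def)
    also have "\<dots> = ennreal (c * T + c powr (1 - p) * X)"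
      using c T_pos X(2) by (simp flip: ennreal_plus ennreal_mult)
    finally show ?thesis
      using c T_pos X(2) by (subst (asm) ennreal_le_iff) auto
  qed
  have "Y powr p \<le> (T + 1) powr p * X"
  proof (cases "X = 0")
    case True
    have "Y \<le> 0 + e" if e: "e > 0" for e
      using le[of "e / T"] e T_pos True by simp
    then have "Y \<le> 0" by (rule field_le_epsilon)
    then show ?thesis using Y(2) True p by simp
  next
    case False
    then have X0: "X > 0" using X(2) by simp
    have "Y \<le> X powr (1 / p) * T + (X powr (1 / p)) powr (1 - p) * X"
      using X0 by (intro le) auto
    also have "(X powr (1 / p)) powr (1 - p) * X = X powr (1 / p)"
    proof -
      have "(X powr (1 / p)) powr (1 - p) * X = X powr (1 / p * (1 - p) + 1)"
        using X0 by (simp add: powr_powr powr_add)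
      also have "1 / p * (1 - p) + 1 = 1 / p" using p by (simp add: field_simps)
      finally show ?thesis .
    qed
    finally have "Y \<le> (T + 1) * X powr (1 / p)" by (simp add: algebra_simps)
    then have "Y powr p \<le> ((T + 1) * X powr (1 / p)) powr p"
      using Y(2) p by (intro powr_mono2) auto
    also have "\<dots> = (T + 1) powr p * X"
      using T_pos X0 p by (simp add: powr_mult powr_powr)
    finally show ?thesis .
  qed
  then show ?thesis
    using X(2) unfolding Y_def[symmetric] X(1) by (simp add: ennreal_leI flip: ennreal_mult)
qed

lemma is_sobolev_deriv_primitive:
  "is_sobolev_deriv T p F G \<longleftrightarrow> G \<in> Lp_space T p UNIV norm \<and> (\<exists>F0. \<forall>t\<in>{0..T}. F t = F0 + primitive G t)"
  by (simp add: is_sobolev_deriv_def primitive_def)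

lemma is_sobolev_deriv_at_0:
  fixes F :: "real \<Rightarrow> 'a::banach"
  assumes F: "is_sobolev_deriv T p F G" and p: "p \<ge> 1" and t: "t \<in> {0..T}"
  shows "F t = F 0 + primitive G t"
proof -
  have "G \<in> Lp_space T p UNIV norm" using F by (simp add: is_sobolev_deriv_primitive)
  then have G: "L1 G" by (rule Lp_L1[OF _ p])
  obtain F0 where F0: "\<forall>t\<in>{0..T}. F t = F0 + primitive G t"
    using F unfolding is_sobolev_deriv_primitive by blast
  have "F 0 = F0" using F0[rule_format, of 0] T_pos G by simp
  then show ?thesis using F0 t by blast
qed

lemma is_sobolev_deriv_continuous:
  fixes F :: "real \<Rightarrow> 'a::banach"
  assumes F: "is_sobolev_deriv T p F G" and p: "p \<ge> 1"
  shows "continuous_on {0..T} F"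
proof (rule continuous_on_eq)
  show "continuous_on {0..T} (\<lambda>t. F 0 + primitive G t)"
    using F p by (intro continuous_intros continuous_on_primitive) (auto simp: is_sobolev_deriv_primitive Lp_L1)
qed (rule is_sobolev_deriv_at_0[OF F p, symmetric])

lemma is_sobolev_deriv_unique:
  fixes F :: "real \<Rightarrow> 'a::banach"
  assumes G: "is_sobolev_deriv T p F G" and H: "is_sobolev_deriv T p F H" and p: "p \<ge> 1"
  shows "AE t in MT. G t = H t"
proof -
  have L: "L1 G" "L1 H" using assms by (auto simp: is_sobolev_deriv_primitive Lp_L1)
  have "AE t in MT. G t - H t = 0"
  proof (rule AE_zero_if_primitive_zero[OF L1_diff[OF L]])
    fix t assume t: "t \<in> {0..T}"
    have "primitive G t = primitive H t"
      using is_sobolev_deriv_at_0[OF G p t] is_sobolev_deriv_at_0[OF H p t] by simp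
    then show "primitive (\<lambda>s. G s - H s) t = 0" by (simp add: primitive_diff L t del: atLeastAtMost_iff)
  qed
  then show ?thesis by simp
qed

lemma sobolev_deriv:
  "F \<in> W1p_space T p \<Longrightarrow> is_sobolev_deriv T p F (sobolev_deriv T p F)"
  unfolding W1p_space_def sobolev_deriv_def mem_Collect_eq by (rule someI_ex[of "is_sobolev_deriv T p F"])

text \<open>\<open>sobolev_deriv\<close> is an arbitrary choice; this replaces it, up to a null set,
  by a derivative that is known explicitly.\<close>

lemma sobolev_deriv_AE:
  fixes F :: "real \<Rightarrow> 'a::banach"
  assumes "is_sobolev_deriv T p F G" "p \<ge> 1"
  shows "AE t in MT. sobolev_deriv T p F t = G t"
  by (rule is_sobolev_deriv_unique[OF sobolev_deriv assms]) (use assms in \<open>auto simp: W1p_space_def\<close>)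

lemma Lp_norm_pow_bounded:
  assumes F: "\<And>t. t \<in> {0..T} \<Longrightarrow> 0 \<le> N (F t) \<and> N (F t) \<le> M" and p: "p \<ge> 0"
  shows "Lp_norm_pow T p N F \<le> ennreal (T * M powr p)"
proof -
  have "Lp_norm_pow T p N F \<le> (\<integral>\<^sup>+t. ennreal (M powr p) \<partial>MT)"
    unfolding Lp_norm_pow_def using p F by (intro nn_integral_mono ennreal_leI powr_mono2) auto
  also have "\<dots> = ennreal (T * M powr p)"
    using T_pos emeasure_MT by (simp add: ennreal_mult mult.commute)
  finally show ?thesis .
qed

lemma Lp_continuous:
  fixes F :: "real \<Rightarrow> 'a::real_normed_vector"
  assumes F: "continuous_on {0..T} F" and p: "p \<ge> 0"
  shows "F \<in> Lp_space T p UNIV norm"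
proof -
  have "bounded (F ` {0..T})"
    by (intro compact_imp_bounded compact_continuous_image F compact_Icc)
  then obtain M where M: "\<And>t. t \<in> {0..T} \<Longrightarrow> norm (F t) \<le> M"
    unfolding bounded_iff by (metis imageI)
  have "Lp_norm_pow T p norm F < \<infinity>"
    by (rule le_less_trans[OF Lp_norm_pow_bounded[of norm F M]]) (use M p in auto)
  then show ?thesis using smeas_continuous[OF F] by (simp add: Lp_space_def)
qed

end

section \<open>Sequences of solutions\<close>

locale weights =
  fixes p s h :: real
  assumes p_ge_1: "p \<ge> 1" and h_pos: "h > 0"
begin

lemma p_nonneg: "p \<ge> 0" using p_ge_1 by simp

abbreviation W :: "nat \<Rightarrow> real" where "W \<equiv> weight p s h"

lemma weight_pos: "W \<alpha> > 0"
  using h_pos by (simp add: weight_def)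

text \<open>With values in \<open>ennreal\<close> the sums always exist, so they can be compared and
  split before finiteness is known.\<close>

definition wsum :: "(nat \<Rightarrow> ennreal) \<Rightarrow> ennreal" where
  "wsum X = (\<Sum>\<alpha>. ennreal (W \<alpha>) * X \<alpha>)"

lemma wsum_mono: "(\<And>\<alpha>. X \<alpha> \<le> Y \<alpha>) \<Longrightarrow> wsum X \<le> wsum Y"
  unfolding wsum_def by (intro suminf_le mult_left_mono summableI) auto

lemma wsum_add: "wsum (\<lambda>\<alpha>. X \<alpha> + Y \<alpha>) = wsum X + wsum Y"
  unfolding wsum_def by (simp add: distrib_left suminf_add[symmetric])

lemma wsum_cmult: "wsum (\<lambda>\<alpha>. c * X \<alpha>) = c * wsum X"
  unfolding wsum_def by (simp add: mult.left_commute[of _ c])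

lemma wsum_le_cmult:
  assumes "\<And>\<alpha>. X \<alpha> \<le> c * Y \<alpha>" "wsum Y < \<infinity>" "c < top"
  shows "wsum X < \<infinity>"
  using wsum_mono[of X "\<lambda>\<alpha>. c * Y \<alpha>"] assms
  by (auto simp: wsum_cmult ennreal_mult_less_top elim!: le_less_trans)

lemma weight_le_wsum: "ennreal (W \<alpha>) * X \<alpha> \<le> wsum X"
  unfolding wsum_def using sum_le_suminf[of "\<lambda>\<alpha>. ennreal (W \<alpha>) * X \<alpha>" "{\<alpha>}"] by (simp add: summableI)

text \<open>Dominated convergence for the counting measure, with the full summands as the dominating
  function.\<close>

lemma wsum_tail_tendsto:
  assumes "wsum X < \<infinity>"
  shows "(\<lambda>k. wsum (\<lambda>\<alpha>. if \<alpha> < k then 0 else X \<alpha>)) \<longlonglongrightarrow> 0"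
proof -
  have "(\<lambda>k. \<integral>\<^sup>+\<alpha>. ennreal (W \<alpha>) * (if \<alpha> < k then 0 else X \<alpha>) \<partial>count_space UNIV) \<longlonglongrightarrow> (\<integral>\<^sup>+\<alpha>. 0 \<partial>count_space (UNIV :: nat set))"
  proof (rule nn_integral_dominated_convergence[where w="\<lambda>\<alpha>. ennreal (W \<alpha>) * X \<alpha>"])
    show "(\<integral>\<^sup>+\<alpha>. ennreal (W \<alpha>) * X \<alpha> \<partial>count_space UNIV) < \<infinity>"
      using assms by (simp add: nn_integral_count_space_nat wsum_def)
    show "AE \<alpha> in count_space UNIV. (\<lambda>k. ennreal (W \<alpha>) * (if \<alpha> < k then 0 else X \<alpha>)) \<longlonglongrightarrow> 0"
    proof (rule AE_I2)
      fix \<alpha>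
      have "\<forall>\<^sub>F k in sequentially. ennreal (W \<alpha>) * (if \<alpha> < k then 0 else X \<alpha>) = 0"
        unfolding eventually_sequentially by (intro exI[of _ "Suc \<alpha>"]) auto
      then show "(\<lambda>k. ennreal (W \<alpha>) * (if \<alpha> < k then 0 else X \<alpha>)) \<longlonglongrightarrow> 0"
        by (rule tendsto_eventually)
    qed
  qed auto
  then show ?thesis by (simp add: nn_integral_count_space_nat wsum_def)
qed

lemma wsum_finite_support:
  assumes "\<And>\<alpha>. \<alpha> \<ge> k \<Longrightarrow> X \<alpha> = 0" "\<And>\<alpha>. X \<alpha> < \<infinity>"
  shows "wsum X < \<infinity>"
proof -
  have "wsum X = (\<Sum>\<alpha><k. ennreal (W \<alpha>) * X \<alpha>)"
    unfolding wsum_def using assms(1) by (intro suminf_finite) auto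
  also have "\<dots> < \<infinity>"
    using assms(2) by (induction k) (auto simp: ennreal_mult_less_top)
  finally show ?thesis .
qed

text \<open>Nonnegative scalar sequences with finite weighted norm. They serve as bounds, uniform in
  time, for the members of a sequence of functions.\<close>

definition wfin :: "(nat \<Rightarrow> real) \<Rightarrow> bool" where
  "wfin a \<longleftrightarrow> (\<forall>\<alpha>. a \<alpha> \<ge> 0) \<and> wsum (\<lambda>\<alpha>. ennreal (a \<alpha> powr p)) < \<infinity>"

lemma weighted_summable_iff: "weighted_summable p s h v \<longleftrightarrow> wfin (\<lambda>\<alpha>. norm (v \<alpha>))"
proof -
  have "weighted_summable p s h v \<longleftrightarrow> (\<Sum>\<alpha>. ennreal (W \<alpha> * norm (v \<alpha>) powr p)) \<noteq> top"
  proof -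
    have nn: "0 \<le> W \<alpha> * norm (v \<alpha>) powr p" for \<alpha>
      using weight_pos[of \<alpha>] by simp
    show ?thesis
      unfolding weighted_summable_def
      by (rule iffI, rule ennreal_suminf_neq_top[OF _ nn], assumption, rule summable_suminf_not_top[OF nn])
  qed
  then show ?thesis
    using weight_pos by (simp add: wfin_def wsum_def less_top ennreal_mult less_imp_le)
qed

lemma wfin_add:
  assumes a: "wfin a" and b: "wfin b"
  shows "wfin (\<lambda>\<alpha>. a \<alpha> + b \<alpha>)"
proof -
  have "wsum (\<lambda>\<alpha>. ennreal ((a \<alpha> + b \<alpha>) powr p)) < \<infinity>"
  proof (rule wsum_le_cmult)
    show "ennreal ((a \<alpha> + b \<alpha>) powr p) \<le> ennreal (2 powr p) * (ennreal (a \<alpha> powr p) + ennreal (b \<alpha> powr p))" for \<alpha>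
      using powr_add_le[of "a \<alpha>" "b \<alpha>" p] a b p_nonneg
      by (simp add: wfin_def ennreal_leI flip: ennreal_plus ennreal_mult)
    show "wsum (\<lambda>\<alpha>. ennreal (a \<alpha> powr p) + ennreal (b \<alpha> powr p)) < \<infinity>"
      using a b by (simp add: wfin_def wsum_add)
  qed simp
  then show ?thesis using a b by (simp add: wfin_def)
qed

lemma wfin_cmult:
  assumes a: "wfin a" and c: "c \<ge> 0"
  shows "wfin (\<lambda>\<alpha>. c * a \<alpha>)"
proof -
  have "wsum (\<lambda>\<alpha>. ennreal ((c * a \<alpha>) powr p)) < \<infinity>"
  proof (rule wsum_le_cmult)
    show "ennreal ((c * a \<alpha>) powr p) \<le> ennreal (c powr p) * ennreal (a \<alpha> powr p)" for \<alpha>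
      using a c by (simp add: wfin_def powr_mult flip: ennreal_mult)
    show "wsum (\<lambda>\<alpha>. ennreal (a \<alpha> powr p)) < \<infinity>"
      using a by (simp add: wfin_def)
  qed simp
  then show ?thesis using a c by (simp add: wfin_def)
qed

lemma wfin_mono:
  assumes a: "wfin a" and le: "\<And>\<alpha>. 0 \<le> b \<alpha>" "\<And>\<alpha>. b \<alpha> \<le> a \<alpha>"
  shows "wfin b"
proof -
  have "wsum (\<lambda>\<alpha>. ennreal (b \<alpha> powr p)) \<le> wsum (\<lambda>\<alpha>. ennreal (a \<alpha> powr p))"
    using le p_nonneg by (intro wsum_mono ennreal_leI powr_mono2) auto
  then show ?thesis using a le by (auto simp: wfin_def elim!: le_less_trans)
qed

lemma seq_Lp_norm_pow_wsum: "seq_Lp_norm_pow T p s h N f = wsum (\<lambda>\<alpha>. Lp_norm_pow T p N (f \<alpha>))"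
  by (simp add: seq_Lp_norm_pow_def wsum_def)

lemma seq_Lp_norm_tendsto:
  assumes "(\<lambda>k. seq_Lp_norm_pow T p s h N (f k)) \<longlonglongrightarrow> 0"
  shows "(\<lambda>k. seq_Lp_norm T p s h N (f k)) \<longlonglongrightarrow> 0"
proof -
  have "(\<lambda>k. enn2real (seq_Lp_norm_pow T p s h N (f k))) \<longlonglongrightarrow> enn2real 0"
    using assms by (intro tendsto_enn2real) auto
  then have "(\<lambda>k. enn2real (seq_Lp_norm_pow T p s h N (f k)) powr (1 / p)) \<longlonglongrightarrow> 0 powr (1 / p)"
    using p_ge_1 by (intro tendsto_powr' tendsto_const) auto
  then show ?thesis by (simp add: seq_Lp_norm_def)
qed

text \<open>Finiteness has to be assumed: \<open>enn2real\<close> sends an infinite value to 0, so a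
  vanishing limit of the real norms would otherwise say nothing. A single component is then
  controlled through its positive weight.\<close>

lemma seq_Lp_norm_tendsto_component:
  assumes lim: "(\<lambda>k. seq_Lp_norm T p s h N (f k)) \<longlonglongrightarrow> 0" and fin: "\<And>k. seq_Lp_norm_pow T p s h N (f k) < \<infinity>"
  shows "(\<lambda>k. Lp_norm_pow T p N (f k \<alpha>)) \<longlonglongrightarrow> 0"
proof -
  have "(\<lambda>k. seq_Lp_norm T p s h N (f k) powr p) \<longlonglongrightarrow> 0 powr p"
    using p_ge_1 lim by (intro tendsto_powr' tendsto_const) (auto simp: seq_Lp_norm_def)
  then have "(\<lambda>k. ennreal (enn2real (seq_Lp_norm_pow T p s h N (f k)))) \<longlonglongrightarrow> ennreal 0"
    using p_ge_1 by (intro tendsto_ennrealI) (simp add: seq_Lp_norm_def powr_powr)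
  then have "(\<lambda>k. seq_Lp_norm_pow T p s h N (f k)) \<longlonglongrightarrow> 0"
    using fin by simp
  then have lim': "(\<lambda>k. ennreal (1 / W \<alpha>) * seq_Lp_norm_pow T p s h N (f k)) \<longlonglongrightarrow> ennreal (1 / W \<alpha>) * 0"
    by (intro ennreal_tendsto_cmult) auto
  have le: "Lp_norm_pow T p N (f k \<alpha>) \<le> ennreal (1 / W \<alpha>) * seq_Lp_norm_pow T p s h N (f k)" for k
  proof -
    have "Lp_norm_pow T p N (f k \<alpha>) = ennreal (1 / W \<alpha>) * (ennreal (W \<alpha>) * Lp_norm_pow T p N (f k \<alpha>))"
      using weight_pos[of \<alpha>] by (simp flip: mult.assoc ennreal_mult)
    also have "\<dots> \<le> ennreal (1 / W \<alpha>) * seq_Lp_norm_pow T p s h N (f k)"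
      unfolding seq_Lp_norm_pow_wsum by (intro mult_left_mono weight_le_wsum) auto
    finally show ?thesis .
  qed
  show ?thesis
    by (rule tendsto_sandwich[OF _ always_eventually[OF allI[OF le]] tendsto_const]) (use lim' in auto)
qed

end

locale hy_problem = hy_operator D A R w C T + weights p s h
  for D :: "'a::banach set" and A :: "'a \<Rightarrow> 'a" and R w C T p s h
begin

lemma wfin_L1_norm:
  assumes "\<And>\<alpha>. g \<alpha> \<in> Lp_space T p UNIV norm" "wsum (\<lambda>\<alpha>. Lp_norm_pow T p norm (g \<alpha>)) < \<infinity>"
  shows "wfin (\<lambda>\<alpha>. enn2real (\<integral>\<^sup>+t. ennreal (norm (g \<alpha> t)) \<partial>MT))"
proof -
  have "wsum (\<lambda>\<alpha>. ennreal (enn2real (\<integral>\<^sup>+t. ennreal (norm (g \<alpha> t)) \<partial>MT) powr p)) < \<infinity>"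
    by (rule wsum_le_cmult[OF L1_norm_powr_le[OF assms(1) p_ge_1] assms(2)]) simp
  then show ?thesis by (simp add: wfin_def)
qed

lemma norm_primitive_le:
  fixes F :: "real \<Rightarrow> 'b::banach"
  assumes F: "L1 F" and t: "t \<in> {0..T}"
  shows "norm (primitive F t) \<le> enn2real (\<integral>\<^sup>+t. ennreal (norm (F t)) \<partial>MT)"
  using primitive_norm_le[OF F t] F by (cases "\<integral>\<^sup>+t. ennreal (norm (F t)) \<partial>MT") (auto simp: L1_def)

lemma wsum_bounded:
  assumes "wfin M" "\<And>\<alpha> t. t \<in> {0..T} \<Longrightarrow> 0 \<le> N (F \<alpha> t) \<and> N (F \<alpha> t) \<le> M \<alpha>"
  shows "wsum (\<lambda>\<alpha>. Lp_norm_pow T p N (F \<alpha>)) < \<infinity>"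
proof (rule wsum_le_cmult)
  show "Lp_norm_pow T p N (F \<alpha>) \<le> ennreal T * ennreal (M \<alpha> powr p)" for \<alpha>
    using Lp_norm_pow_bounded[of N "F \<alpha>" "M \<alpha>" p] assms(2) T_pos p_nonneg by (simp add: ennreal_mult)
qed (use assms(1) in \<open>auto simp: wfin_def\<close>)

lemma Lp_norm_pow_cong_AE:
  "AE t in MT. F t = G t \<Longrightarrow> Lp_norm_pow T p N F = Lp_norm_pow T p N G"
  unfolding Lp_norm_pow_def by (intro nn_integral_cong_AE) (auto elim: AE_mp)

text \<open>Simple functions approximating \<open>(w + 1) F - A F\<close> are mapped by
  \<open>R (w + 1)\<close> to simple functions with values in \<open>D\<close>. These converge to
  \<open>F\<close> in the graph norm because \<open>A R(w + 1)\<close> is bounded too.\<close>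

lemma strongly_measurable_graph:
  assumes F: "\<And>t. t \<in> {0<..<T} \<Longrightarrow> F t \<in> D" "smeas (\<lambda>t. (w + 1) *\<^sub>R F t - A (F t))"
  shows "strongly_measurable MT D (graph_norm A) F"
proof -
  have l: "w < w + 1" by simp
  obtain S where S: "\<forall>n. simple_function MT (S n)" "AE t in MT. (\<lambda>n. S n t) \<longlonglongrightarrow> (w + 1) *\<^sub>R F t - A (F t)"
    using F(2) by (rule smeasE)
  show ?thesis
    unfolding strongly_measurable_def
  proof (intro conjI exI allI)
    show "AE t in MT. F t \<in> D" using F(1) by (intro AE_I2) auto
    show "simple_function MT (\<lambda>t. R (w + 1) (S n t))" for n
      by (rule simple_function_compose1[OF S(1)[rule_format]])
    show "(\<lambda>t. R (w + 1) (S n t)) ` space MT \<subseteq> D" for n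
      using R_in_D[OF l] by auto
    show "AE t in MT. (\<lambda>n. graph_norm A (R (w + 1) (S n t) - F t)) \<longlonglongrightarrow> 0"
      using S(2) AE_space
    proof eventually_elim
      case (elim t)
      define y where "y = (w + 1) *\<^sub>R F t - A (F t)"
      have y: "(\<lambda>n. S n t - y) \<longlonglongrightarrow> 0" using elim(1) by (simp add: y_def LIM_zero)
      have eq: "R (w + 1) (S n t) - F t = R (w + 1) (S n t - y)" for n
        using R_eq_shift[OF l, of "F t"] F(1) elim(2) by (simp add: y_def blinfun.diff_right)
      have "(\<lambda>n. norm (R (w + 1) (S n t - y)) + norm (AR (w + 1) (S n t - y))) \<longlonglongrightarrow> norm (R (w + 1) 0) + norm (AR (w + 1) 0)"
        by (intro tendsto_add tendsto_norm blinfun.tendsto tendsto_const y)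
      then show ?case
        by (simp add: graph_norm_def eq A_R'[OF l] blinfun.zero_right)
    qed
  qed
qed

text \<open>For each index, \<open>u\<close>, its derivative \<open>v\<close> and \<open>A u\<close>
  are bounded in time by expressions linear in the norms of \<open>u0\<close>, \<open>A u0\<close>
  and \<open>f 0\<close> and the \<open>L1\<close> norm of \<open>f'\<close>, with constants
  independent of the index. Weighted summability of the solution is thereby reduced to that of these
  scalar sequences.\<close>

lemma strict_solution_exists:
  assumes f: "f \<in> seq_W1p T p s h" and u0: "\<And>\<alpha>. u0 \<alpha> \<in> D" "\<And>\<alpha>. A (u0 \<alpha>) + f \<alpha> 0 \<in> closure D"
    and sum: "weighted_summable p s h u0" "weighted_summable p s h (\<lambda>\<alpha>. A (u0 \<alpha>))"
  shows "\<exists>u. strict_solution T p s h D A f u0 u"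
proof -
  define g where "g = seq_deriv T p f"
  have fg: "is_sobolev_deriv T p (f \<alpha>) (g \<alpha>)" for \<alpha>
    using f sobolev_deriv[of "f \<alpha>"] by (simp add: seq_W1p_def g_def seq_deriv_def)
  have gLp: "g \<alpha> \<in> Lp_space T p UNIV norm" for \<alpha> using fg by (simp add: is_sobolev_deriv_primitive)
  have Lg: "L1 (g \<alpha>)" for \<alpha> by (rule Lp_L1[OF gLp p_ge_1])
  have f_eq: "f \<alpha> t = f \<alpha> 0 + primitive (g \<alpha>) t" if "t \<in> {0..T}" for \<alpha> t
    by (rule is_sobolev_deriv_at_0[OF fg p_ge_1 that])
  have cf: "continuous_on {0..T} (f \<alpha>)" for \<alpha> by (rule is_sobolev_deriv_continuous[OF fg p_ge_1])
  have wf: "wsum (\<lambda>\<alpha>. Lp_norm_pow T p norm (f \<alpha>)) < \<infinity>" and wg: "wsum (\<lambda>\<alpha>. Lp_norm_pow T p norm (g \<alpha>)) < \<infinity>"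
    using f unfolding seq_W1p_def wsum_def[symmetric] wsum_add g_def by auto
  define n1 where "n1 = (\<lambda>\<alpha>. enn2real (\<integral>\<^sup>+t. ennreal (norm (g \<alpha> t)) \<partial>MT))"
  have n1: "wfin n1" unfolding n1_def by (rule wfin_L1_norm[OF gLp wg])
  have n1_eq: "(\<integral>\<^sup>+t. ennreal (norm (g \<alpha> t)) \<partial>MT) = ennreal (n1 \<alpha>)" for \<alpha>
    using Lg[of \<alpha>] by (simp add: n1_def L1_def less_top)
  have n1_nn: "n1 \<alpha> \<ge> 0" for \<alpha> by (simp add: n1_def)
  \<comment> \<open>Weighted summability of the initial values of \<open>f\<close> is not given. It
    is recovered from \<open>norm (f 0) \<le> norm (f t) + n1\<close> by averaging the
    \<open>p\<close>-th powers over \<open>t\<close>, which brings in the factor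
    \<open>1 / T\<close>.\<close>
  have f0: "wfin (\<lambda>\<alpha>. norm (f \<alpha> 0))"
  proof -
    have "wsum (\<lambda>\<alpha>. ennreal (norm (f \<alpha> 0) powr p)) < \<infinity>"
    proof (rule wsum_le_cmult)
      show "ennreal (norm (f \<alpha> 0) powr p) \<le> ennreal (2 powr p / T) * (Lp_norm_pow T p norm (f \<alpha>) + ennreal (T * n1 \<alpha> powr p))" for \<alpha>
      proof -
        have "ennreal (T * norm (f \<alpha> 0) powr p) = (\<integral>\<^sup>+t. ennreal (norm (f \<alpha> 0) powr p) \<partial>MT)"
          using T_pos emeasure_MT by (simp add: ennreal_mult mult.commute)
        also have "\<dots> \<le> ennreal (2 powr p) * ((\<integral>\<^sup>+t. ennreal (norm (f \<alpha> t) powr p) \<partial>MT) + (\<integral>\<^sup>+t. ennreal (norm (n1 \<alpha>) powr p) \<partial>MT))"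
        proof (intro nn_integral_powr_triangle smeas_continuous[OF cf] smeas_const p_nonneg)
          fix t assume t: "t \<in> {0<..<T}"
          then have "norm (f \<alpha> 0) \<le> norm (f \<alpha> t) + norm (primitive (g \<alpha>) t)"
            using f_eq[of t \<alpha>] norm_triangle_ineq4[of "f \<alpha> t" "primitive (g \<alpha>) t"] by simp
          also have "norm (primitive (g \<alpha>) t) \<le> n1 \<alpha>"
            unfolding n1_def using t by (intro norm_primitive_le Lg) auto
          finally show "norm (f \<alpha> 0) \<le> norm (f \<alpha> t) + norm (n1 \<alpha>)" using n1_nn by simp
        qed
        also have "\<dots> = ennreal (2 powr p) * (Lp_norm_pow T p norm (f \<alpha>) + ennreal (T * n1 \<alpha> powr p))"
          using T_pos emeasure_MT n1_nn by (simp add: ennreal_mult mult.commute Lp_norm_pow_def)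
        finally have "ennreal (1 / T) * ennreal (T * norm (f \<alpha> 0) powr p) \<le> ennreal (1 / T) * (ennreal (2 powr p) * (Lp_norm_pow T p norm (f \<alpha>) + ennreal (T * n1 \<alpha> powr p)))"
          by (rule mult_left_mono) simp
        moreover have "ennreal (1 / T) * ennreal (T * norm (f \<alpha> 0) powr p) = ennreal (norm (f \<alpha> 0) powr p)"
          using T_pos by (simp flip: ennreal_mult)
        moreover have "ennreal (1 / T) * (ennreal (2 powr p) * (Lp_norm_pow T p norm (f \<alpha>) + ennreal (T * n1 \<alpha> powr p)))
            = ennreal (2 powr p / T) * (Lp_norm_pow T p norm (f \<alpha>) + ennreal (T * n1 \<alpha> powr p))"
          using T_pos by (simp add: mult.assoc[symmetric] flip: ennreal_mult)
        ultimately show ?thesis by simp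
      qed
      have "wsum (\<lambda>\<alpha>. ennreal (T * n1 \<alpha> powr p)) < \<infinity>"
        by (rule wsum_le_cmult[of _ "ennreal T" "\<lambda>\<alpha>. ennreal (n1 \<alpha> powr p)"])
          (use n1 T_pos in \<open>auto simp: wfin_def ennreal_mult\<close>)
      then show "wsum (\<lambda>\<alpha>. Lp_norm_pow T p norm (f \<alpha>) + ennreal (T * n1 \<alpha> powr p)) < \<infinity>"
        using wf by (simp add: wsum_add)
    qed simp
    then show ?thesis by (simp add: wfin_def)
  qed
  have "\<forall>\<alpha>. \<exists>v. mild_solution (A (u0 \<alpha>) + f \<alpha> 0) (primitive (g \<alpha>)) v"
    using mild_L1_exists_bound[OF u0(2) Lg] by blast
  then obtain v where v: "\<And>\<alpha>. mild_solution (A (u0 \<alpha>) + f \<alpha> 0) (primitive (g \<alpha>)) (v \<alpha>)" by metis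
  have cv: "continuous_on {0..T} (v \<alpha>)" for \<alpha> by (rule mild_continuous[OF v])
  have Lv: "L1 (v \<alpha>)" for \<alpha> by (rule L1_continuous[OF cv])
  define u where "u = (\<lambda>\<alpha> t. u0 \<alpha> + primitive (v \<alpha>) t)"
  \<comment> \<open>Bound for \<open>v\<close>, the time derivative of \<open>u\<close>: the a
    priori estimate with initial value \<open>A u0 + f 0\<close> and forcing
    \<open>f'\<close>.\<close>
  define M where "M = (\<lambda>\<alpha>. K2 * (norm (A (u0 \<alpha>)) + norm (f \<alpha> 0) + n1 \<alpha>))"
  have vM: "norm (v \<alpha> t) \<le> M \<alpha>" if t: "t \<in> {0..T}" for \<alpha> t
  proof -
    have "ennreal (norm (v \<alpha> t)) \<le> ennreal K2 * (ennreal (norm (A (u0 \<alpha>) + f \<alpha> 0)) + ennreal (n1 \<alpha>))"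
      using mild_L1_bound[OF v Lg t] by (simp only: n1_eq)
    also have "\<dots> = ennreal (K2 * (norm (A (u0 \<alpha>) + f \<alpha> 0) + n1 \<alpha>))"
      using K2_pos n1_nn by (simp flip: ennreal_plus ennreal_mult)
    finally have "norm (v \<alpha> t) \<le> K2 * (norm (A (u0 \<alpha>) + f \<alpha> 0) + n1 \<alpha>)"
      using K2_pos n1_nn by (subst (asm) ennreal_le_iff) auto
    also have "\<dots> \<le> M \<alpha>"
      unfolding M_def using K2_pos by (intro mult_left_mono add_right_mono norm_triangle_ineq) auto
    finally show ?thesis .
  qed
  have M: "wfin M"
    unfolding M_def using sum(2) K2_pos
    by (intro wfin_cmult wfin_add f0 n1) (auto simp: weighted_summable_iff)
  have M_nn: "M \<alpha> \<ge> 0" for \<alpha> using M by (simp add: wfin_def)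
  have primitive_v: "norm (primitive (v \<alpha>) t) \<le> T * M \<alpha>" if t: "t \<in> {0..T}" for \<alpha> t
  proof -
    have "ennreal (norm (primitive (v \<alpha>) t)) \<le> (\<integral>\<^sup>+s. ennreal (norm (v \<alpha> s)) \<partial>MT)"
      by (rule primitive_norm_le[OF Lv t])
    also have "\<dots> \<le> (\<integral>\<^sup>+s. ennreal (M \<alpha>) \<partial>MT)"
      by (intro nn_integral_mono ennreal_leI vM) auto
    also have "\<dots> = ennreal (T * M \<alpha>)"
      using T_pos emeasure_MT M_nn by (simp add: ennreal_mult mult.commute)
    finally show ?thesis using T_pos M_nn by (subst (asm) ennreal_le_iff) auto
  qed
  \<comment> \<open>The first bracket bounds \<open>u\<close>, the second
    \<open>A u = v - f\<close>; their sum bounds the graph norm.\<close>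
  define M' where "M' = (\<lambda>\<alpha>. (norm (u0 \<alpha>) + T * M \<alpha>) + (M \<alpha> + (norm (f \<alpha> 0) + n1 \<alpha>)))"
  have M': "wfin M'"
    unfolding M'_def using sum(1) T_pos
    by (intro wfin_add wfin_cmult M f0 n1) (auto simp: weighted_summable_iff)
  have u_le: "norm (u \<alpha> t) \<le> norm (u0 \<alpha>) + T * M \<alpha>" if "t \<in> {0..T}" for \<alpha> t
    unfolding u_def using primitive_v[OF that] norm_triangle_ineq order_trans by (meson add_left_mono)
  have uD: "u \<alpha> t \<in> D" and Au: "A (u \<alpha> t) = v \<alpha> t - f \<alpha> t" if t: "t \<in> {0..T}" for \<alpha> t
    using mild_strong_solution[OF v u0(1) t] by (simp_all add: u_def f_eq[OF t])
  have Au_le: "norm (A (u \<alpha> t)) \<le> M \<alpha> + (norm (f \<alpha> 0) + n1 \<alpha>)" if t: "t \<in> {0..T}" for \<alpha> t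
  proof -
    have "norm (f \<alpha> t) \<le> norm (f \<alpha> 0) + n1 \<alpha>"
      using norm_triangle_ineq[of "f \<alpha> 0" "primitive (g \<alpha>) t"] norm_primitive_le[OF Lg t] f_eq[OF t]
      by (simp add: n1_def) (meson add_left_mono order_trans)
    then show ?thesis
      unfolding Au[OF t] using vM[OF t, of \<alpha>] norm_triangle_ineq4[of "v \<alpha> t" "f \<alpha> t"] by linarith
  qed
  have uv: "is_sobolev_deriv T p (u \<alpha>) (v \<alpha>)" for \<alpha>
    unfolding is_sobolev_deriv_primitive using Lp_continuous[OF cv p_nonneg] by (auto simp: u_def)
  have du: "AE t in MT. seq_deriv T p u \<alpha> t = v \<alpha> t" for \<alpha>
    unfolding seq_deriv_def by (rule sobolev_deriv_AE[OF uv p_ge_1])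
  have cu: "continuous_on {0..T} (u \<alpha>)" for \<alpha> by (rule is_sobolev_deriv_continuous[OF uv p_ge_1])
  have "u \<in> seq_W1p T p s h"
    unfolding seq_W1p_def
  proof (intro CollectI conjI allI)
    show "u \<alpha> \<in> W1p_space T p" for \<alpha> using uv by (auto simp: W1p_space_def)
    have "wsum (\<lambda>\<alpha>. Lp_norm_pow T p norm (u \<alpha>)) < \<infinity>"
    proof (rule wsum_bounded[OF M'])
      show "0 \<le> norm (u \<alpha> t) \<and> norm (u \<alpha> t) \<le> M' \<alpha>" if "t \<in> {0..T}" for \<alpha> t
        using u_le[OF that, of \<alpha>] M_nn n1_nn by (simp add: M'_def add_increasing2)
    qed
    moreover have "wsum (\<lambda>\<alpha>. Lp_norm_pow T p norm (v \<alpha>)) < \<infinity>"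
      using vM by (intro wsum_bounded[OF M]) auto
    ultimately show "(\<Sum>\<alpha>. ennreal (W \<alpha>) * (Lp_norm_pow T p norm (u \<alpha>) + Lp_norm_pow T p norm (seq_deriv T p u \<alpha>))) < \<infinity>"
      by (simp add: Lp_norm_pow_cong_AE[OF du] wsum_def[symmetric] wsum_add)
  qed
  moreover have "u \<in> seq_Lp T p s h D (graph_norm A)"
  proof -
    have gr: "0 \<le> graph_norm A (u \<alpha> t) \<and> graph_norm A (u \<alpha> t) \<le> M' \<alpha>" if t: "t \<in> {0..T}" for \<alpha> t
      using u_le[OF t, of \<alpha>] Au_le[OF t, of \<alpha>] by (simp add: graph_norm_def M'_def)
    have "strongly_measurable MT D (graph_norm A) (u \<alpha>)" for \<alpha>
    proof (rule strongly_measurable_graph)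
      show "u \<alpha> t \<in> D" if "t \<in> {0<..<T}" for t using uD that by auto
      have "continuous_on {0..T} (\<lambda>t. (w + 1) *\<^sub>R u \<alpha> t - (v \<alpha> t - f \<alpha> t))"
        by (intro continuous_intros cu cv cf)
      then have "continuous_on {0..T} (\<lambda>t. (w + 1) *\<^sub>R u \<alpha> t - A (u \<alpha> t))"
        by (rule continuous_on_eq) (simp add: Au)
      then show "smeas (\<lambda>t. (w + 1) *\<^sub>R u \<alpha> t - A (u \<alpha> t))" by (rule smeas_continuous)
    qed
    moreover have "Lp_norm_pow T p (graph_norm A) (u \<alpha>) < \<infinity>" for \<alpha>
      using gr p_nonneg by (intro le_less_trans[OF Lp_norm_pow_bounded]) auto
    ultimately show ?thesis
      using wsum_bounded[OF M', of "graph_norm A" u, OF gr] by (simp add: seq_Lp_def Lp_space_def seq_Lp_norm_pow_wsum)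
  qed
  moreover have "equation_ae T p A f u"
    unfolding equation_ae_def AE_closed_iff
  proof
    fix \<alpha>
    show "AE t in MT. seq_deriv T p u \<alpha> t = A (u \<alpha> t) + f \<alpha> t"
      using du[of \<alpha>] AE_space by eventually_elim (simp add: Au)
  qed
  moreover have "u \<alpha> 0 = u0 \<alpha>" for \<alpha> using Lv by (simp add: u_def)
  ultimately show ?thesis
    unfolding strict_solution_def regular_seqs_def by blast
qed

lemma strict_solution_mild:
  assumes u: "strict_solution T p s h D A f u0 u" and f: "L1 (f \<alpha>)"
  shows "mild_solution (u0 \<alpha>) (primitive (f \<alpha>)) (u \<alpha>)"
proof -
  define G where "G = seq_deriv T p u \<alpha>"
  have G: "is_sobolev_deriv T p (u \<alpha>) G"
    using u sobolev_deriv[of "u \<alpha>"] by (simp add: strict_solution_def regular_seqs_def seq_W1p_def G_def seq_deriv_def)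
  have LG: "L1 G"
    using G by (intro Lp_L1[OF _ p_ge_1]) (simp add: is_sobolev_deriv_primitive)
  show ?thesis
  proof (rule strong_solution_mild[OF _ _ LG f])
    show "continuous_on {0..T} (u \<alpha>)" by (rule is_sobolev_deriv_continuous[OF G p_ge_1])
    show "u \<alpha> t = u0 \<alpha> + primitive G t" if "t \<in> {0..T}" for t
      using is_sobolev_deriv_at_0[OF G p_ge_1 that] u by (simp add: strict_solution_def)
    show "AE t in MT. u \<alpha> t \<in> D"
      using u by (simp add: strict_solution_def regular_seqs_def seq_Lp_def Lp_space_def strongly_measurable_def)
    show "AE t in MT. G t = A (u \<alpha> t) + f \<alpha> t"
      using u unfolding strict_solution_def equation_ae_def AE_closed_iff G_def by blast
  qed
qed

text \<open>The bound uniform in time is integrated over an interval of length \<open>T\<close>. The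
  factor \<open>(2 * K2) powr p\<close> arises from splitting the \<open>p\<close>-th power of a
  sum, and \<open>(T + 1) powr p\<close> from passing from the \<open>L1\<close> to the
  \<open>Lp\<close> norm of the forcing.\<close>

lemma mild_Lp_bound:
  assumes v: "mild_solution x (primitive f) v" and f: "f \<in> Lp_space T p UNIV norm"
  shows "Lp_norm_pow T p norm v \<le> ennreal (T * (2 * K2) powr p * (T + 1) powr p) * (ennreal (norm x powr p) + Lp_norm_pow T p norm f)"
proof -
  have Lf: "L1 f" by (rule Lp_L1[OF f p_ge_1])
  define n where "n = enn2real (\<integral>\<^sup>+t. ennreal (norm (f t)) \<partial>MT)"
  have n: "(\<integral>\<^sup>+t. ennreal (norm (f t)) \<partial>MT) = ennreal n" "n \<ge> 0"
    using Lf by (auto simp: n_def L1_def less_top)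
  have b: "norm (v t) \<le> K2 * (norm x + n)" if t: "t \<in> {0..T}" for t
  proof -
    have "ennreal (norm (v t)) \<le> ennreal K2 * (ennreal (norm x) + ennreal n)"
      using mild_L1_bound[OF v Lf t] by (simp only: n(1))
    also have "\<dots> = ennreal (K2 * (norm x + n))"
      using K2_pos n(2) by (simp flip: ennreal_plus ennreal_mult)
    finally show ?thesis using K2_pos n(2) by (subst (asm) ennreal_le_iff) auto
  qed
  have "Lp_norm_pow T p norm v \<le> ennreal (T * (K2 * (norm x + n)) powr p)"
    using b p_nonneg by (intro Lp_norm_pow_bounded) auto
  also have "T * (K2 * (norm x + n)) powr p \<le> T * (2 * K2) powr p * (norm x powr p + n powr p)"
  proof -
    have "(K2 * (norm x + n)) powr p = K2 powr p * (norm x + n) powr p"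
      using K2_pos n(2) by (simp add: powr_mult)
    also have "\<dots> \<le> K2 powr p * (2 powr p * (norm x powr p + n powr p))"
      using n(2) p_nonneg by (intro mult_left_mono powr_add_le) auto
    also have "\<dots> = (2 * K2) powr p * (norm x powr p + n powr p)"
      using K2_pos by (simp add: powr_mult mult.assoc mult.left_commute)
    finally show ?thesis using T_pos by (simp add: mult.assoc)
  qed
  also have "ennreal (T * (2 * K2) powr p * (norm x powr p + n powr p)) = ennreal (T * (2 * K2) powr p) * (ennreal (norm x powr p) + ennreal (n powr p))"
    using T_pos by (simp flip: ennreal_plus ennreal_mult)
  also have "\<dots> \<le> ennreal (T * (2 * K2) powr p) * (ennreal ((T + 1) powr p) * (ennreal (norm x powr p) + Lp_norm_pow T p norm f))"
  proof (rule mult_left_mono)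
    \<comment> \<open>The initial value does not produce this factor by itself; since it is at least
      1, one constant can stand in front of both terms.\<close>
    have "1 \<le> (T + 1) powr p" using T_pos p_nonneg by (intro ge_one_powr_ge_zero) auto
    then have "ennreal (norm x powr p) \<le> ennreal ((T + 1) powr p) * ennreal (norm x powr p)"
      by (simp flip: ennreal_mult add: ennreal_leI mult_le_cancel_right1)
    then show "ennreal (norm x powr p) + ennreal (n powr p) \<le> ennreal ((T + 1) powr p) * (ennreal (norm x powr p) + Lp_norm_pow T p norm f)"
      unfolding distrib_left using L1_norm_powr_le[OF f p_ge_1] by (intro add_mono) (auto simp: n_def)
  qed simp
  also have "\<dots> = ennreal (T * (2 * K2) powr p * (T + 1) powr p) * (ennreal (norm x powr p) + Lp_norm_pow T p norm f)"
    using T_pos by (simp add: mult.assoc ennreal_mult)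
  finally show ?thesis by (simp add: ennreal_leI)
qed

end

section \<open>Compatible smooth data and approximating strict solutions\<close>

context hy_problem
begin

text \<open>Derivatives are taken within the closed interval: the approximating forcing must be
  differentiable up to time 0, where the compatibility condition is imposed.\<close>

definition C1 :: "(real \<Rightarrow> 'b::real_normed_vector) \<Rightarrow> (real \<Rightarrow> 'b) \<Rightarrow> bool" where
  "C1 g g' \<longleftrightarrow> (\<forall>t\<in>{0..T}. (g has_vector_derivative g' t) (at t within {0..T})) \<and> continuous_on {0..T} g'"

lemma C1_continuous: "C1 g g' \<Longrightarrow> continuous_on {0..T} g"
  unfolding C1_def continuous_on_eq_continuous_within by (blast intro: has_vector_derivative_continuous)

lemma C1_sobolev_deriv:
  fixes g :: "real \<Rightarrow> 'b::banach"
  assumes "C1 g g'"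
  shows "is_sobolev_deriv T p g g'"
  unfolding is_sobolev_deriv_primitive
proof (intro conjI exI ballI)
  have c: "continuous_on {0..T} g'" using assms by (simp add: C1_def)
  show "g' \<in> Lp_space T p UNIV norm" by (rule Lp_continuous[OF c p_nonneg])
  fix t assume t: "t \<in> {0..T}"
  have "(g' has_integral (g t - g 0)) {0..t}"
  proof (rule fundamental_theorem_of_calculus)
    show "(g has_vector_derivative g' s) (at s within {0..t})" if "s \<in> {0..t}" for s
    proof (rule has_vector_derivative_within_subset)
      show "(g has_vector_derivative g' s) (at s within {0..T})"
        using assms that t by (simp add: C1_def)
      show "{0..t} \<subseteq> {0..T}" using t by auto
    qed
  qed (use t in simp)
  then show "g t = g 0 + primitive g' t"
    by (simp only: primitive_continuous_eq_integral[OF c t] integral_unique) simp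
qed

lemma C1_diff: "C1 f f' \<Longrightarrow> C1 g g' \<Longrightarrow> C1 (\<lambda>t. f t - g t) (\<lambda>t. f' t - g' t)"
  unfolding C1_def by (auto intro!: has_vector_derivative_diff continuous_on_diff)

lemma C1_vpoly:
  fixes P :: "real \<Rightarrow> 'b::real_normed_vector"
  assumes "vpoly P"
  shows "\<exists>P'. C1 P P'"
proof -
  obtain n y where P: "P = (\<lambda>s. \<Sum>i<n. s ^ i *\<^sub>R y i)" using assms by (auto simp: vpoly_def)
  have "C1 P (\<lambda>s. \<Sum>i<n. (real i * s ^ (i - 1)) *\<^sub>R y i)"
    unfolding C1_def P
  proof (intro conjI ballI continuous_intros has_vector_derivative_sum)
    fix t i
    have "((\<lambda>s. s ^ i) has_real_derivative real i * t ^ (i - 1)) (at t within {0..T})"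
      using DERIV_pow[of i t "{0..T}"] by simp
    from has_vector_derivative_scaleR[OF this has_vector_derivative_const[of "y i"]]
    show "((\<lambda>s. s ^ i *\<^sub>R y i) has_vector_derivative (real i * t ^ (i - 1)) *\<^sub>R y i) (at t within {0..T})"
      by simp
  qed
  then show ?thesis by blast
qed

lemma C1_cutoff: "\<exists>g'. C1 (\<lambda>t. (1 - t / T) ^ m *\<^sub>R c) g'"
proof -
  have "C1 (\<lambda>t. (1 - t / T) ^ m *\<^sub>R c) (\<lambda>t. (real m * (1 - t / T) ^ (m - 1) * (- 1 / T)) *\<^sub>R c)"
    unfolding C1_def
  proof (intro conjI ballI continuous_intros)
    fix t
    have "((\<lambda>s. 1 - s / T) has_real_derivative - 1 / T) (at t within {0..T})"
      using T_pos by (auto intro!: derivative_eq_intros)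
    from DERIV_power[OF this, of m]
    have "((\<lambda>s. (1 - s / T) ^ m) has_real_derivative real m * (1 - t / T) ^ (m - 1) * (- 1 / T)) (at t within {0..T})"
      by (simp add: mult.assoc mult.left_commute)
    from has_vector_derivative_scaleR[OF this has_vector_derivative_const[of c]]
    show "((\<lambda>t. (1 - t / T) ^ m *\<^sub>R c) has_vector_derivative (real m * (1 - t / T) ^ (m - 1) * (- 1 / T)) *\<^sub>R c) (at t within {0..T})"
      by simp
  qed (use T_pos in auto)
  then show ?thesis by blast
qed

text \<open>The cut-off has values between 0 and 1 and \<open>p \<ge> 1\<close>, so its
  \<open>p\<close>-th power is at most the cut-off itself, whose integral is
  \<open>T / (m + 1)\<close>.\<close>

lemma cutoff_Lp_le:
  fixes c :: "'b::real_normed_vector"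
  shows "(\<integral>\<^sup>+t. ennreal (norm ((1 - t / T) ^ m *\<^sub>R c) powr p) \<partial>MT) \<le> ennreal (norm c powr p * (T / (real m + 1)))"
proof -
  have "(\<integral>\<^sup>+t. ennreal (norm ((1 - t / T) ^ m *\<^sub>R c) powr p) \<partial>MT) \<le> (\<integral>\<^sup>+t. ennreal (norm c powr p * (1 - t / T) ^ m) \<partial>MT)"
  proof (intro nn_integral_mono ennreal_leI)
    fix t assume "t \<in> space MT"
    then have t: "0 \<le> 1 - t / T" "1 - t / T \<le> 1" using T_pos by auto
    have "norm ((1 - t / T) ^ m *\<^sub>R c) powr p = norm c powr p * ((1 - t / T) ^ m) powr p"
      using t by (simp add: powr_mult)
    also have "((1 - t / T) ^ m) powr p \<le> ((1 - t / T) ^ m) powr 1"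
      using t p_ge_1 by (intro powr_mono') (auto intro: power_le_one)
    finally show "norm ((1 - t / T) ^ m *\<^sub>R c) powr p \<le> norm c powr p * (1 - t / T) ^ m"
      using t by (simp add: mult_left_mono)
  qed
  also have "\<dots> = ennreal (integral {0..T} (\<lambda>t. norm c powr p * (1 - t / T) ^ m))"
    using T_pos by (intro nn_integral_MT_continuous) (auto intro!: continuous_intros)
  also have "integral {0..T} (\<lambda>t. norm c powr p * (1 - t / T) ^ m) = norm c powr p * (T / (real m + 1))"
  proof (rule integral_unique, rule has_integral_mult_right)
    have "((\<lambda>s. - (T / (real m + 1)) * (1 - s / T) ^ Suc m) has_vector_derivative (1 - t / T) ^ m) (at t within {0..T})" for t
    proof -
      have "((\<lambda>s. 1 - s / T) has_real_derivative - 1 / T) (at t within {0..T})"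
        using T_pos by (auto intro!: derivative_eq_intros)
      from DERIV_cmult[OF DERIV_power[OF this, of "Suc m"], of "- (T / (real m + 1))"]
      have "((\<lambda>s. - (T / (real m + 1)) * (1 - s / T) ^ Suc m) has_real_derivative
          - (T / (real m + 1)) * (real (Suc m) * (- 1 / T * (1 - t / T) ^ m))) (at t within {0..T})"
        by simp
      moreover have "- (T / (real m + 1)) * (real (Suc m) * (- 1 / T * x)) = x" for x
      proof -
        have "- (T / n) * (n * (- 1 / T * x)) = x" if "n \<noteq> 0" for n
          using T_pos that by (simp add: field_simps)
        from this[of "real m + 1"] show ?thesis by (simp add: add.commute)
      qed
      ultimately show ?thesis
        by (simp only: has_real_derivative_iff_has_vector_derivative)
    qed
    from fundamental_theorem_of_calculus[OF less_imp_le[OF T_pos] this]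
    show "((\<lambda>t. (1 - t / T) ^ m) has_integral T / (real m + 1)) {0..T}"
      using T_pos by simp
  qed
  finally show ?thesis .
qed

text \<open>
  The cut-off \<open>(1 - t / T)\<^sup>m\<close> is small in \<open>L\<^sup>p\<close> but equal to \<open>1\<close> at \<open>0\<close>; it makes the initial values
  compatible.
\<close>

lemma smooth_data_approx:
  assumes x0: "x0 \<in> closure D" and f: "f \<in> Lp_space T p UNIV norm" and e: "e > 0"
  shows "\<exists>x g g'. x \<in> D \<and> norm (x - x0) powr p \<le> e \<and> C1 g g' \<and>
    (\<integral>\<^sup>+t. ennreal (norm (g t - f t) powr p) \<partial>MT) \<le> ennreal e \<and> A x + g 0 = 0"
proof -
  have sf: "smeas f" using f by (simp add: Lp_space_iff)
  obtain x where x: "x \<in> D" "dist x x0 < e powr (1 / p)"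
    using x0 e unfolding closure_approachable by (metis powr_gt_zero less_irrefl)
  have xe: "norm (x - x0) powr p \<le> e"
  proof -
    have "norm (x - x0) powr p \<le> (e powr (1 / p)) powr p"
      using x(2) p_nonneg by (intro powr_mono2) (auto simp: dist_norm)
    then show ?thesis using e p_ge_1 by (simp add: powr_powr)
  qed
  have e': "e / (2 * 2 powr p) > 0" using e by simp
  obtain P where P: "vpoly P" "(\<integral>\<^sup>+t. ennreal (norm (f t - P t) powr p) \<partial>MT) < ennreal (e / (2 * 2 powr p))"
    using approximable_Lp[OF sf p_ge_1] f e' unfolding approximable_def Lp_space_iff by blast
  \<comment> \<open>Subtracting the cut-off times \<open>c\<close> from \<open>P\<close> moves the
    value at 0 to \<open>- A x\<close>; the derivative of the solution then starts at 0, which lies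
    in \<open>D\<close>.\<close>
  define c where "c = P 0 + A x"
  obtain m where m: "norm c powr p * (T / (real m + 1)) < e / (2 * 2 powr p)"
  proof -
    have "(\<lambda>m. norm c powr p * (T / (real m + 1))) \<longlonglongrightarrow> 0" by real_asymp
    then have "\<forall>\<^sub>F m in sequentially. norm c powr p * (T / (real m + 1)) < e / (2 * 2 powr p)"
      using e' by (rule order_tendstoD(2))
    then show thesis using that unfolding eventually_sequentially by blast
  qed
  define \<eta> where "\<eta> = (\<lambda>t. (1 - t / T) ^ m *\<^sub>R c)"
  have \<eta>: "(\<integral>\<^sup>+t. ennreal (norm (\<eta> t) powr p) \<partial>MT) < ennreal (e / (2 * 2 powr p))"
    using cutoff_Lp_le[of m c] m e' unfolding \<eta>_def by (auto elim!: le_less_trans intro!: ennreal_lessI)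
  obtain P' where P': "C1 P P'" using C1_vpoly[OF P(1)] by blast
  obtain \<eta>' where \<eta>': "C1 \<eta> \<eta>'" unfolding \<eta>_def using C1_cutoff by blast
  have "(\<integral>\<^sup>+t. ennreal (norm ((P t - \<eta> t) - f t) powr p) \<partial>MT) \<le>
     ennreal (2 powr p) * ((\<integral>\<^sup>+t. ennreal (norm (f t - P t) powr p) \<partial>MT) + (\<integral>\<^sup>+t. ennreal (norm (\<eta> t) powr p) \<partial>MT))"
  proof (intro nn_integral_powr_triangle smeas_diff sf smeas_vpoly[OF P(1)] smeas_continuous[OF C1_continuous[OF \<eta>']] p_nonneg)
    show "norm ((P t - \<eta> t) - f t) \<le> norm (f t - P t) + norm (\<eta> t)" for t
      using norm_triangle_ineq4[of "P t - f t" "\<eta> t"] by (simp add: norm_minus_commute algebra_simps)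
  qed
  also have "\<dots> < ennreal e" by (rule two_powr_bound[OF P(2) \<eta> e])
  finally have "(\<integral>\<^sup>+t. ennreal (norm ((P t - \<eta> t) - f t) powr p) \<partial>MT) \<le> ennreal e" by simp
  moreover have "A x + (P 0 - \<eta> 0) = 0" by (simp add: \<eta>_def c_def)
  ultimately show ?thesis
    using x(1) xe C1_diff[OF P' \<eta>'] by (intro exI[of _ x] exI[of _ "\<lambda>t. P t - \<eta> t"] exI[of _ "\<lambda>t. P' t - \<eta>' t"]) auto
qed

lemma seq_Lp_iff: "f \<in> seq_Lp T p s h UNIV norm \<longleftrightarrow>
    (\<forall>\<alpha>. f \<alpha> \<in> Lp_space T p UNIV norm) \<and> wsum (\<lambda>\<alpha>. Lp_norm_pow T p norm (f \<alpha>)) < \<infinity>"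
  by (simp add: seq_Lp_def seq_Lp_norm_pow_wsum)

lemma seq_Lp_diff:
  fixes f g :: "nat \<Rightarrow> real \<Rightarrow> 'b::real_normed_vector"
  assumes f: "f \<in> seq_Lp T p s h UNIV norm" and g: "g \<in> seq_Lp T p s h UNIV norm"
  shows "(\<lambda>\<alpha> t. f \<alpha> t - g \<alpha> t) \<in> seq_Lp T p s h UNIV norm"
proof -
  have sm: "smeas (f \<alpha>)" "smeas (g \<alpha>)" for \<alpha>
    using f g by (auto simp: seq_Lp_iff Lp_space_iff)
  have le: "Lp_norm_pow T p norm (\<lambda>t. f \<alpha> t - g \<alpha> t) \<le> ennreal (2 powr p) * (Lp_norm_pow T p norm (f \<alpha>) + Lp_norm_pow T p norm (g \<alpha>))" for \<alpha>
    unfolding Lp_norm_pow_def by (intro nn_integral_powr_triangle sm p_nonneg norm_triangle_ineq4)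
  have "Lp_norm_pow T p norm (\<lambda>t. f \<alpha> t - g \<alpha> t) < \<infinity>" for \<alpha>
    by (rule le_less_trans[OF le]) (use f g in \<open>auto simp: seq_Lp_iff Lp_space_def ennreal_mult_less_top\<close>)
  moreover have "wsum (\<lambda>\<alpha>. Lp_norm_pow T p norm (\<lambda>t. f \<alpha> t - g \<alpha> t)) < \<infinity>"
    by (rule wsum_le_cmult[OF le]) (use f g in \<open>auto simp: seq_Lp_iff wsum_add\<close>)
  ultimately show ?thesis
    using sm by (simp add: seq_Lp_iff Lp_space_def smeas_diff)
qed

lemma Lp_norm_pow_const:
  fixes c :: "'b::real_normed_vector"
  shows "Lp_norm_pow T p norm (\<lambda>_. c) = ennreal T * ennreal (norm c powr p)"
  using emeasure_MT by (simp add: Lp_norm_pow_def mult.commute)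

lemma const_seq_in_seq_Lp:
  fixes v :: "nat \<Rightarrow> 'b::real_normed_vector"
  assumes "weighted_summable p s h v"
  shows "const_seq v \<in> seq_Lp T p s h UNIV norm"
proof -
  have "const_seq v \<alpha> \<in> Lp_space T p UNIV norm" for \<alpha>
    unfolding const_seq_def by (rule Lp_continuous[OF continuous_on_const p_nonneg])
  moreover have "wsum (\<lambda>\<alpha>. Lp_norm_pow T p norm (const_seq v \<alpha>)) < \<infinity>"
    using assms by (simp add: const_seq_def Lp_norm_pow_const wsum_cmult weighted_summable_iff wfin_def ennreal_mult_less_top)
  ultimately show ?thesis by (simp add: seq_Lp_iff)
qed

lemma W1p_continuous: "F \<in> W1p_space T p \<Longrightarrow> continuous_on {0..T} (F :: real \<Rightarrow> 'b::banach)"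
  by (rule is_sobolev_deriv_continuous[OF sobolev_deriv p_ge_1])

lemma seq_W1p_D:
  fixes f :: "nat \<Rightarrow> real \<Rightarrow> 'b::banach"
  assumes "f \<in> seq_W1p T p s h"
  shows "f \<in> seq_Lp T p s h UNIV norm" "seq_deriv T p f \<in> seq_Lp T p s h UNIV norm"
proof -
  have W: "f \<alpha> \<in> W1p_space T p" for \<alpha> using assms by (simp add: seq_W1p_def)
  have "wsum (\<lambda>\<alpha>. Lp_norm_pow T p norm (f \<alpha>)) < \<infinity>" "wsum (\<lambda>\<alpha>. Lp_norm_pow T p norm (seq_deriv T p f \<alpha>)) < \<infinity>"
    using assms unfolding seq_W1p_def wsum_def[symmetric] wsum_add by auto
  moreover have "f \<alpha> \<in> Lp_space T p UNIV norm" for \<alpha>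
    by (rule Lp_continuous[OF W1p_continuous[OF W] p_nonneg])
  moreover have "seq_deriv T p f \<alpha> \<in> Lp_space T p UNIV norm" for \<alpha>
    using sobolev_deriv[OF W[of \<alpha>]] by (simp add: seq_deriv_def is_sobolev_deriv_primitive)
  ultimately show "f \<in> seq_Lp T p s h UNIV norm" "seq_deriv T p f \<in> seq_Lp T p s h UNIV norm"
    by (auto simp: seq_Lp_iff)
qed

lemma wsum_finite_part:
  assumes "\<And>\<alpha>. \<alpha> < k \<Longrightarrow> X \<alpha> \<le> ennreal (1 / ((real k + 1)\<^sup>2 * W \<alpha>))" "\<And>\<alpha>. \<alpha> \<ge> k \<Longrightarrow> X \<alpha> = 0"
  shows "wsum X \<le> ennreal (1 / (real k + 1))"
proof -
  have "wsum X = (\<Sum>\<alpha><k. ennreal (W \<alpha>) * X \<alpha>)"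
    unfolding wsum_def using assms(2) by (intro suminf_finite) auto
  also have "\<dots> \<le> (\<Sum>\<alpha><k. ennreal (1 / (real k + 1)\<^sup>2))"
  proof (rule sum_mono)
    fix \<alpha> assume "\<alpha> \<in> {..<k}"
    then have "ennreal (W \<alpha>) * X \<alpha> \<le> ennreal (W \<alpha>) * ennreal (1 / ((real k + 1)\<^sup>2 * W \<alpha>))"
      using assms(1) by (intro mult_left_mono) auto
    also have "\<dots> = ennreal (1 / (real k + 1)\<^sup>2)"
      using weight_pos[of \<alpha>] by (simp flip: ennreal_mult)
    finally show "ennreal (W \<alpha>) * X \<alpha> \<le> ennreal (1 / (real k + 1)\<^sup>2)" .
  qed
  also have "\<dots> = ennreal (real k * (1 / (real k + 1)\<^sup>2))"
    by (simp add: ennreal_of_nat_eq_real_of_nat flip: ennreal_mult)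
  also have "\<dots> \<le> ennreal (1 / (real k + 1))"
  proof (rule ennreal_leI)
    have "real k / (real k + 1)\<^sup>2 \<le> (real k + 1) / (real k + 1)\<^sup>2"
      by (intro divide_right_mono) auto
    then show "real k * (1 / (real k + 1)\<^sup>2) \<le> 1 / (real k + 1)"
      by (simp add: power2_eq_square)
  qed
  finally show ?thesis .
qed

text \<open>Common source of the F-solutions and the F-weak solutions. Cutting the data off at index
  \<open>k\<close> makes every weighted sum finite, including those of the derivatives and of
  \<open>A (V k \<alpha>)\<close>, which the data do not control. The limit \<open>u\<close> is
  constructed beforehand as the integrated solution for the limiting data, so convergence of
  \<open>U k\<close> is the estimate for a difference of solutions.\<close>

lemma approximating_solutions:
  fixes f :: "nat \<Rightarrow> real \<Rightarrow> 'a" and u0 :: "nat \<Rightarrow> 'a"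
  assumes f: "f \<in> seq_Lp T p s h UNIV norm" and u0: "weighted_summable p s h u0" "\<And>\<alpha>. u0 \<alpha> \<in> closure D"
  obtains u U F V where "u \<in> seq_Lp T p s h UNIV norm"
    "\<forall>k. strict_solution T p s h D A (F k) (V k) (U k)"
    "\<forall>k. F k \<in> seq_Lp T p s h UNIV norm" "\<forall>k. weighted_summable p s h (V k :: nat \<Rightarrow> 'a)"
    "(\<lambda>k. seq_Lp_norm_pow T p s h norm (\<lambda>\<alpha> t. U k \<alpha> t - u \<alpha> t)) \<longlonglongrightarrow> 0"
    "(\<lambda>k. seq_Lp_norm_pow T p s h norm (\<lambda>\<alpha> t. F k \<alpha> t - f \<alpha> t)) \<longlonglongrightarrow> 0"
    "(\<lambda>k. seq_Lp_norm_pow T p s h norm (const_seq (\<lambda>\<alpha>. V k \<alpha> - u0 \<alpha>))) \<longlonglongrightarrow> 0"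
proof -
  have fLp: "f \<alpha> \<in> Lp_space T p UNIV norm" for \<alpha> using f by (simp add: seq_Lp_iff)
  have Lf: "L1 (f \<alpha>)" for \<alpha> by (rule Lp_L1[OF fLp p_ge_1])
  \<comment> \<open>The approximations of index \<open>k\<close> are supported on \<open>\<alpha> < k\<close>, where their total weighted error is at
    most \<open>k / (k + 1)\<^sup>2\<close>.\<close>
  define e where "e = (\<lambda>k \<alpha>. 1 / ((real k + 1)\<^sup>2 * W \<alpha>))"
  have e_pos: "e k \<alpha> > 0" for k \<alpha> using weight_pos[of \<alpha>] by (simp add: e_def add_nonneg_pos)
  \<comment> \<open>A triple of initial value, forcing and derivative of the forcing, bundled so
    that a single choice provides all three.\<close>
  define Q where "Q = (\<lambda>k \<alpha> z. fst z \<in> D \<and> norm (fst z - u0 \<alpha>) powr p \<le> e k \<alpha> \<and> C1 (fst (snd z)) (snd (snd z)) \<and>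
      (\<integral>\<^sup>+t. ennreal (norm (fst (snd z) t - f \<alpha> t) powr p) \<partial>MT) \<le> ennreal (e k \<alpha>) \<and> A (fst z) + fst (snd z) 0 = 0)"
  have "\<forall>k \<alpha>. \<exists>z. Q k \<alpha> z"
    using smooth_data_approx[OF u0(2) fLp e_pos] by (simp add: Q_def split_paired_Ex)
  then obtain Z where "\<forall>k \<alpha>. Q k \<alpha> (Z k \<alpha>)"
    unfolding choice_iff by (elim exE)
  then have Z: "fst (Z k \<alpha>) \<in> D" "norm (fst (Z k \<alpha>) - u0 \<alpha>) powr p \<le> e k \<alpha>" "C1 (fst (snd (Z k \<alpha>))) (snd (snd (Z k \<alpha>)))"
      "(\<integral>\<^sup>+t. ennreal (norm (fst (snd (Z k \<alpha>)) t - f \<alpha> t) powr p) \<partial>MT) \<le> ennreal (e k \<alpha>)"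
      "A (fst (Z k \<alpha>)) + fst (snd (Z k \<alpha>)) 0 = 0" for k \<alpha>
    by (auto simp: Q_def)
  define V where "V = (\<lambda>k \<alpha>. if \<alpha> < k then fst (Z k \<alpha>) else 0)"
  define F where "F = (\<lambda>k \<alpha>. if \<alpha> < k then fst (snd (Z k \<alpha>)) else (\<lambda>_. 0))"
  define F' where "F' = (\<lambda>k \<alpha>. if \<alpha> < k then snd (snd (Z k \<alpha>)) else (\<lambda>_. 0))"
  have D0: "0 \<in> D" by (rule subspace_0[OF subspace_D])
  have V_D: "V k \<alpha> \<in> D" and C1_F: "C1 (F k \<alpha>) (F' k \<alpha>)" and compat: "A (V k \<alpha>) + F k \<alpha> 0 = 0" for k \<alpha>
    using Z[of k \<alpha>] D0 by (auto simp: V_def F_def F'_def C1_def)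
  have V_u0: "norm (V k \<alpha> - u0 \<alpha>) powr p \<le> e k \<alpha>" and
    F_f: "Lp_norm_pow T p norm (\<lambda>t. F k \<alpha> t - f \<alpha> t) \<le> ennreal (e k \<alpha>)" if "\<alpha> < k" for k \<alpha>
    using Z[of k \<alpha>] that by (auto simp: V_def F_def Lp_norm_pow_def)
  have F_sob: "is_sobolev_deriv T p (F k \<alpha>) (F' k \<alpha>)" for k \<alpha> by (rule C1_sobolev_deriv[OF C1_F])
  have F_W1p: "F k \<in> seq_W1p T p s h" for k
  proof -
    have "wsum (\<lambda>\<alpha>. Lp_norm_pow T p norm (F k \<alpha>) + Lp_norm_pow T p norm (seq_deriv T p (F k) \<alpha>)) < \<infinity>"
    proof (rule wsum_finite_support)
      fix \<alpha>
      have eq: "Lp_norm_pow T p norm (seq_deriv T p (F k) \<alpha>) = Lp_norm_pow T p norm (F' k \<alpha>)"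
        unfolding seq_deriv_def by (rule Lp_norm_pow_cong_AE[OF sobolev_deriv_AE[OF F_sob p_ge_1]])
      show "Lp_norm_pow T p norm (F k \<alpha>) + Lp_norm_pow T p norm (seq_deriv T p (F k) \<alpha>) = 0" if "\<alpha> \<ge> k"
        unfolding eq using that p_ge_1 by (simp add: F_def F'_def Lp_norm_pow_def)
      show "Lp_norm_pow T p norm (F k \<alpha>) + Lp_norm_pow T p norm (seq_deriv T p (F k) \<alpha>) < \<infinity>"
        unfolding eq using F_sob[of k \<alpha>] Lp_continuous[OF C1_continuous[OF C1_F[of k \<alpha>]] p_nonneg]
        by (simp add: is_sobolev_deriv_primitive Lp_space_def)
    qed
    then show ?thesis
      using F_sob by (auto simp: seq_W1p_def W1p_space_def wsum_def)
  qed
  have ws: "weighted_summable p s h (V k)" "weighted_summable p s h (\<lambda>\<alpha>. A (V k \<alpha>))" for k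
    unfolding weighted_summable_def
    by (rule summable_finite[of "{..<k}"]; use p_ge_1 in \<open>auto simp: V_def\<close>)+
  have "\<forall>k. \<exists>U. strict_solution T p s h D A (F k) (V k) U"
  proof
    fix k
    have "A (V k \<alpha>) + F k \<alpha> 0 \<in> closure D" for \<alpha>
      unfolding compat using D0 closure_subset by blast
    then show "\<exists>U. strict_solution T p s h D A (F k) (V k) U"
      by (intro strict_solution_exists F_W1p V_D ws)
  qed
  then obtain U where U: "\<And>k. strict_solution T p s h D A (F k) (V k) (U k)" by metis
  have "\<forall>\<alpha>. \<exists>u. mild_solution (u0 \<alpha>) (primitive (f \<alpha>)) u"
    using mild_L1_exists_bound[OF u0(2) Lf] by blast
  then obtain u where u: "\<And>\<alpha>. mild_solution (u0 \<alpha>) (primitive (f \<alpha>)) (u \<alpha>)" by metis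
  define c where "c = ennreal (T * (2 * K2) powr p * (T + 1) powr p)"
  have uLp: "u \<alpha> \<in> Lp_space T p UNIV norm" for \<alpha>
    by (rule Lp_continuous[OF mild_continuous[OF u] p_nonneg])
  have u_Lp: "u \<in> seq_Lp T p s h UNIV norm"
  proof -
    have "wsum (\<lambda>\<alpha>. Lp_norm_pow T p norm (u \<alpha>)) < \<infinity>"
    proof (rule wsum_le_cmult)
      show "Lp_norm_pow T p norm (u \<alpha>) \<le> c * (ennreal (norm (u0 \<alpha>) powr p) + Lp_norm_pow T p norm (f \<alpha>))" for \<alpha>
        unfolding c_def by (rule mild_Lp_bound[OF u fLp])
      show "wsum (\<lambda>\<alpha>. ennreal (norm (u0 \<alpha>) powr p) + Lp_norm_pow T p norm (f \<alpha>)) < \<infinity>"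
        using u0(1) f by (simp add: wsum_add weighted_summable_iff wfin_def seq_Lp_iff)
    qed (simp add: c_def)
    then show ?thesis using uLp by (simp add: seq_Lp_iff)
  qed
  have F_Lp: "F k \<in> seq_Lp T p s h UNIV norm" for k by (rule seq_W1p_D(1)[OF F_W1p])
  have small: "(\<lambda>k. ennreal (1 / (real k + 1))) \<longlonglongrightarrow> 0"
  proof -
    have "(\<lambda>k. 1 / (real k + 1)) \<longlonglongrightarrow> 0" by real_asymp
    then have "(\<lambda>k. ennreal (1 / (real k + 1))) \<longlonglongrightarrow> ennreal 0" by (rule tendsto_ennrealI)
    then show ?thesis by simp
  qed
  \<comment> \<open>The error splits into the part below \<open>k\<close>, small by the choice of
    \<open>e\<close>, and the tail of the fixed sequence \<open>Y\<close>, which stems from the data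
    because the approximants vanish there.\<close>
  have key: "(\<lambda>k. wsum (X k)) \<longlonglongrightarrow> 0" if X: "\<And>k \<alpha>. \<alpha> < k \<Longrightarrow> X k \<alpha> \<le> ennreal (e k \<alpha>)" "\<And>k \<alpha>. \<alpha> \<ge> k \<Longrightarrow> X k \<alpha> = Y \<alpha>"
    and Y: "wsum Y < \<infinity>" for X Y
  proof (rule tendsto_sandwich[OF _ _ tendsto_const])
    show "(\<lambda>k. ennreal (1 / (real k + 1)) + wsum (\<lambda>\<alpha>. if \<alpha> < k then 0 else Y \<alpha>)) \<longlonglongrightarrow> 0"
      using tendsto_add[OF small wsum_tail_tendsto[OF Y]] by simp
    show "\<forall>\<^sub>F k in sequentially. wsum (X k) \<le> ennreal (1 / (real k + 1)) + wsum (\<lambda>\<alpha>. if \<alpha> < k then 0 else Y \<alpha>)"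
    proof (intro always_eventually allI)
      fix k
      have "wsum (X k) = wsum (\<lambda>\<alpha>. (if \<alpha> < k then X k \<alpha> else 0) + (if \<alpha> < k then 0 else Y \<alpha>))"
        using X(2) by (intro arg_cong[where f=wsum] ext) auto
      also have "\<dots> = wsum (\<lambda>\<alpha>. if \<alpha> < k then X k \<alpha> else 0) + wsum (\<lambda>\<alpha>. if \<alpha> < k then 0 else Y \<alpha>)"
        by (rule wsum_add)
      also have "wsum (\<lambda>\<alpha>. if \<alpha> < k then X k \<alpha> else 0) \<le> ennreal (1 / (real k + 1))"
        using X(1) by (intro wsum_finite_part) (auto simp: e_def)
      finally show "wsum (X k) \<le> ennreal (1 / (real k + 1)) + wsum (\<lambda>\<alpha>. if \<alpha> < k then 0 else Y \<alpha>)"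
        by (simp add: add_right_mono)
    qed
  qed simp
  have limV: "(\<lambda>k. wsum (\<lambda>\<alpha>. ennreal (norm (V k \<alpha> - u0 \<alpha>) powr p))) \<longlonglongrightarrow> 0"
  proof (rule key)
    show "ennreal (norm (V k \<alpha> - u0 \<alpha>) powr p) \<le> ennreal (e k \<alpha>)" if "\<alpha> < k" for k \<alpha>
      using V_u0[OF that] by (rule ennreal_leI)
    show "ennreal (norm (V k \<alpha> - u0 \<alpha>) powr p) = ennreal (norm (u0 \<alpha>) powr p)" if "\<alpha> \<ge> k" for k \<alpha>
      using that by (simp add: V_def)
    show "wsum (\<lambda>\<alpha>. ennreal (norm (u0 \<alpha>) powr p)) < \<infinity>"
      using u0(1) by (simp add: weighted_summable_iff wfin_def)
  qed
  have limF: "(\<lambda>k. wsum (\<lambda>\<alpha>. Lp_norm_pow T p norm (\<lambda>t. F k \<alpha> t - f \<alpha> t))) \<longlonglongrightarrow> 0"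
  proof (rule key)
    show "Lp_norm_pow T p norm (\<lambda>t. F k \<alpha> t - f \<alpha> t) \<le> ennreal (e k \<alpha>)" if "\<alpha> < k" for k \<alpha>
      using that by (rule F_f)
    show "Lp_norm_pow T p norm (\<lambda>t. F k \<alpha> t - f \<alpha> t) = Lp_norm_pow T p norm (f \<alpha>)" if "\<alpha> \<ge> k" for k \<alpha>
      using that by (simp add: F_def Lp_norm_pow_def)
    show "wsum (\<lambda>\<alpha>. Lp_norm_pow T p norm (f \<alpha>)) < \<infinity>"
      using f by (simp add: seq_Lp_iff)
  qed
  have limU: "(\<lambda>k. wsum (\<lambda>\<alpha>. Lp_norm_pow T p norm (\<lambda>t. U k \<alpha> t - u \<alpha> t))) \<longlonglongrightarrow> 0"
  proof (rule tendsto_sandwich[OF _ _ tendsto_const])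
    have "(\<lambda>k. c * (wsum (\<lambda>\<alpha>. ennreal (norm (V k \<alpha> - u0 \<alpha>) powr p)) + wsum (\<lambda>\<alpha>. Lp_norm_pow T p norm (\<lambda>t. F k \<alpha> t - f \<alpha> t)))) \<longlonglongrightarrow> c * (0 + 0)"
      unfolding c_def by (intro ennreal_tendsto_cmult tendsto_add limV limF) auto
    then show "(\<lambda>k. c * (wsum (\<lambda>\<alpha>. ennreal (norm (V k \<alpha> - u0 \<alpha>) powr p)) + wsum (\<lambda>\<alpha>. Lp_norm_pow T p norm (\<lambda>t. F k \<alpha> t - f \<alpha> t)))) \<longlonglongrightarrow> 0"
      by simp
    show "\<forall>\<^sub>F k in sequentially. wsum (\<lambda>\<alpha>. Lp_norm_pow T p norm (\<lambda>t. U k \<alpha> t - u \<alpha> t)) \<le>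
       c * (wsum (\<lambda>\<alpha>. ennreal (norm (V k \<alpha> - u0 \<alpha>) powr p)) + wsum (\<lambda>\<alpha>. Lp_norm_pow T p norm (\<lambda>t. F k \<alpha> t - f \<alpha> t)))"
    proof (intro always_eventually allI)
      fix k
      have FfLp: "(\<lambda>t. F k \<alpha> t - f \<alpha> t) \<in> Lp_space T p UNIV norm" for \<alpha>
        using seq_Lp_diff[OF F_Lp f, of k] by (simp add: seq_Lp_iff)
      have LF: "L1 (F k \<alpha>)" for \<alpha> by (rule L1_continuous[OF C1_continuous[OF C1_F]])
      have "mild_solution (V k \<alpha> - u0 \<alpha>) (primitive (\<lambda>t. F k \<alpha> t - f \<alpha> t)) (\<lambda>t. U k \<alpha> t - u \<alpha> t)" for \<alpha>
        by (rule mild_L1_diff[OF strict_solution_mild[OF U LF] u LF Lf])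
      from mild_Lp_bound[OF this FfLp]
      have "wsum (\<lambda>\<alpha>. Lp_norm_pow T p norm (\<lambda>t. U k \<alpha> t - u \<alpha> t)) \<le>
          wsum (\<lambda>\<alpha>. c * (ennreal (norm (V k \<alpha> - u0 \<alpha>) powr p) + Lp_norm_pow T p norm (\<lambda>t. F k \<alpha> t - f \<alpha> t)))"
        unfolding c_def by (intro wsum_mono)
      then show "wsum (\<lambda>\<alpha>. Lp_norm_pow T p norm (\<lambda>t. U k \<alpha> t - u \<alpha> t)) \<le>
         c * (wsum (\<lambda>\<alpha>. ennreal (norm (V k \<alpha> - u0 \<alpha>) powr p)) + wsum (\<lambda>\<alpha>. Lp_norm_pow T p norm (\<lambda>t. F k \<alpha> t - f \<alpha> t)))"
        by (simp add: wsum_cmult wsum_add)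
    qed
  qed simp
  have limV': "(\<lambda>k. seq_Lp_norm_pow T p s h norm (const_seq (\<lambda>\<alpha>. V k \<alpha> - u0 \<alpha>))) \<longlonglongrightarrow> 0"
    using ennreal_tendsto_cmult[OF _ limV, of "ennreal T"]
    by (simp add: seq_Lp_norm_pow_wsum const_seq_def Lp_norm_pow_const wsum_cmult)
  show thesis
  proof (rule that[OF u_Lp, of F V U])
    show "\<forall>k. strict_solution T p s h D A (F k) (V k) (U k)" using U by blast
    show "\<forall>k. F k \<in> seq_Lp T p s h UNIV norm" using F_Lp by blast
    show "\<forall>k. weighted_summable p s h (V k)" using ws(1) by blast
  qed (use limU limF limV' in \<open>simp_all add: seq_Lp_norm_pow_wsum\<close>)
qed

section \<open>Existence and uniqueness of F-solutions, uniqueness of strict solutions\<close>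

lemma weighted_summable_diff:
  fixes v v' :: "nat \<Rightarrow> 'b::real_normed_vector"
  assumes "weighted_summable p s h v" "weighted_summable p s h v'"
  shows "weighted_summable p s h (\<lambda>\<alpha>. v \<alpha> - v' \<alpha>)"
  using assms unfolding weighted_summable_iff
  by (rule wfin_mono[OF wfin_add[of "\<lambda>\<alpha>. norm (v \<alpha>)" "\<lambda>\<alpha>. norm (v' \<alpha>)"]]) (auto intro: norm_triangle_ineq4)

lemma F_solution_exists:
  assumes f: "f \<in> seq_Lp T p s h UNIV norm" and u0: "weighted_summable p s h u0" "\<And>\<alpha>. u0 \<alpha> \<in> closure D"
  shows "\<exists>u. F_solution T p s h D A f u0 u"
proof -
  obtain u U F V where *: "u \<in> seq_Lp T p s h UNIV norm"
    "\<forall>k. strict_solution T p s h D A (F k) (V k) (U k)"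
    "\<forall>k. F k \<in> seq_Lp T p s h UNIV norm" "\<forall>k. weighted_summable p s h (V k)"
    "(\<lambda>k. seq_Lp_norm_pow T p s h norm (\<lambda>\<alpha> t. U k \<alpha> t - u \<alpha> t)) \<longlonglongrightarrow> 0"
    "(\<lambda>k. seq_Lp_norm_pow T p s h norm (\<lambda>\<alpha> t. F k \<alpha> t - f \<alpha> t)) \<longlonglongrightarrow> 0"
    "(\<lambda>k. seq_Lp_norm_pow T p s h norm (const_seq (\<lambda>\<alpha>. V k \<alpha> - u0 \<alpha>))) \<longlonglongrightarrow> 0"
    by (rule approximating_solutions[OF assms])
  have "F_solution T p s h D A f u0 u"
    unfolding F_solution_def
  proof (rule conjI[OF *(1)], rule exI[of _ U], rule exI[of _ F], rule exI[of _ V], intro conjI allI seq_Lp_norm_tendsto *(5-))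
    show "U k \<in> regular_seqs T p s h D A" "U k \<alpha> 0 = V k \<alpha>" "equation_ae T p A (F k) (U k)" for k \<alpha>
      using *(2) by (auto simp: strict_solution_def)
    show "F k \<in> seq_Lp T p s h UNIV norm" "weighted_summable p s h (V k)" for k
      using *(3,4) by auto
  qed
  then show ?thesis by blast
qed

text \<open>Two F-solutions may come with different approximating sequences. For each index the
  approximants are integrated solutions, so their differences are controlled by the differences of
  their data, which tend to 0 because both sets of data have the same limits.\<close>

lemma F_solution_unique:
  assumes f: "f \<in> seq_Lp T p s h UNIV norm" and u0: "weighted_summable p s h u0"
    and u: "F_solution T p s h D A f u0 u" and v: "F_solution T p s h D A f u0 v"
  shows "AE t in MT. u \<alpha> t = v \<alpha> t"
proof -
  \<comment> \<open>Reduction to the single index \<open>\<alpha>\<close>: convergence in the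
    sequence norms is replaced by convergence of the entries, and strict solutions by integrated
    ones.\<close>
  have sol: "\<exists>U F V. (\<forall>k. mild_solution (V k) (primitive (F k)) (U k) \<and> F k \<in> Lp_space T p UNIV norm \<and> smeas (U k)) \<and>
      (\<lambda>k. Lp_norm_pow T p norm (\<lambda>t. U k t - u \<alpha> t)) \<longlonglongrightarrow> 0 \<and>
      (\<lambda>k. Lp_norm_pow T p norm (\<lambda>t. F k t - f \<alpha> t)) \<longlonglongrightarrow> 0 \<and> (\<lambda>k. ennreal (norm (V k - u0 \<alpha>) powr p)) \<longlonglongrightarrow> 0"
    if F: "F_solution T p s h D A f u0 u" for u
  proof -
    obtain U F V where **: "(\<forall>k. U k \<in> regular_seqs T p s h D A \<and> F k \<in> seq_Lp T p s h UNIV norm \<and> weighted_summable p s h (V k) \<and>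
             (\<forall>\<alpha>. U k \<alpha> 0 = V k \<alpha>) \<and> equation_ae T p A (F k) (U k)) \<and>
      (\<lambda>k. seq_Lp_norm T p s h norm (\<lambda>\<alpha> t. U k \<alpha> t - u \<alpha> t)) \<longlonglongrightarrow> 0 \<and>
      (\<lambda>k. seq_Lp_norm T p s h norm (\<lambda>\<alpha> t. F k \<alpha> t - f \<alpha> t)) \<longlonglongrightarrow> 0 \<and>
      (\<lambda>k. seq_Lp_norm T p s h norm (const_seq (\<lambda>\<alpha>. V k \<alpha> - u0 \<alpha>))) \<longlonglongrightarrow> 0"
      using F[unfolded F_solution_def, THEN conjunct2] by (elim exE)
    note * = F[unfolded F_solution_def, THEN conjunct1] **[THEN conjunct1] **[THEN conjunct2, THEN conjunct1]
      **[THEN conjunct2, THEN conjunct2, THEN conjunct1] **[THEN conjunct2, THEN conjunct2, THEN conjunct2]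
    have strict: "strict_solution T p s h D A (F k) (V k) (U k)" for k
      using *(2) by (simp add: strict_solution_def)
    have U: "U k \<in> seq_Lp T p s h UNIV norm" and F: "F k \<in> seq_Lp T p s h UNIV norm" for k
      using *(2) seq_W1p_D(1) by (auto simp: regular_seqs_def)
    have V: "weighted_summable p s h (V k)" for k using *(2) by simp
    have fin: "seq_Lp_norm_pow T p s h norm g < \<infinity>" if "g \<in> seq_Lp T p s h UNIV norm" for g :: "nat \<Rightarrow> real \<Rightarrow> 'a"
      using that by (simp add: seq_Lp_def)
    have FLp: "F k \<alpha> \<in> Lp_space T p UNIV norm" for k using F by (simp add: seq_Lp_iff)
    have limU: "(\<lambda>k. Lp_norm_pow T p norm (\<lambda>t. U k \<alpha> t - u \<alpha> t)) \<longlonglongrightarrow> 0"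
      using seq_Lp_norm_tendsto_component[OF *(3) fin[OF seq_Lp_diff[OF U *(1)]]] .
    have limF: "(\<lambda>k. Lp_norm_pow T p norm (\<lambda>t. F k \<alpha> t - f \<alpha> t)) \<longlonglongrightarrow> 0"
      using seq_Lp_norm_tendsto_component[OF *(4) fin[OF seq_Lp_diff[OF F f]]] .
    have "(\<lambda>k. Lp_norm_pow T p norm (const_seq (\<lambda>\<alpha>. V k \<alpha> - u0 \<alpha>) \<alpha>)) \<longlonglongrightarrow> 0"
      using seq_Lp_norm_tendsto_component[OF *(5) fin[OF const_seq_in_seq_Lp[OF weighted_summable_diff[OF V u0]]]] .
    then have "(\<lambda>k. ennreal T * ennreal (norm (V k \<alpha> - u0 \<alpha>) powr p)) \<longlonglongrightarrow> 0"
      by (simp add: const_seq_def Lp_norm_pow_const)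
    from ennreal_tendsto_cmult[OF _ this, of "ennreal (1 / T)"]
    have limV: "(\<lambda>k. ennreal (norm (V k \<alpha> - u0 \<alpha>) powr p)) \<longlonglongrightarrow> 0"
      using T_pos by (simp add: mult.assoc[symmetric] flip: ennreal_mult)
    have "mild_solution (V k \<alpha>) (primitive (F k \<alpha>)) (U k \<alpha>)" for k
      by (rule strict_solution_mild[OF strict Lp_L1[OF FLp p_ge_1]])
    moreover have "smeas (U k \<alpha>)" for k
      using U[of k] by (simp add: seq_Lp_iff Lp_space_iff)
    ultimately show ?thesis
      using FLp limU limF limV by (intro exI[of _ "\<lambda>k. U k \<alpha>"] exI[of _ "\<lambda>k. F k \<alpha>"] exI[of _ "\<lambda>k. V k \<alpha>"]) simp
  qed
  obtain U F V where *: "(\<forall>k. mild_solution (V k) (primitive (F k)) (U k) \<and> F k \<in> Lp_space T p UNIV norm \<and> smeas (U k)) \<and>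
      (\<lambda>k. Lp_norm_pow T p norm (\<lambda>t. U k t - u \<alpha> t)) \<longlonglongrightarrow> 0 \<and>
      (\<lambda>k. Lp_norm_pow T p norm (\<lambda>t. F k t - f \<alpha> t)) \<longlonglongrightarrow> 0 \<and> (\<lambda>k. ennreal (norm (V k - u0 \<alpha>) powr p)) \<longlonglongrightarrow> 0"
    using sol[OF u] by (elim exE)
  note U0 = *[THEN conjunct1] *[THEN conjunct2, THEN conjunct1]
      *[THEN conjunct2, THEN conjunct2, THEN conjunct1] *[THEN conjunct2, THEN conjunct2, THEN conjunct2]
  have U: "mild_solution (V k) (primitive (F k)) (U k)" "F k \<in> Lp_space T p UNIV norm" "smeas (U k)" for k
    using U0(1) by auto
  obtain U' F' V' where *: "(\<forall>k. mild_solution (V' k) (primitive (F' k)) (U' k) \<and> F' k \<in> Lp_space T p UNIV norm \<and> smeas (U' k)) \<and>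
      (\<lambda>k. Lp_norm_pow T p norm (\<lambda>t. U' k t - v \<alpha> t)) \<longlonglongrightarrow> 0 \<and>
      (\<lambda>k. Lp_norm_pow T p norm (\<lambda>t. F' k t - f \<alpha> t)) \<longlonglongrightarrow> 0 \<and> (\<lambda>k. ennreal (norm (V' k - u0 \<alpha>) powr p)) \<longlonglongrightarrow> 0"
    using sol[OF v] by (elim exE)
  note U0' = *[THEN conjunct1] *[THEN conjunct2, THEN conjunct1]
      *[THEN conjunct2, THEN conjunct2, THEN conjunct1] *[THEN conjunct2, THEN conjunct2, THEN conjunct2]
  have U': "mild_solution (V' k) (primitive (F' k)) (U' k)" "F' k \<in> Lp_space T p UNIV norm" "smeas (U' k)" for k
    using U0'(1) by auto
  have su: "smeas (u \<alpha>)" "smeas (v \<alpha>)" "smeas (f \<alpha>)"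
    using u v f by (auto simp: F_solution_def seq_Lp_iff Lp_space_iff)
  have sF: "smeas (F k)" "smeas (F' k)" for k using U(2) U'(2) by (auto simp: Lp_space_iff)
  have LF: "L1 (F k)" "L1 (F' k)" for k using U(2) U'(2) p_ge_1 by (auto intro: Lp_L1)
  \<comment> \<open>The constant of the triangle inequality for \<open>p\<close>-th powers, not the
    conjugate exponent. It is nested below because the path from \<open>u\<close> to
    \<open>v\<close> passes through both \<open>U k\<close> and \<open>U' k\<close>.\<close>
  define q where "q = ennreal (2 powr p)"
  define c where "c = ennreal (T * (2 * K2) powr p * (T + 1) powr p)"
  let ?N = "Lp_norm_pow T p norm"
  have tri: "?N (\<lambda>t. a t - b t) \<le> q * (?N (\<lambda>t. a t - d t) + ?N (\<lambda>t. b t - d t))" if "smeas a" "smeas b" "smeas d" for a b d :: "real \<Rightarrow> 'a"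
    unfolding Lp_norm_pow_def q_def
  proof (intro nn_integral_powr_triangle smeas_diff that p_nonneg)
    show "norm (a t - b t) \<le> norm (a t - d t) + norm (b t - d t)" for t
      using norm_triangle_ineq4[of "a t - d t" "b t - d t"] by simp
  qed
  have UU: "?N (\<lambda>t. U k t - U' k t) \<le> c * (q * (ennreal (norm (V k - u0 \<alpha>) powr p) + ennreal (norm (V' k - u0 \<alpha>) powr p)) +
      q * (?N (\<lambda>t. F k t - f \<alpha> t) + ?N (\<lambda>t. F' k t - f \<alpha> t)))" for k
  proof -
    have FF: "?N (\<lambda>t. F k t - F' k t) \<le> q * (?N (\<lambda>t. F k t - f \<alpha> t) + ?N (\<lambda>t. F' k t - f \<alpha> t))"
      by (rule tri[OF sF su(3)])
    have FLp: "(\<lambda>t. F k t - F' k t) \<in> Lp_space T p UNIV norm"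
    proof -
      have "?N (\<lambda>t. F k t - F' k t) \<le> q * (?N (F k) + ?N (F' k))"
        using tri[OF sF smeas_const[of 0], of k k] by simp
      also have "\<dots> < \<infinity>" using U(2)[of k] U'(2)[of k] by (simp add: Lp_space_def q_def ennreal_mult_less_top)
      finally show ?thesis using smeas_diff[OF sF] by (simp add: Lp_space_def)
    qed
    have "ennreal (norm (V k - V' k) powr p) \<le> q * (ennreal (norm (V k - u0 \<alpha>) powr p) + ennreal (norm (V' k - u0 \<alpha>) powr p))"
    proof -
      have "norm (V k - V' k) powr p \<le> (norm (V k - u0 \<alpha>) + norm (V' k - u0 \<alpha>)) powr p"
        using norm_triangle_ineq4[of "V k - u0 \<alpha>" "V' k - u0 \<alpha>"] p_nonneg by (intro powr_mono2) auto
      also have "\<dots> \<le> 2 powr p * (norm (V k - u0 \<alpha>) powr p + norm (V' k - u0 \<alpha>) powr p)"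
        using p_nonneg by (intro powr_add_le) auto
      finally show ?thesis by (simp add: q_def ennreal_leI flip: ennreal_plus ennreal_mult)
    qed
    then show ?thesis
      using mild_Lp_bound[OF mild_L1_diff[OF U(1) U'(1) LF] FLp] FF unfolding c_def
      by (meson add_mono mult_left_mono order_trans zero_le)
  qed
  have "?N (\<lambda>t. u \<alpha> t - v \<alpha> t) \<le> q * (?N (\<lambda>t. U k t - u \<alpha> t) + q * (?N (\<lambda>t. U k t - U' k t) + ?N (\<lambda>t. U' k t - v \<alpha> t)))" for k
  proof -
    have sym: "?N (\<lambda>t. a t - b t) = ?N (\<lambda>t. b t - a t)" for a b :: "real \<Rightarrow> 'a"
      by (simp add: Lp_norm_pow_def norm_minus_commute)
    have "?N (\<lambda>t. u \<alpha> t - v \<alpha> t) \<le> q * (?N (\<lambda>t. u \<alpha> t - U k t) + ?N (\<lambda>t. v \<alpha> t - U k t))"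
      by (rule tri[OF su(1,2) U(3)])
    also have "?N (\<lambda>t. v \<alpha> t - U k t) \<le> q * (?N (\<lambda>t. v \<alpha> t - U' k t) + ?N (\<lambda>t. U k t - U' k t))"
      by (rule tri[OF su(2) U(3) U'(3)])
    finally show ?thesis
      unfolding sym[of "u \<alpha>"] sym[of "v \<alpha>" "U' k"] by (simp add: add.commute add_left_mono mult_left_mono)
  qed
  then have "?N (\<lambda>t. u \<alpha> t - v \<alpha> t) \<le> q * (?N (\<lambda>t. U k t - u \<alpha> t) + q * (c * (q * (ennreal (norm (V k - u0 \<alpha>) powr p) + ennreal (norm (V' k - u0 \<alpha>) powr p)) +
      q * (?N (\<lambda>t. F k t - f \<alpha> t) + ?N (\<lambda>t. F' k t - f \<alpha> t))) + ?N (\<lambda>t. U' k t - v \<alpha> t)))" for k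
    using UU by (meson add_mono mult_left_mono order_refl order_trans zero_le)
  moreover have "(\<lambda>k. q * (?N (\<lambda>t. U k t - u \<alpha> t) + q * (c * (q * (ennreal (norm (V k - u0 \<alpha>) powr p) + ennreal (norm (V' k - u0 \<alpha>) powr p)) +
      q * (?N (\<lambda>t. F k t - f \<alpha> t) + ?N (\<lambda>t. F' k t - f \<alpha> t))) + ?N (\<lambda>t. U' k t - v \<alpha> t)))) \<longlonglongrightarrow>
      q * (0 + q * (c * (q * (0 + 0) + q * (0 + 0)) + 0))"
    unfolding q_def c_def by (intro ennreal_tendsto_cmult tendsto_add U0(2-) U0'(2-)) auto
  ultimately have "?N (\<lambda>t. u \<alpha> t - v \<alpha> t) \<le> q * (0 + q * (c * (q * (0 + 0) + q * (0 + 0)) + 0))"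
    by (intro LIMSEQ_le_const) blast+
  then have "(\<integral>\<^sup>+t. ennreal (norm (u \<alpha> t - v \<alpha> t) powr p) \<partial>MT) = 0" by (simp add: Lp_norm_pow_def)
  then have "AE t in MT. ennreal (norm (u \<alpha> t - v \<alpha> t) powr p) = 0"
    by (subst (asm) nn_integral_0_iff_AE[OF smeas_ennreal_norm_powr[OF smeas_diff[OF su(1,2)]]])
  then show ?thesis by eventually_elim simp
qed

text \<open>Equality holds at every time, not just almost everywhere, because strict solutions solve
  the integrated equation, whose solutions are compared pointwise.\<close>

lemma strict_solution_unique:
  assumes f: "f \<in> seq_W1p T p s h" and u: "strict_solution T p s h D A f u0 u" and v: "strict_solution T p s h D A f u0 v"
    and t: "t \<in> {0..T}"
  shows "u \<alpha> t = v \<alpha> t"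
proof -
  have "L1 (f \<alpha>)"
    using seq_W1p_D(1)[OF f] p_ge_1 by (auto simp: seq_Lp_iff intro: Lp_L1)
  then show ?thesis
    by (intro mild_unique[OF strict_solution_mild[OF u] strict_solution_mild[OF v] t])
qed

end

section \<open>Test functions and weak solutions\<close>

locale hy_dual_problem = hy_problem D A R w C T p s h
  for D :: "'a::banach set" and A :: "'a \<Rightarrow> 'a" and R w C T p s h +
  fixes q :: ennreal
  assumes conjugate: "1 / ennreal p + 1 / q = 1"
begin

lemma q_eq_top: "p = 1 \<Longrightarrow> q = \<infinity>"
proof -
  assume "p = 1"
  then have "1 + 1 / q = 1 + 0" using conjugate by simp
  then have "1 / q = 0" by (subst (asm) ennreal_add_left_cancel) auto
  then show "q = \<infinity>" by (simp add: ennreal_divide_eq_0_iff)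
qed

lemma q_real:
  assumes "p > 1"
  shows "q \<noteq> \<infinity>" "enn2real q > 1" "1 / p + 1 / enn2real q = 1"
proof -
  have ip: "1 / ennreal p = ennreal (1 / p)"
    using assms by (simp add: divide_ennreal flip: ennreal_1)
  show "q \<noteq> \<infinity>"
  proof
    assume "q = \<infinity>"
    then have "ennreal (1 / p) = ennreal 1" using conjugate ip by simp
    then show False using assms by (subst (asm) ennreal_inj) auto
  qed
  then obtain r where r: "q = ennreal r" "r \<ge> 0" by (cases q) auto
  \<comment> \<open>In \<open>ennreal\<close> the quotient \<open>1 / 0\<close> is infinite and
    cannot be part of a sum equal to 1.\<close>
  have "r \<noteq> 0"
  proof
    assume "r = 0"
    then show False using conjugate r by (simp add: ennreal_divide_eq_top_iff ip divide_ennreal_def)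
  qed
  then have r0: "r > 0" using r by simp
  have "ennreal (1 / p) + ennreal (1 / r) = ennreal 1"
    using conjugate r0 r(1) ip by (simp add: divide_ennreal flip: ennreal_1)
  then have "ennreal (1 / p + 1 / r) = ennreal 1"
    using assms r0 by (simp add: ennreal_plus)
  then have *: "1 / p + 1 / r = 1"
    using assms r0 by (subst (asm) ennreal_inj) auto
  then show "1 / p + 1 / enn2real q = 1" using r by simp
  have "1 / r < 1" using * assms by (smt (verit) zero_less_divide_1_iff)
  then show "enn2real q > 1" using r r0 by simp
qed

section \<open>Continuity of the pairing with a test function\<close>

lemma test_function_measurable:
  assumes "\<phi> \<in> test_functions T q s h"
  shows "(deriv ^^ \<alpha>) \<phi> \<in> borel_measurable MT"
proof -
  have "continuous_on {0<..<T} ((deriv ^^ \<alpha>) \<phi>)"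
    using assms by (intro differentiable_imp_continuous_on differentiable_at_imp_differentiable_on) (auto simp: test_functions_def)
  then show ?thesis
    by (rule continuous_imp_measurable_on_sets_lebesgue) simp
qed

lemma smeas_test_scaleR:
  "\<phi> \<in> test_functions T q s h \<Longrightarrow> smeas F \<Longrightarrow> smeas (\<lambda>t. (deriv ^^ \<alpha>) \<phi> t *\<^sub>R F t)"
  by (intro smeas_scaleR test_function_measurable)

text \<open>For \<open>p = 1\<close> the weight in the norm of the test functions is the reciprocal
  of \<open>W\<close>. The essential supremum of the derivative of order \<open>\<alpha>\<close> is
  therefore at most \<open>c * W \<alpha>\<close>, which is the weight in the sequence norm, and no
  additive error arises.\<close>

lemma pairing_bound_1:
  assumes \<phi>: "\<phi> \<in> test_functions T q s h" and p: "p = 1"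
  shows "\<exists>c. \<forall>g. (\<forall>\<alpha>. smeas (g \<alpha>)) \<longrightarrow>
    (\<Sum>\<alpha>. \<integral>\<^sup>+t. ennreal (norm ((deriv ^^ \<alpha>) \<phi> t *\<^sub>R g \<alpha> t)) \<partial>MT) \<le> ennreal c * seq_Lp_norm_pow T p s h norm (g :: nat \<Rightarrow> real \<Rightarrow> 'b::real_normed_vector)"
proof -
  define S where "S = (\<lambda>\<alpha>. esssup MT (\<lambda>t. ennreal \<bar>(deriv ^^ \<alpha>) \<phi> t\<bar>))"
  define M where "M = (SUP \<alpha>. ennreal (h ^ \<alpha> / fact \<alpha> powr s) * S \<alpha>)"
  have "M < \<infinity>" using \<phi> q_eq_top[OF p] by (simp add: test_functions_def M_def S_def)
  then obtain c where c: "M = ennreal c" by (cases M) auto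
  have W: "ennreal (W \<alpha>) * ennreal (h ^ \<alpha> / fact \<alpha> powr s) = 1" for \<alpha>
    using h_pos by (simp add: weight_def p powr_realpow flip: ennreal_mult)
  have SW: "S \<alpha> \<le> ennreal (W \<alpha>) * ennreal c" for \<alpha>
  proof -
    have "S \<alpha> = ennreal (W \<alpha>) * (ennreal (h ^ \<alpha> / fact \<alpha> powr s) * S \<alpha>)"
      by (simp only: mult.assoc[symmetric] W mult_1)
    also have "\<dots> \<le> ennreal (W \<alpha>) * M"
      unfolding M_def by (intro mult_left_mono SUP_upper) auto
    finally show ?thesis by (simp add: c)
  qed
  show ?thesis
  proof (intro exI[of _ c] allI impI)
    fix g :: "nat \<Rightarrow> real \<Rightarrow> 'b" assume g: "\<forall>\<alpha>. smeas (g \<alpha>)"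
    have "(\<integral>\<^sup>+t. ennreal (norm ((deriv ^^ \<alpha>) \<phi> t *\<^sub>R g \<alpha> t)) \<partial>MT) \<le> ennreal (W \<alpha>) * ennreal c * Lp_norm_pow T p norm (g \<alpha>)" for \<alpha>
    proof -
      have "AE t in MT. ennreal \<bar>(deriv ^^ \<alpha>) \<phi> t\<bar> \<le> S \<alpha>"
        unfolding S_def by (rule esssup_AE)
      then have "(\<integral>\<^sup>+t. ennreal (norm ((deriv ^^ \<alpha>) \<phi> t *\<^sub>R g \<alpha> t)) \<partial>MT) \<le> (\<integral>\<^sup>+t. (ennreal (W \<alpha>) * ennreal c) * ennreal (norm (g \<alpha> t)) \<partial>MT)"
      proof (intro nn_integral_mono_AE, eventually_elim)
        case (elim t)
        have "ennreal \<bar>(deriv ^^ \<alpha>) \<phi> t\<bar> \<le> ennreal (W \<alpha>) * ennreal c"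
          by (intro order_trans[OF elim(2) SW])
        then show ?case by (simp add: ennreal_mult mult_right_mono)
      qed
      also have "\<dots> = ennreal (W \<alpha>) * ennreal c * Lp_norm_pow T p norm (g \<alpha>)"
        unfolding Lp_norm_pow_def p
        by (subst nn_integral_cmult[OF smeas_ennreal_norm[OF g[rule_format]]]) simp
      finally show ?thesis .
    qed
    then have "(\<Sum>\<alpha>. \<integral>\<^sup>+t. ennreal (norm ((deriv ^^ \<alpha>) \<phi> t *\<^sub>R g \<alpha> t)) \<partial>MT) \<le> (\<Sum>\<alpha>. ennreal (W \<alpha>) * ennreal c * Lp_norm_pow T p norm (g \<alpha>))"
      by (intro suminf_le summableI)
    also have "\<dots> = wsum (\<lambda>\<alpha>. ennreal c * Lp_norm_pow T p norm (g \<alpha>))"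
      by (simp add: wsum_def mult.assoc)
    also have "\<dots> = ennreal c * seq_Lp_norm_pow T p s h norm g"
      by (simp only: wsum_cmult seq_Lp_norm_pow_wsum)
    finally show "(\<Sum>\<alpha>. \<integral>\<^sup>+t. ennreal (norm ((deriv ^^ \<alpha>) \<phi> t *\<^sub>R g \<alpha> t)) \<partial>MT) \<le> ennreal c * seq_Lp_norm_pow T p s h norm g" .
  qed
qed

text \<open>
  Young's inequality with a free parameter; the additive error makes the estimate usable for
  limits as well, so that Hoelder's inequality is not needed.
\<close>

lemma pairing_bound_gt_1:
  assumes \<phi>: "\<phi> \<in> test_functions T q s h" and p: "p > 1" and e: "e > 0"
  shows "\<exists>c. \<forall>g. (\<forall>\<alpha>. smeas (g \<alpha>)) \<longrightarrow>
    (\<Sum>\<alpha>. \<integral>\<^sup>+t. ennreal (norm ((deriv ^^ \<alpha>) \<phi> t *\<^sub>R g \<alpha> t)) \<partial>MT) \<le> ennreal c * seq_Lp_norm_pow T p s h norm (g :: nat \<Rightarrow> real \<Rightarrow> 'b::real_normed_vector) + ennreal e"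
proof -
  define r where "r = enn2real q"
  have r: "r > 1" "1 / p + 1 / r = 1" using q_real[OF p] by (auto simp: r_def)
  define w' where "w' = (\<lambda>\<alpha>. h powr (r * real \<alpha>) / fact \<alpha> powr (r * s))"
  define I where "I = (\<lambda>\<alpha>. \<integral>\<^sup>+t. ennreal (\<bar>(deriv ^^ \<alpha>) \<phi> t\<bar> powr r) \<partial>MT)"
  have "(\<Sum>\<alpha>. ennreal (w' \<alpha>) * I \<alpha>) < \<infinity>"
    using \<phi> q_real(1)[OF p] by (simp add: test_functions_def r_def w'_def I_def)
  then obtain n where n: "(\<Sum>\<alpha>. ennreal (w' \<alpha>) * I \<alpha>) = ennreal n" "n \<ge> 0"
    by (cases "\<Sum>\<alpha>. ennreal (w' \<alpha>) * I \<alpha>") auto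
  \<comment> \<open>Chosen so that \<open>d powr (- r) * n \<le> e\<close>; adding 1 keeps the base
    positive when \<open>n = 0\<close>.\<close>
  define d where "d = (n / e + 1) powr (1 / r)"
  have base: "n / e + 1 > 0" using n e by (simp add: add_nonneg_pos)
  have d: "d > 0" using base by (simp add: d_def)
  have dr: "d powr (- r) * n \<le> e"
  proof -
    have "d powr (- r) = inverse (n / e + 1)"
      using base r by (simp add: d_def powr_powr powr_minus)
    moreover have "n \<le> e * (n / e + 1)" using e by (simp add: algebra_simps)
    then have "inverse (n / e + 1) * n \<le> inverse (n / e + 1) * (e * (n / e + 1))"
      using base by (intro mult_left_mono) auto
    moreover have "inverse (n / e + 1) * (e * (n / e + 1)) = e" using base by simp
    ultimately show ?thesis by simp
  qed
  \<comment> \<open>Raised to the power \<open>- r / p\<close>, the weight of the sequence norm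
    becomes the weight of the test-function norm. This is the duality between the two
    spaces.\<close>
  have w': "W \<alpha> powr (- r / p) = w' \<alpha>" for \<alpha>
    using h_pos p by (simp add: weight_def w'_def powr_divide powr_powr powr_minus mult.commute mult.left_commute divide_simps)
  have young: "\<bar>x\<bar> * y \<le> d powr p * (W \<alpha> * y powr p) + d powr (- r) * (w' \<alpha> * \<bar>x\<bar> powr r)" if y: "y \<ge> 0" for x y \<alpha>
  proof -
    \<comment> \<open>This scaling distributes the weight and the free parameter \<open>d\<close>
      over the two factors of the product. The coefficients \<open>1 / p\<close> and
      \<open>1 / r\<close> of Young's inequality are at most 1 and are dropped.\<close>
    define k where "k = d * W \<alpha> powr (1 / p)"
    have k: "k > 0" using d weight_pos[of \<alpha>] by (simp add: k_def)
    have "\<bar>x\<bar> * y = (k * y) * (\<bar>x\<bar> / k)" using k by simp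
    also have "\<dots> \<le> (k * y) powr p / p + (\<bar>x\<bar> / k) powr r / r"
      using p r k y by (intro Youngs_inequality) auto
    also have "\<dots> \<le> (k * y) powr p + (\<bar>x\<bar> / k) powr r"
      using p r by (intro add_mono) (auto simp: divide_le_eq mult_le_cancel_left1)
    also have "(k * y) powr p = d powr p * (W \<alpha> * y powr p)"
      using d y p weight_pos[of \<alpha>] by (simp add: k_def powr_mult powr_powr)
    also have "(\<bar>x\<bar> / k) powr r = d powr (- r) * (w' \<alpha> * \<bar>x\<bar> powr r)"
    proof -
      have "(\<bar>x\<bar> / k) powr r = \<bar>x\<bar> powr r * k powr (- r)"
        using powr_divide[of "\<bar>x\<bar>" k r] k by (simp add: powr_minus divide_inverse)
      also have "k powr (- r) = d powr (- r) * W \<alpha> powr (- r / p)"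
        using d weight_pos[of \<alpha>] by (simp add: k_def powr_mult powr_powr)
      finally show ?thesis by (simp add: w'[simplified] mult_ac)
    qed
    finally show ?thesis .
  qed
  show ?thesis
  proof (intro exI[of _ "d powr p"] allI impI)
    fix g :: "nat \<Rightarrow> real \<Rightarrow> 'b" assume g: "\<forall>\<alpha>. smeas (g \<alpha>)"
    have bound_term: "(\<integral>\<^sup>+t. ennreal (norm ((deriv ^^ \<alpha>) \<phi> t *\<^sub>R g \<alpha> t)) \<partial>MT) \<le>
        ennreal (d powr p) * (ennreal (W \<alpha>) * Lp_norm_pow T p norm (g \<alpha>)) + ennreal (d powr (- r)) * (ennreal (w' \<alpha>) * I \<alpha>)" for \<alpha>
    proof -
      have m: "(\<lambda>t. ennreal (\<bar>(deriv ^^ \<alpha>) \<phi> t\<bar> powr r)) \<in> borel_measurable MT"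
        using test_function_measurable[OF \<phi>] by measurable
      have "(\<integral>\<^sup>+t. ennreal (norm ((deriv ^^ \<alpha>) \<phi> t *\<^sub>R g \<alpha> t)) \<partial>MT) \<le>
         (\<integral>\<^sup>+t. ennreal (d powr p * W \<alpha>) * ennreal (norm (g \<alpha> t) powr p) + ennreal (d powr (- r) * w' \<alpha>) * ennreal (\<bar>(deriv ^^ \<alpha>) \<phi> t\<bar> powr r) \<partial>MT)"
      proof (rule nn_integral_mono)
        fix t
        have "norm ((deriv ^^ \<alpha>) \<phi> t *\<^sub>R g \<alpha> t) \<le> d powr p * (W \<alpha> * norm (g \<alpha> t) powr p) + d powr (- r) * (w' \<alpha> * \<bar>(deriv ^^ \<alpha>) \<phi> t\<bar> powr r)"
          using young[of "norm (g \<alpha> t)" "(deriv ^^ \<alpha>) \<phi> t" \<alpha>] by simp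
        then have "ennreal (norm ((deriv ^^ \<alpha>) \<phi> t *\<^sub>R g \<alpha> t)) \<le> ennreal (d powr p * W \<alpha> * norm (g \<alpha> t) powr p + d powr (- r) * w' \<alpha> * \<bar>(deriv ^^ \<alpha>) \<phi> t\<bar> powr r)"
          by (intro ennreal_leI) (simp add: mult.assoc)
        then show "ennreal (norm ((deriv ^^ \<alpha>) \<phi> t *\<^sub>R g \<alpha> t)) \<le> ennreal (d powr p * W \<alpha>) * ennreal (norm (g \<alpha> t) powr p) + ennreal (d powr (- r) * w' \<alpha>) * ennreal (\<bar>(deriv ^^ \<alpha>) \<phi> t\<bar> powr r)"
          using weight_pos[of \<alpha>] by (simp add: w'_def flip: ennreal_plus ennreal_mult)
      qed
      also have "\<dots> = ennreal (d powr p * W \<alpha>) * Lp_norm_pow T p norm (g \<alpha>) + ennreal (d powr (- r) * w' \<alpha>) * I \<alpha>"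
        unfolding I_def Lp_norm_pow_def using g m smeas_ennreal_norm_powr[of "g \<alpha>" p]
        by (subst nn_integral_add) (auto simp: nn_integral_cmult)
      also have "ennreal (d powr p * W \<alpha>) = ennreal (d powr p) * ennreal (W \<alpha>)"
        using weight_pos[of \<alpha>] by (simp add: ennreal_mult)
      also have "ennreal (d powr (- r) * w' \<alpha>) = ennreal (d powr (- r)) * ennreal (w' \<alpha>)"
        by (rule ennreal_mult) (simp_all add: w'_def)
      finally show ?thesis by (simp add: mult.assoc)
    qed
    have "(\<Sum>\<alpha>. \<integral>\<^sup>+t. ennreal (norm ((deriv ^^ \<alpha>) \<phi> t *\<^sub>R g \<alpha> t)) \<partial>MT) \<le>
        (\<Sum>\<alpha>. ennreal (d powr p) * (ennreal (W \<alpha>) * Lp_norm_pow T p norm (g \<alpha>)) + ennreal (d powr (- r)) * (ennreal (w' \<alpha>) * I \<alpha>))"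
      by (intro suminf_le summableI bound_term)
    also have "\<dots> = (\<Sum>\<alpha>. ennreal (d powr p) * (ennreal (W \<alpha>) * Lp_norm_pow T p norm (g \<alpha>))) + (\<Sum>\<alpha>. ennreal (d powr (- r)) * (ennreal (w' \<alpha>) * I \<alpha>))"
      by (rule suminf_add[symmetric]) (rule summableI)+
    also have "\<dots> = ennreal (d powr p) * seq_Lp_norm_pow T p s h norm g + ennreal (d powr (- r)) * ennreal n"
      by (simp only: ennreal_suminf_cmult n(1) seq_Lp_norm_pow_def)
    also have "ennreal (d powr (- r)) * ennreal n \<le> ennreal e"
      using dr n(2) by (simp add: ennreal_leI flip: ennreal_mult)
    finally show "(\<Sum>\<alpha>. \<integral>\<^sup>+t. ennreal (norm ((deriv ^^ \<alpha>) \<phi> t *\<^sub>R g \<alpha> t)) \<partial>MT) \<le> ennreal (d powr p) * seq_Lp_norm_pow T p s h norm g + ennreal e"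
      by (simp add: add_left_mono)
  qed
qed

lemma pairing_bound:
  fixes \<phi> :: "real \<Rightarrow> real"
  assumes \<phi>: "\<phi> \<in> test_functions T q s h" and e: "e > 0"
  obtains c where "\<forall>g. g \<in> seq_Lp T p s h UNIV norm \<longrightarrow>
    (\<Sum>\<alpha>. \<integral>\<^sup>+t. ennreal (norm ((deriv ^^ \<alpha>) \<phi> t *\<^sub>R g \<alpha> t)) \<partial>MT) \<le> ennreal c * seq_Lp_norm_pow T p s h norm (g :: nat \<Rightarrow> real \<Rightarrow> 'b::real_normed_vector) + ennreal e"
proof -
  have sm: "\<forall>\<alpha>. smeas (g \<alpha>)" if "g \<in> seq_Lp T p s h UNIV norm" for g :: "nat \<Rightarrow> real \<Rightarrow> 'b"
    using that by (simp add: seq_Lp_iff Lp_space_iff)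
  show thesis
  proof (cases "p = 1")
    case True
    from pairing_bound_1[OF \<phi> True, where 'b='b] obtain c where c: "\<forall>g. (\<forall>\<alpha>. smeas (g \<alpha>)) \<longrightarrow>
      (\<Sum>\<alpha>. \<integral>\<^sup>+t. ennreal (norm ((deriv ^^ \<alpha>) \<phi> t *\<^sub>R g \<alpha> t)) \<partial>MT) \<le> ennreal c * seq_Lp_norm_pow T p s h norm (g :: nat \<Rightarrow> real \<Rightarrow> 'b)" ..
    show thesis
    proof (rule that[of c], intro allI impI)
      fix g :: "nat \<Rightarrow> real \<Rightarrow> 'b" assume "g \<in> seq_Lp T p s h UNIV norm"
      with c sm have "(\<Sum>\<alpha>. \<integral>\<^sup>+t. ennreal (norm ((deriv ^^ \<alpha>) \<phi> t *\<^sub>R g \<alpha> t)) \<partial>MT) \<le> ennreal c * seq_Lp_norm_pow T p s h norm g" by blast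
      then show "(\<Sum>\<alpha>. \<integral>\<^sup>+t. ennreal (norm ((deriv ^^ \<alpha>) \<phi> t *\<^sub>R g \<alpha> t)) \<partial>MT) \<le> ennreal c * seq_Lp_norm_pow T p s h norm g + ennreal e"
        by (rule order_trans) simp
    qed
  next
    case False
    then have "p > 1" using p_ge_1 by simp
    from pairing_bound_gt_1[OF \<phi> this e, where 'b='b] obtain c where c: "\<forall>g. (\<forall>\<alpha>. smeas (g \<alpha>)) \<longrightarrow>
      (\<Sum>\<alpha>. \<integral>\<^sup>+t. ennreal (norm ((deriv ^^ \<alpha>) \<phi> t *\<^sub>R g \<alpha> t)) \<partial>MT) \<le> ennreal c * seq_Lp_norm_pow T p s h norm (g :: nat \<Rightarrow> real \<Rightarrow> 'b) + ennreal e" ..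
    show thesis
      by (rule that[of c]) (use c sm in blast)
  qed
qed

definition pair_term :: "(nat \<Rightarrow> real \<Rightarrow> 'b::real_normed_vector) \<Rightarrow> (real \<Rightarrow> real) \<Rightarrow> nat \<Rightarrow> 'b" where
  "pair_term g \<phi> \<alpha> = (- 1) ^ \<alpha> *\<^sub>R strong_integral MT (\<lambda>t. (deriv ^^ \<alpha>) \<phi> t *\<^sub>R g \<alpha> t)"

lemma pairing_eq: "pairing T g \<phi> = (\<Sum>\<alpha>. pair_term g \<phi> \<alpha>)"
  by (simp add: pairing_def pair_term_def)

text \<open>The estimate with \<open>e = 1\<close> makes the sum of the \<open>L1\<close> norms of
  all terms finite; integrability of each term and absolute convergence of the series are read off
  from this.\<close>

lemma pair_term_facts:
  fixes g :: "nat \<Rightarrow> real \<Rightarrow> 'b::banach"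
  assumes \<phi>: "\<phi> \<in> test_functions T q s h" and g: "g \<in> seq_Lp T p s h UNIV norm"
  shows L1_test_scaleR: "L1 (\<lambda>t. (deriv ^^ \<alpha>) \<phi> t *\<^sub>R g \<alpha> t)"
    and summable_pair_term: "summable (pair_term g \<phi>)"
    and norm_pairing_le: "ennreal (norm (pairing T g \<phi>)) \<le> (\<Sum>\<alpha>. \<integral>\<^sup>+t. ennreal (norm ((deriv ^^ \<alpha>) \<phi> t *\<^sub>R g \<alpha> t)) \<partial>MT)"
proof -
  let ?n = "\<lambda>\<alpha>. \<integral>\<^sup>+t. ennreal (norm ((deriv ^^ \<alpha>) \<phi> t *\<^sub>R g \<alpha> t)) \<partial>MT"
  obtain c where c: "\<forall>g. g \<in> seq_Lp T p s h UNIV norm \<longrightarrow>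
    (\<Sum>\<alpha>. \<integral>\<^sup>+t. ennreal (norm ((deriv ^^ \<alpha>) \<phi> t *\<^sub>R g \<alpha> t)) \<partial>MT) \<le> ennreal c * seq_Lp_norm_pow T p s h norm (g :: nat \<Rightarrow> real \<Rightarrow> 'b) + ennreal 1"
    by (rule pairing_bound[OF \<phi> zero_less_one])
  have "(\<Sum>\<alpha>. ?n \<alpha>) \<le> ennreal c * seq_Lp_norm_pow T p s h norm g + ennreal 1"
    using c g by blast
  also have "\<dots> < \<infinity>"
    using g by (simp add: seq_Lp_def ennreal_mult_less_top)
  finally have fin: "(\<Sum>\<alpha>. ?n \<alpha>) < \<infinity>" .
  have n_le: "?n \<alpha> \<le> (\<Sum>\<alpha>. ?n \<alpha>)" for \<alpha>
    using sum_le_suminf[of ?n "{\<alpha>}"] by (simp add: summableI)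
  have sm: "smeas (g \<alpha>)" for \<alpha> using g by (simp add: seq_Lp_iff Lp_space_iff)
  show L: "L1 (\<lambda>t. (deriv ^^ \<alpha>) \<phi> t *\<^sub>R g \<alpha> t)" for \<alpha>
    using smeas_test_scaleR[OF \<phi> sm, of \<alpha>] le_less_trans[OF n_le fin, of \<alpha>] by (simp add: L1_def)
  have bound_term: "ennreal (norm (pair_term g \<phi> \<alpha>)) \<le> ?n \<alpha>" for \<alpha>
    using strong_integral_norm_le[OF L, of \<alpha>] by (simp add: pair_term_def)
  then have le: "(\<Sum>\<alpha>. ennreal (norm (pair_term g \<phi> \<alpha>))) \<le> (\<Sum>\<alpha>. ?n \<alpha>)"
    by (intro suminf_le summableI)
  then have sn: "summable (\<lambda>\<alpha>. norm (pair_term g \<phi> \<alpha>))"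
    using fin by (intro summable_suminf_not_top) (auto simp: top_unique)
  then show "summable (pair_term g \<phi>)" by (rule summable_norm_cancel)
  have "ennreal (norm (pairing T g \<phi>)) \<le> ennreal (\<Sum>\<alpha>. norm (pair_term g \<phi> \<alpha>))"
    unfolding pairing_eq by (intro ennreal_leI summable_norm sn)
  also have "\<dots> = (\<Sum>\<alpha>. ennreal (norm (pair_term g \<phi> \<alpha>)))"
    by (rule suminf_ennreal2[symmetric]) (use sn in auto)
  finally show "ennreal (norm (pairing T g \<phi>)) \<le> (\<Sum>\<alpha>. ?n \<alpha>)" using le by simp
qed

text \<open>The constant \<open>c\<close> depends on the additive error, so that error is fixed
  first, as half of the tolerance; only then is \<open>k\<close> taken large enough for the other
  half.\<close>

lemma pairing_tendsto_0:
  fixes g :: "nat \<Rightarrow> nat \<Rightarrow> real \<Rightarrow> 'b::banach"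
  assumes \<phi>: "\<phi> \<in> test_functions T q s h" and g: "\<And>k. g k \<in> seq_Lp T p s h UNIV norm"
    and lim: "(\<lambda>k. seq_Lp_norm_pow T p s h norm (g k)) \<longlonglongrightarrow> 0"
  shows "(\<lambda>k. norm (pairing T (g k) \<phi>)) \<longlonglongrightarrow> 0"
proof (rule LIMSEQ_I)
  fix e :: real assume e: "e > 0"
  then have e2: "e / 2 > 0" by simp
  obtain c where c: "\<forall>g. g \<in> seq_Lp T p s h UNIV norm \<longrightarrow>
    (\<Sum>\<alpha>. \<integral>\<^sup>+t. ennreal (norm ((deriv ^^ \<alpha>) \<phi> t *\<^sub>R g \<alpha> t)) \<partial>MT) \<le> ennreal c * seq_Lp_norm_pow T p s h norm (g :: nat \<Rightarrow> real \<Rightarrow> 'b) + ennreal (e / 2)"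
    by (rule pairing_bound[OF \<phi> e2])
  have "(\<lambda>k. ennreal c * seq_Lp_norm_pow T p s h norm (g k)) \<longlonglongrightarrow> ennreal c * 0"
    by (intro ennreal_tendsto_cmult lim) simp
  then have "\<forall>\<^sub>F k in sequentially. ennreal c * seq_Lp_norm_pow T p s h norm (g k) < ennreal (e / 2)"
    using e2 by (intro order_tendstoD(2)) auto
  then obtain N where N: "\<And>k. k \<ge> N \<Longrightarrow> ennreal c * seq_Lp_norm_pow T p s h norm (g k) < ennreal (e / 2)"
    unfolding eventually_sequentially by blast
  show "\<exists>N. \<forall>k\<ge>N. norm (norm (pairing T (g k) \<phi>) - 0) < e"
  proof (intro exI[of _ N] allI impI)
    fix k assume k: "k \<ge> N"
    have "ennreal (norm (pairing T (g k) \<phi>)) \<le> ennreal c * seq_Lp_norm_pow T p s h norm (g k) + ennreal (e / 2)"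
      using norm_pairing_le[OF \<phi> g] c g by (blast intro: order_trans)
    also have "\<dots> < ennreal e"
    proof -
      obtain x where x: "ennreal c * seq_Lp_norm_pow T p s h norm (g k) = ennreal x" "x \<ge> 0"
        using N[OF k] by (cases "ennreal c * seq_Lp_norm_pow T p s h norm (g k)") auto
      then have "x < e / 2" using N[OF k] by (simp add: ennreal_less_iff)
      then have "ennreal (x + e / 2) < ennreal e" using x e by (intro ennreal_lessI) auto
      then show ?thesis using x e by simp
    qed
    finally show "norm (norm (pairing T (g k) \<phi>) - 0) < e" using e by (simp add: ennreal_less_iff)
  qed
qed

lemma strict_solution_weak:
  assumes u: "strict_solution T p s h D A f u0 u" and f: "f \<in> seq_Lp T p s h UNIV norm"
  shows "strict_weak_solution T p q s h D A f u0 u"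
proof -
  have uW: "u \<in> seq_W1p T p s h" and uD: "u \<in> seq_Lp T p s h D (graph_norm A)"
    using u by (auto simp: strict_solution_def regular_seqs_def)
  define G where "G = seq_deriv T p u"
  have uL: "u \<in> seq_Lp T p s h UNIV norm" and GL: "G \<in> seq_Lp T p s h UNIV norm"
    using seq_W1p_D[OF uW] by (auto simp: G_def)
  define l where "l = w + 1"
  have l: "w < l" by (simp add: l_def)
  have "pairing T u \<phi> \<in> D \<and> pairing T G \<phi> = A (pairing T u \<phi>) + pairing T f \<phi>"
    if \<phi>: "\<phi> \<in> test_functions T q s h" for \<phi>
  proof -
    have bound_term: "pair_term u \<phi> \<alpha> = R l (l *\<^sub>R pair_term u \<phi> \<alpha> - pair_term G \<phi> \<alpha> + pair_term f \<phi> \<alpha>)" for \<alpha>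
    proof -
      let ?\<phi> = "(deriv ^^ \<alpha>) \<phi>"
      have L: "L1 (\<lambda>t. ?\<phi> t *\<^sub>R u \<alpha> t)" "L1 (\<lambda>t. ?\<phi> t *\<^sub>R G \<alpha> t)" "L1 (\<lambda>t. ?\<phi> t *\<^sub>R f \<alpha> t)"
        using uL GL f by (auto intro: L1_test_scaleR[OF \<phi>])
      have Lh: "L1 (\<lambda>t. l *\<^sub>R (?\<phi> t *\<^sub>R u \<alpha> t) - ?\<phi> t *\<^sub>R G \<alpha> t + ?\<phi> t *\<^sub>R f \<alpha> t)"
        by (intro L1_add L1_diff L1_scaleR L)
      have 1: "AE t in MT. G \<alpha> t = A (u \<alpha> t) + f \<alpha> t"
        using u unfolding strict_solution_def equation_ae_def AE_closed_iff G_def by blast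
      have 2: "AE t in MT. u \<alpha> t \<in> D"
        using uD by (simp add: seq_Lp_def Lp_space_def strongly_measurable_def)
      \<comment> \<open>The scalar factor passes through the linear operator \<open>R l\<close>, so
        the resolvent form of the equation holds for the weighted component, where integral and
        series can be moved inside.\<close>
      have ae: "AE t in MT. ?\<phi> t *\<^sub>R u \<alpha> t = R l (l *\<^sub>R (?\<phi> t *\<^sub>R u \<alpha> t) - ?\<phi> t *\<^sub>R G \<alpha> t + ?\<phi> t *\<^sub>R f \<alpha> t)"
        using 1 2
      proof eventually_elim
        case (elim t)
        have "l *\<^sub>R (?\<phi> t *\<^sub>R u \<alpha> t) - ?\<phi> t *\<^sub>R G \<alpha> t + ?\<phi> t *\<^sub>R f \<alpha> t = ?\<phi> t *\<^sub>R (l *\<^sub>R u \<alpha> t - A (u \<alpha> t))"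
          unfolding elim(1) by (simp add: algebra_simps)
        then show ?case
          using R_eq_shift[OF l elim(2)] by (simp add: blinfun.scaleR_right)
      qed
      have "strong_integral MT (\<lambda>t. ?\<phi> t *\<^sub>R u \<alpha> t) = R l (strong_integral MT (\<lambda>t. l *\<^sub>R (?\<phi> t *\<^sub>R u \<alpha> t) - ?\<phi> t *\<^sub>R G \<alpha> t + ?\<phi> t *\<^sub>R f \<alpha> t))"
        unfolding strong_integral_cong_AE[OF L(1) ae] by (rule strong_integral_linear[OF blinfun.bounded_linear_right Lh])
      also have "strong_integral MT (\<lambda>t. l *\<^sub>R (?\<phi> t *\<^sub>R u \<alpha> t) - ?\<phi> t *\<^sub>R G \<alpha> t + ?\<phi> t *\<^sub>R f \<alpha> t) =
          l *\<^sub>R strong_integral MT (\<lambda>t. ?\<phi> t *\<^sub>R u \<alpha> t) - strong_integral MT (\<lambda>t. ?\<phi> t *\<^sub>R G \<alpha> t) + strong_integral MT (\<lambda>t. ?\<phi> t *\<^sub>R f \<alpha> t)"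
        using strong_integral_add[OF L1_diff[OF L1_scaleR[OF L(1)] L(2)] L(3), of l]
          strong_integral_diff[OF L1_scaleR[OF L(1)] L(2), of l]
          strong_integral_linear[OF bounded_linear_scaleR_right L(1), of l] by (simp only:)
      finally have eq: "strong_integral MT (\<lambda>t. ?\<phi> t *\<^sub>R u \<alpha> t) = R l (l *\<^sub>R strong_integral MT (\<lambda>t. ?\<phi> t *\<^sub>R u \<alpha> t) - strong_integral MT (\<lambda>t. ?\<phi> t *\<^sub>R G \<alpha> t) + strong_integral MT (\<lambda>t. ?\<phi> t *\<^sub>R f \<alpha> t))" .
      show ?thesis
        unfolding pair_term_def
        by (subst eq) (simp add: blinfun.scaleR_right[symmetric] scaleR_add_right scaleR_diff_right mult.commute[of l])
    qed
    have S: "summable (pair_term u \<phi>)" "summable (pair_term G \<phi>)" "summable (pair_term f \<phi>)"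
      by (intro summable_pair_term \<phi> uL GL f)+
    have Sh: "summable (\<lambda>\<alpha>. l *\<^sub>R pair_term u \<phi> \<alpha> - pair_term G \<phi> \<alpha> + pair_term f \<phi> \<alpha>)"
      by (intro summable_add summable_diff summable_scaleR_right S)
    have "pairing T u \<phi> = (\<Sum>\<alpha>. R l (l *\<^sub>R pair_term u \<phi> \<alpha> - pair_term G \<phi> \<alpha> + pair_term f \<phi> \<alpha>))"
      unfolding pairing_eq by (rule arg_cong[where f=suminf]) (rule ext, rule bound_term)
    also have "\<dots> = R l (\<Sum>\<alpha>. l *\<^sub>R pair_term u \<phi> \<alpha> - pair_term G \<phi> \<alpha> + pair_term f \<phi> \<alpha>)"
      by (rule bounded_linear.suminf[symmetric, OF blinfun.bounded_linear_right Sh])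
    also have "(\<Sum>\<alpha>. l *\<^sub>R pair_term u \<phi> \<alpha> - pair_term G \<phi> \<alpha> + pair_term f \<phi> \<alpha>) = l *\<^sub>R pairing T u \<phi> - pairing T G \<phi> + pairing T f \<phi>"
      using suminf_add[OF summable_diff[OF summable_scaleR_right[OF S(1)] S(2)] S(3), of l]
        suminf_diff[OF summable_scaleR_right[OF S(1)] S(2), of l] suminf_scaleR_right[OF S(1), of l]
      by (simp add: pairing_eq)
    finally have eq: "pairing T u \<phi> = R l (l *\<^sub>R pairing T u \<phi> - pairing T G \<phi> + pairing T f \<phi>)" .
    \<comment> \<open>The relation \<open>A R(l) = l R(l) - 1\<close> turns the resolvent form back
      into the equation. The same form shows that the pairing lies in \<open>D\<close>, since
      \<open>R l\<close> maps into \<open>D\<close>.\<close>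
    then have "A (pairing T u \<phi>) = l *\<^sub>R pairing T u \<phi> - (l *\<^sub>R pairing T u \<phi> - pairing T G \<phi> + pairing T f \<phi>)"
      using A_R[OF l, of "l *\<^sub>R pairing T u \<phi> - pairing T G \<phi> + pairing T f \<phi>"] by simp
    moreover have "pairing T u \<phi> \<in> D" using eq R_in_D[OF l] by metis
    ultimately show ?thesis by simp
  qed
  then show ?thesis
    using u by (simp add: strict_weak_solution_def strict_solution_def equation_weak_def G_def)
qed

text \<open>The same approximants serve here: strict solutions are strict weak solutions, and
  convergence in norm implies convergence of all pairings.\<close>

lemma F_weak_solution_exists:
  assumes f: "f \<in> seq_Lp T p s h UNIV norm" and u0: "weighted_summable p s h u0" "\<And>\<alpha>. u0 \<alpha> \<in> closure D"
  shows "\<exists>u. F_weak_solution T p q s h D A f u0 u"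
proof -
  obtain u U F V where *: "u \<in> seq_Lp T p s h UNIV norm"
    "\<forall>k. strict_solution T p s h D A (F k) (V k) (U k)"
    "\<forall>k. F k \<in> seq_Lp T p s h UNIV norm" "\<forall>k. weighted_summable p s h (V k)"
    "(\<lambda>k. seq_Lp_norm_pow T p s h norm (\<lambda>\<alpha> t. U k \<alpha> t - u \<alpha> t)) \<longlonglongrightarrow> 0"
    "(\<lambda>k. seq_Lp_norm_pow T p s h norm (\<lambda>\<alpha> t. F k \<alpha> t - f \<alpha> t)) \<longlonglongrightarrow> 0"
    "(\<lambda>k. seq_Lp_norm_pow T p s h norm (const_seq (\<lambda>\<alpha>. V k \<alpha> - u0 \<alpha>))) \<longlonglongrightarrow> 0"
    by (rule approximating_solutions[OF assms])
  have weak: "strict_weak_solution T p q s h D A (F k) (V k) (U k)" for k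
    using *(2,3) by (intro strict_solution_weak) auto
  have UL: "U k \<in> seq_Lp T p s h UNIV norm" for k
    using weak[of k] seq_W1p_D(1) by (auto simp: strict_weak_solution_def regular_seqs_def)
  have "F_weak_solution T p q s h D A f u0 u"
    unfolding F_weak_solution_def
  proof (rule conjI[OF *(1)], rule exI[of _ U], rule exI[of _ F], rule exI[of _ V], intro conjI allI ballI)
    show "U k \<in> regular_seqs T p s h D A" "U k \<alpha> 0 = V k \<alpha>" "equation_weak T p q s h D A (F k) (U k)" for k \<alpha>
      using weak[of k] by (auto simp: strict_weak_solution_def)
    show "F k \<in> seq_Lp T p s h UNIV norm" "weighted_summable p s h (V k)" for k
      using *(3,4) by auto
    fix \<phi> assume \<phi>: "\<phi> \<in> test_functions T q s h"
    have "(\<lambda>k. norm (pairing T (\<lambda>\<alpha> t. U k \<alpha> t - u \<alpha> t) \<phi>) + norm (pairing T (\<lambda>\<alpha> t. F k \<alpha> t - f \<alpha> t) \<phi>) +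
        norm (pairing T (const_seq (\<lambda>\<alpha>. V k \<alpha> - u0 \<alpha>)) \<phi>)) \<longlonglongrightarrow> 0 + 0 + 0"
      using *(3,4)
      by (intro tendsto_add pairing_tendsto_0[OF \<phi>] * seq_Lp_diff UL f const_seq_in_seq_Lp weighted_summable_diff u0) auto
    then show "(\<lambda>k. norm (pairing T (\<lambda>\<alpha> t. U k \<alpha> t - u \<alpha> t) \<phi>) + norm (pairing T (\<lambda>\<alpha> t. F k \<alpha> t - f \<alpha> t) \<phi>) +
        norm (pairing T (const_seq (\<lambda>\<alpha>. V k \<alpha> - u0 \<alpha>)) \<phi>)) \<longlonglongrightarrow> 0" by simp
  qed
  then show ?thesis by blast
qed

end

text \<open>Passing from \<open>\<omega>\<close> to \<open>max \<omega> 0\<close> and from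
  \<open>C\<close> to \<open>max C 1\<close> keeps the bound, because
  \<open>0 < l - w \<le> l - \<omega>\<close>. The power \<open>k = 0\<close>, which the condition
  does not mention, is covered by \<open>C' \<ge> 1\<close>.\<close>

lemma hille_yosida_operator:
  fixes D :: "'a::banach set"
  assumes cl: "closed_linear_operator D A" and hy: "hille_yosida D A" and T: "T > 0"
  shows "\<exists>R w C. hy_operator D A R w C T"
proof -
  obtain \<omega> C where C: "C > 0" and hy: "\<And>l. l > \<omega> \<Longrightarrow> l \<in> resolvent_set D A"
    "\<And>l k. l > \<omega> \<Longrightarrow> k \<ge> 1 \<Longrightarrow> onorm (\<lambda>x. (l - \<omega>) ^ k *\<^sub>R (resolvent D A l ^^ k) x) \<le> C"
    using hy unfolding hille_yosida_def by blast
  define w where "w = max \<omega> 0"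
  define C' where "C' = max C 1"
  define R where "R = (\<lambda>l. Blinfun (resolvent D A l))"
  have bl: "bounded_linear (resolvent D A l)" and bij: "bij_betw (\<lambda>x. l *\<^sub>R x - A x) D UNIV" if "w < l" for l
    using hy(1)[of l] that by (auto simp: resolvent_set_def w_def)
  have R: "R l x = resolvent D A l x" if "w < l" for l x
    unfolding R_def using bl[OF that] by (simp add: bounded_linear_Blinfun_apply)
  have inD: "resolvent D A l x \<in> D" if "w < l" for l x
    unfolding resolvent_def using bij[OF that] by (intro inv_into_into) (simp add: bij_betw_def)
  have right: "l *\<^sub>R resolvent D A l x - A (resolvent D A l x) = x" if "w < l" for l x
    unfolding resolvent_def using bij[OF that] f_inv_into_f[of x "\<lambda>x. l *\<^sub>R x - A x" D] by (simp add: bij_betw_def)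
  have left: "resolvent D A l (l *\<^sub>R x - A x) = x" if "w < l" "x \<in> D" for l x
    unfolding resolvent_def using bij[OF that(1)] that(2) inv_into_f_f[of "\<lambda>x. l *\<^sub>R x - A x" D x] by (simp add: bij_betw_def)
  have pow: "bpow (R l) k x = (resolvent D A l ^^ k) x" if "w < l" for l k x
    by (induction k) (simp_all add: R[OF that])
  have lin: "subspace D" "\<And>x y. x \<in> D \<Longrightarrow> y \<in> D \<Longrightarrow> A (x + y) = A x + A y" "\<And>c x. x \<in> D \<Longrightarrow> A (c *\<^sub>R x) = c *\<^sub>R A x"
    "closed {(x, A x) |x. x \<in> D}"
    using cl by (auto simp: closed_linear_operator_def)
  have "hy_operator D A R w C' T"
  proof
    show "subspace D" by (rule lin)
    show "A (x + y) = A x + A y" if "x \<in> D" "y \<in> D" for x y using lin that by blast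
    show "A (c *\<^sub>R x) = c *\<^sub>R A x" if "x \<in> D" for c x using lin that by blast
    show "x \<in> D \<and> A x = y" if X: "\<And>n. X n \<in> D" "X \<longlonglongrightarrow> x" "(\<lambda>n. A (X n)) \<longlonglongrightarrow> y" for X x y
    proof -
      have "(\<lambda>n. (X n, A (X n))) \<longlonglongrightarrow> (x, y)" by (intro tendsto_Pair X)
      then have "(x, y) \<in> {(x, A x) |x. x \<in> D}"
        by (rule closed_sequentially[OF lin(4), rotated]) (use X(1) in auto)
      then show ?thesis by auto
    qed
    fix l assume l: "w < l"
    show "R l x \<in> D" for x unfolding R[OF l] by (rule inD[OF l])
    show "A (R l x) = l *\<^sub>R R l x - x" for x
      unfolding R[OF l] using right[OF l, of x] by (simp add: algebra_simps)
    show "R l (A x) = l *\<^sub>R R l x - x" if "x \<in> D" for x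
    proof -
      interpret bounded_linear "resolvent D A l" by (rule bl[OF l])
      show ?thesis
        unfolding R[OF l] using left[OF l that] by (simp add: diff scaleR algebra_simps)
    qed
    show "norm (bpow (R l) k) \<le> C' / (l - w) ^ k" for k
    proof (rule norm_blinfun_bound)
      show "0 \<le> C' / (l - w) ^ k" using l by (simp add: C'_def)
      fix x
      show "norm (bpow (R l) k x) \<le> C' / (l - w) ^ k * norm x"
      proof (cases "k = 0")
        case True
        then show ?thesis using mult_right_mono[of 1 C' "norm x"] by (simp add: C'_def)
      next
        case False
        have lo: "\<omega> < l" "0 < l - w" "l - w \<le> l - \<omega>" using l by (auto simp: w_def)
        let ?f = "\<lambda>x. (l - \<omega>) ^ k *\<^sub>R (resolvent D A l ^^ k) x"
        \<comment> \<open>\<open>onorm\<close> controls the values of a map once that map is bounded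
          linear; this is seen from its form as a bounded operator.\<close>
        have "?f = blinfun_apply ((l - \<omega>) ^ k *\<^sub>R bpow (R l) k)"
          by (simp add: fun_eq_iff pow[OF l] scaleR_blinfun.rep_eq)
        then have "bounded_linear ?f" using blinfun.bounded_linear_right by metis
        then have "norm (?f x) \<le> onorm ?f * norm x" by (rule onorm)
        also have "\<dots> \<le> C * norm x" using hy(2)[OF lo(1), of k] False by (intro mult_right_mono) auto
        also have "\<dots> \<le> C' * norm x" by (intro mult_right_mono) (auto simp: C'_def)
        finally have 1: "(l - \<omega>) ^ k * norm ((resolvent D A l ^^ k) x) \<le> C' * norm x" using lo by simp
        have "(l - w) ^ k * norm ((resolvent D A l ^^ k) x) \<le> (l - \<omega>) ^ k * norm ((resolvent D A l ^^ k) x)"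
          using lo by (intro mult_right_mono power_mono) auto
        with 1 have "(l - w) ^ k * norm ((resolvent D A l ^^ k) x) \<le> C' * norm x" by simp
        then show ?thesis
          using lo by (simp add: pow[OF l] field_simps)
      qed
    qed
  qed (auto simp: w_def C'_def T)
  then show ?thesis by blast
qed

theorem theorem5p5:
  fixes s T h p :: real
    and q :: ennreal
    and D :: "'a::banach set"
    and A :: "'a \<Rightarrow> 'a"
  assumes "s > 1" and "T > 0" and "h > 0" and "p \<ge> 1"
    and "1 / ennreal p + 1 / q = 1"
    and "closed_linear_operator D A"
    and "hille_yosida D A"
  shows "(\<forall>f u\<^sub>0. f \<in> seq_Lp T p s h UNIV norm \<and>
                  weighted_summable p s h u\<^sub>0 \<and>
                  (\<forall>\<alpha>. u\<^sub>0 \<alpha> \<in> closure D) \<longrightarrow>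
            (\<exists>u. F_solution T p s h D A f u\<^sub>0 u) \<and>
            (\<exists>u. F_weak_solution T p q s h D A f u\<^sub>0 u) \<and>
            (\<forall>u v. F_solution T p s h D A f u\<^sub>0 u \<and> F_solution T p s h D A f u\<^sub>0 v \<longrightarrow>
               (\<forall>\<alpha>. AE t in lebesgue_on {0<..<T}. u \<alpha> t = v \<alpha> t)))
       \<and>
         (\<forall>f u\<^sub>0. f \<in> seq_W1p T p s h \<and>
                  (\<forall>\<alpha>. u\<^sub>0 \<alpha> \<in> D \<and> A (u\<^sub>0 \<alpha>) + f \<alpha> 0 \<in> closure D) \<and>
                  weighted_summable p s h u\<^sub>0 \<and>
                  weighted_summable p s h (\<lambda>\<alpha>. A (u\<^sub>0 \<alpha>)) \<longrightarrow>
            (\<exists>u. strict_solution T p s h D A f u\<^sub>0 u) \<and>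
            (\<exists>u. strict_weak_solution T p q s h D A f u\<^sub>0 u) \<and>
            (\<forall>u v. strict_solution T p s h D A f u\<^sub>0 u \<and> strict_solution T p s h D A f u\<^sub>0 v \<longrightarrow>
               (\<forall>\<alpha>. \<forall>t\<in>{0..T}. u \<alpha> t = v \<alpha> t)))"
proof -
  obtain R w C where "hy_operator D A R w C T"
    using hille_yosida_operator assms by blast
  then interpret hy_operator D A R w C T .
  interpret hy_dual_problem D A R w C T p s h q
    by unfold_locales (fact assms)+
  show ?thesis
  proof (intro conjI allI impI)
    fix f :: "nat \<Rightarrow> real \<Rightarrow> 'a" and u0 :: "nat \<Rightarrow> 'a"
    assume *: "f \<in> seq_Lp T p s h UNIV norm \<and> weighted_summable p s h u0 \<and> (\<forall>\<alpha>. u0 \<alpha> \<in> closure D)"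
    show "\<exists>u. F_solution T p s h D A f u0 u" using * by (intro F_solution_exists) auto
    show "\<exists>u. F_weak_solution T p q s h D A f u0 u" using * by (intro F_weak_solution_exists) auto
    fix u v :: "nat \<Rightarrow> real \<Rightarrow> 'a" and \<alpha>
    assume "F_solution T p s h D A f u0 u \<and> F_solution T p s h D A f u0 v"
    then show "AE t in lebesgue_on {0<..<T}. u \<alpha> t = v \<alpha> t"
      using * F_solution_unique[of f u0 u v \<alpha>] by blast
  next
    fix f :: "nat \<Rightarrow> real \<Rightarrow> 'a" and u0 :: "nat \<Rightarrow> 'a"
    assume *: "f \<in> seq_W1p T p s h \<and> (\<forall>\<alpha>. u0 \<alpha> \<in> D \<and> A (u0 \<alpha>) + f \<alpha> 0 \<in> closure D) \<and>
                  weighted_summable p s h u0 \<and> weighted_summable p s h (\<lambda>\<alpha>. A (u0 \<alpha>))"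
    show "\<exists>u. strict_solution T p s h D A f u0 u" using * by (intro strict_solution_exists) auto
    then show "\<exists>u. strict_weak_solution T p q s h D A f u0 u"
      using * strict_solution_weak seq_W1p_D(1) by blast
  next
    fix f :: "nat \<Rightarrow> real \<Rightarrow> 'a" and u0 :: "nat \<Rightarrow> 'a" and u v :: "nat \<Rightarrow> real \<Rightarrow> 'a" and \<alpha>
    assume *: "f \<in> seq_W1p T p s h \<and> (\<forall>\<alpha>. u0 \<alpha> \<in> D \<and> A (u0 \<alpha>) + f \<alpha> 0 \<in> closure D) \<and>
                  weighted_summable p s h u0 \<and> weighted_summable p s h (\<lambda>\<alpha>. A (u0 \<alpha>))"
      "strict_solution T p s h D A f u0 u \<and> strict_solution T p s h D A f u0 v"
    then show "\<forall>t\<in>{0..T}. u \<alpha> t = v \<alpha> t"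
      using strict_solution_unique by blast
  qed
qed

end
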